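(* Over $\mathsf{RCA}_0$, $\mathsf{HT}^{\leq 2}_4$ implies $\mathsf{ACA}_0$.
   Context: $\mathbb{N}$ denotes the positive integers. $\mathsf{RCA}_0$ and $\mathsf{ACA}_0$ are the standard systems of reverse mathematics. $\mathsf{HT}^{\leq 2}_4$ is the statement: for every $f:\mathbb{N}\to\{0,1,2,3\}$ there exists an infinite $H\subseteq\mathbb{N}$ such that $f$ is constant on the set of all $x$ and all $x+y$ with $x,y\in H$, $x\neq y$. *)

theory Defs
  imports Main
begin

section \<open>The language of second-order arithmetic\<close>

text \<open>
  The two-sorted first-order language with number terms built from 0, 1, +, \<open>\<cdot>\<close>, with atomic
  formulas \<open>s = t\<close>, \<open>s < t\<close>, \<open>t \<in> X\<close>, and with quantifiers over numbers and over sets.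
  Equality of sets is not primitive. Variables of both sorts are de Bruijn indices, counted
  separately: \<open>AllN\<close> binds the number variable 0 and \<open>AllS\<close> the set variable 0 of its body.
\<close>

datatype tm = Var nat | Zero | One | Plus tm tm | Times tm tm

datatype fm =
    Fls
  | Eq tm tm
  | Less tm tm
  | Mem tm nat
  | Imp fm fm  (infixr \<open>\<^bold>\<longrightarrow>\<close> 55)
  | AllN fm
  | AllS fm

abbreviation Neg :: "fm \<Rightarrow> fm" (\<open>\<^bold>\<not> _\<close> [70] 70)
  where "\<^bold>\<not> p \<equiv> p \<^bold>\<longrightarrow> Fls"

abbreviation Con :: "fm \<Rightarrow> fm \<Rightarrow> fm" (infixr \<open>\<^bold>\<and>\<close> 65)
  where "p \<^bold>\<and> q \<equiv> \<^bold>\<not> (p \<^bold>\<longrightarrow> \<^bold>\<not> q)"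

abbreviation Dis :: "fm \<Rightarrow> fm \<Rightarrow> fm" (infixr \<open>\<^bold>\<or>\<close> 60)
  where "p \<^bold>\<or> q \<equiv> \<^bold>\<not> p \<^bold>\<longrightarrow> q"

abbreviation Iff :: "fm \<Rightarrow> fm \<Rightarrow> fm" (infixr \<open>\<^bold>\<longleftrightarrow>\<close> 50)
  where "p \<^bold>\<longleftrightarrow> q \<equiv> (p \<^bold>\<longrightarrow> q) \<^bold>\<and> (q \<^bold>\<longrightarrow> p)"

abbreviation ExN :: "fm \<Rightarrow> fm"
  where "ExN p \<equiv> \<^bold>\<not> AllN (\<^bold>\<not> p)"

abbreviation ExS :: "fm \<Rightarrow> fm"
  where "ExS p \<equiv> \<^bold>\<not> AllS (\<^bold>\<not> p)"

primrec tsubst :: "(nat \<Rightarrow> tm) \<Rightarrow> tm \<Rightarrow> tm" where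
  "tsubst \<sigma> (Var i) = \<sigma> i"
| "tsubst \<sigma> Zero = Zero"
| "tsubst \<sigma> One = One"
| "tsubst \<sigma> (Plus s t) = Plus (tsubst \<sigma> s) (tsubst \<sigma> t)"
| "tsubst \<sigma> (Times s t) = Times (tsubst \<sigma> s) (tsubst \<sigma> t)"

abbreviation tshift :: "tm \<Rightarrow> tm"
  where "tshift \<equiv> tsubst (\<lambda>i. Var (Suc i))"

text \<open>
  Simultaneous capture-avoiding substitution of terms (\<open>\<sigma>\<close>) for number variables and of
  set variables (\<open>\<rho>\<close>) for set variables.
\<close>

primrec subst :: "(nat \<Rightarrow> tm) \<Rightarrow> (nat \<Rightarrow> nat) \<Rightarrow> fm \<Rightarrow> fm" where
  "subst \<sigma> \<rho> Fls = Fls"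
| "subst \<sigma> \<rho> (Eq s t) = Eq (tsubst \<sigma> s) (tsubst \<sigma> t)"
| "subst \<sigma> \<rho> (Less s t) = Less (tsubst \<sigma> s) (tsubst \<sigma> t)"
| "subst \<sigma> \<rho> (Mem t X) = Mem (tsubst \<sigma> t) (\<rho> X)"
| "subst \<sigma> \<rho> (p \<^bold>\<longrightarrow> q) = subst \<sigma> \<rho> p \<^bold>\<longrightarrow> subst \<sigma> \<rho> q"
| "subst \<sigma> \<rho> (AllN p) = AllN (subst (case_nat (Var 0) (\<lambda>i. tshift (\<sigma> i))) \<rho> p)"
| "subst \<sigma> \<rho> (AllS p) = AllS (subst \<sigma> (case_nat 0 (\<lambda>X. Suc (\<rho> X))) p)"

abbreviation shiftN :: "fm \<Rightarrow> fm"
  where "shiftN \<equiv> subst (\<lambda>i. Var (Suc i)) (\<lambda>X. X)"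

abbreviation shiftS :: "fm \<Rightarrow> fm"
  where "shiftS \<equiv> subst Var Suc"

abbreviation instN :: "tm \<Rightarrow> fm \<Rightarrow> fm"
  where "instN t \<equiv> subst (case_nat t Var) (\<lambda>X. X)"

abbreviation instS :: "nat \<Rightarrow> fm \<Rightarrow> fm"
  where "instS Y \<equiv> subst Var (case_nat Y (\<lambda>X. X))"

text \<open>
  All free number variables of \<open>p\<close> are below \<open>boundN p\<close>, all free set variables below
  \<open>boundS p\<close>, and these bounds are least.
\<close>

primrec tbound :: "tm \<Rightarrow> nat" where
  "tbound (Var i) = Suc i"
| "tbound Zero = 0"
| "tbound One = 0"
| "tbound (Plus s t) = max (tbound s) (tbound t)"
| "tbound (Times s t) = max (tbound s) (tbound t)"

primrec boundN :: "fm \<Rightarrow> nat" where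
  "boundN Fls = 0"
| "boundN (Eq s t) = max (tbound s) (tbound t)"
| "boundN (Less s t) = max (tbound s) (tbound t)"
| "boundN (Mem t X) = tbound t"
| "boundN (p \<^bold>\<longrightarrow> q) = max (boundN p) (boundN q)"
| "boundN (AllN p) = boundN p - 1"
| "boundN (AllS p) = boundN p"

primrec boundS :: "fm \<Rightarrow> nat" where
  "boundS Fls = 0"
| "boundS (Eq s t) = 0"
| "boundS (Less s t) = 0"
| "boundS (Mem t X) = Suc X"
| "boundS (p \<^bold>\<longrightarrow> q) = max (boundS p) (boundS q)"
| "boundS (AllN p) = boundS p"
| "boundS (AllS p) = boundS p - 1"

definition univ_closure :: "fm \<Rightarrow> fm"
  where "univ_closure p = (AllN ^^ boundN p) ((AllS ^^ boundS p) p)"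


section \<open>Provability\<close>

text \<open>
  Classical two-sorted natural deduction with equality for numbers. Shifting the hypotheses
  in \<open>AllN_I\<close> and \<open>AllS_I\<close> expresses the eigenvariable condition.
\<close>

inductive provable :: "fm set \<Rightarrow> fm \<Rightarrow> bool" (infix \<open>\<turnstile>\<close> 40) where
  Hyp: "p \<in> \<Gamma> \<Longrightarrow> \<Gamma> \<turnstile> p"
| Imp_I: "insert p \<Gamma> \<turnstile> q \<Longrightarrow> \<Gamma> \<turnstile> p \<^bold>\<longrightarrow> q"
| Imp_E: "\<Gamma> \<turnstile> p \<^bold>\<longrightarrow> q \<Longrightarrow> \<Gamma> \<turnstile> p \<Longrightarrow> \<Gamma> \<turnstile> q"
| Contr: "insert (\<^bold>\<not> p) \<Gamma> \<turnstile> Fls \<Longrightarrow> \<Gamma> \<turnstile> p"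
| AllN_I: "shiftN ` \<Gamma> \<turnstile> p \<Longrightarrow> \<Gamma> \<turnstile> AllN p"
| AllN_E: "\<Gamma> \<turnstile> AllN p \<Longrightarrow> \<Gamma> \<turnstile> instN t p"
| AllS_I: "shiftS ` \<Gamma> \<turnstile> p \<Longrightarrow> \<Gamma> \<turnstile> AllS p"
| AllS_E: "\<Gamma> \<turnstile> AllS p \<Longrightarrow> \<Gamma> \<turnstile> instS Y p"
| Eq_refl: "\<Gamma> \<turnstile> Eq t t"
| Eq_subst: "\<Gamma> \<turnstile> Eq s t \<Longrightarrow> \<Gamma> \<turnstile> instN s p \<Longrightarrow> \<Gamma> \<turnstile> instN t p"


section \<open>The systems \<open>RCA\<^sub>0\<close> and \<open>ACA\<^sub>0\<close>\<close>

text \<open>Bounded (\<open>\<Delta>\<^sup>0\<^sub>0\<close>) formulas; free set variables are allowed. The bound of a bounded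
  quantifier is shifted, so the quantified variable does not occur in it.\<close>

inductive bounded :: "fm \<Rightarrow> bool" where
  "bounded Fls"
| "bounded (Eq s t)"
| "bounded (Less s t)"
| "bounded (Mem t X)"
| "bounded p \<Longrightarrow> bounded q \<Longrightarrow> bounded (p \<^bold>\<longrightarrow> q)"
| "bounded p \<Longrightarrow> bounded (AllN (Less (Var 0) (tshift t) \<^bold>\<longrightarrow> p))"
| "bounded p \<Longrightarrow> bounded (ExN (Less (Var 0) (tshift t) \<^bold>\<and> p))"

definition Sigma01 :: "fm set" where "Sigma01 = {ExN p | p. bounded p}"

definition Pi01 :: "fm set" where "Pi01 = {AllN p | p. bounded p}"

primrec arithmetical :: "fm \<Rightarrow> bool" where
  "arithmetical Fls = True"
| "arithmetical (Eq s t) = True"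
| "arithmetical (Less s t) = True"
| "arithmetical (Mem t X) = True"
| "arithmetical (p \<^bold>\<longrightarrow> q) = (arithmetical p \<and> arithmetical q)"
| "arithmetical (AllN p) = arithmetical p"
| "arithmetical (AllS p) = False"

definition basic_axioms :: "fm set" where
  "basic_axioms =
    {\<^bold>\<not> Eq (Plus (Var 0) One) Zero,
     Eq (Plus (Var 0) One) (Plus (Var 1) One) \<^bold>\<longrightarrow> Eq (Var 0) (Var 1),
     Eq (Plus (Var 0) Zero) (Var 0),
     Eq (Plus (Var 0) (Plus (Var 1) One)) (Plus (Plus (Var 0) (Var 1)) One),
     Eq (Times (Var 0) Zero) Zero,
     Eq (Times (Var 0) (Plus (Var 1) One)) (Plus (Times (Var 0) (Var 1)) (Var 0)),
     \<^bold>\<not> Less (Var 0) Zero,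
     Less (Var 0) (Plus (Var 1) One) \<^bold>\<longleftrightarrow> Less (Var 0) (Var 1) \<^bold>\<or> Eq (Var 0) (Var 1)}"

text \<open>In the schemes, \<open>p(n)\<close> is a formula whose distinguished variable \<open>n\<close> is the number
  variable 0; all other free variables are parameters.\<close>

definition induction_for :: "fm \<Rightarrow> fm" where
  "induction_for p =
    instN Zero p \<^bold>\<and>
    AllN (p \<^bold>\<longrightarrow> subst (case_nat (Plus (Var 0) One) (\<lambda>i. Var (Suc i))) (\<lambda>X. X) p)
    \<^bold>\<longrightarrow> AllN p"

text \<open>\<open>\<exists>X \<forall>n (n \<in> X \<longleftrightarrow> p(n))\<close>, where the shift ensures that \<open>X\<close> is not free in \<open>p\<close>.\<close>

definition comprehension_for :: "fm \<Rightarrow> fm" where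
  "comprehension_for p = ExS (AllN (Mem (Var 0) 0 \<^bold>\<longleftrightarrow> shiftS p))"

definition RCA0 :: "fm set" where
  "RCA0 = univ_closure `
    (basic_axioms
     \<union> {induction_for p | p. p \<in> Sigma01}
     \<union> {AllN (p \<^bold>\<longleftrightarrow> q) \<^bold>\<longrightarrow> comprehension_for p | p q. p \<in> Sigma01 \<and> q \<in> Pi01})"

definition ACA0 :: "fm set" where
  "ACA0 = univ_closure `
    (basic_axioms
     \<union> {induction_for (Mem (Var 0) 0)}
     \<union> {comprehension_for p | p. arithmetical p})"


section \<open>Hindman's theorem for sums of at most two elements\<close>

primrec num :: "nat \<Rightarrow> tm" where
  "num 0 = Zero"
| "num (Suc k) = Plus (num k) One"

text \<open>The usual code \<open>(s + t)\<^sup>2 + s\<close> of the pair \<open>(s, t)\<close>.\<close>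

definition pair :: "tm \<Rightarrow> tm \<Rightarrow> tm" where
  "pair s t = Plus (Times (Plus s t) (Plus s t)) s"

text \<open>
  \<open>F\<close> is (the set of codes of the pairs in the graph of) a function from the positive integers
  to \<open>{0, \<dots>, k - 1}\<close>:
  \<open>\<forall>z \<in> F \<exists>x \<exists>y (0 < x \<and> y < k \<and> z = (x, y))\<close>, and
  \<open>\<forall>x > 0 \<exists>y (x, y) \<in> F\<close>, and
  \<open>\<forall>x \<forall>y \<forall>z ((x, y) \<in> F \<and> (x, z) \<in> F \<longrightarrow> y = z)\<close>.
\<close>

definition colouring :: "nat \<Rightarrow> nat \<Rightarrow> fm" where
  "colouring k F =
    AllN (Mem (Var 0) F \<^bold>\<longrightarrow>
      ExN (ExN (Less Zero (Var 1) \<^bold>\<and> Less (Var 0) (num k) \<^bold>\<and> Eq (Var 2) (pair (Var 1) (Var 0)))))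
    \<^bold>\<and> AllN (Less Zero (Var 0) \<^bold>\<longrightarrow> ExN (Mem (pair (Var 1) (Var 0)) F))
    \<^bold>\<and> AllN (AllN (AllN
        (Mem (pair (Var 2) (Var 1)) F \<^bold>\<and> Mem (pair (Var 2) (Var 0)) F \<^bold>\<longrightarrow> Eq (Var 1) (Var 0))))"

text \<open>\<open>H\<close> is an infinite, i.e. unbounded, set of positive integers.\<close>

definition infinite_positive :: "nat \<Rightarrow> fm" where
  "infinite_positive H =
    AllN (Mem (Var 0) H \<^bold>\<longrightarrow> Less Zero (Var 0))
    \<^bold>\<and> AllN (ExN (Less (Var 1) (Var 0) \<^bold>\<and> Mem (Var 0) H))"

text \<open>\<open>\<exists>c (\<forall>x \<in> H. F(x) = c) \<and> (\<forall>x \<in> H \<forall>y \<in> H (x \<noteq> y \<longrightarrow> F(x + y) = c))\<close>\<close>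

definition sums_homogeneous :: "nat \<Rightarrow> nat \<Rightarrow> fm" where
  "sums_homogeneous F H =
    ExN (AllN (Mem (Var 0) H \<^bold>\<longrightarrow> Mem (pair (Var 0) (Var 1)) F)
      \<^bold>\<and> AllN (AllN (Mem (Var 1) H \<^bold>\<and> Mem (Var 0) H \<^bold>\<and> \<^bold>\<not> Eq (Var 1) (Var 0) \<^bold>\<longrightarrow>
          Mem (pair (Plus (Var 1) (Var 0)) (Var 2)) F)))"

definition HT_le2 :: "nat \<Rightarrow> fm" where
  "HT_le2 k =
    AllS (colouring k 0 \<^bold>\<longrightarrow> ExS (infinite_positive 0 \<^bold>\<and> sums_homogeneous 1 0))"

end

theory Submission
  imports Defs "HOL-Library.Countable"
begin

text \<open>
  By completeness it suffices to show that a (possibly nonstandard) model of \<open>RCA\<^sub>0\<close> that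
  satisfies \<open>HT\<close> for sums of at most two elements and four colours is closed under projection:
  if \<open>T\<close> is a set of the model, so is \<open>A = {m. \<exists>t. (m, t) \<in> T}\<close>. Arithmetical comprehension
  follows by induction on formulas.

  A number \<open>n\<close> is coloured by two bits. The first one is its last nonzero digit in base 3. If
  \<open>x \<noteq> y\<close> ended in the same digit at the same position, then \<open>x + y\<close> would end in the other digit;
  hence in a homogeneous set \<open>H\<close> no two elements end at the same position, and \<open>H\<close> contains
  multiples of every power of 3. The second bit is the parity of the number of gaps in the base 3
  expansion of \<open>n\<close> during which \<open>T\<close> enumerates a new \<open>m\<close> below the lowest power of 3 occurring in
  \<open>n\<close>. Let \<open>x \<in> H\<close> and let \<open>y \<in> H\<close> be divisible by a large power of 3. In \<open>x + y\<close> the gap between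
  \<open>x\<close> and \<open>y\<close> is added to the gaps of \<open>x\<close>, while everything that will ever be enumerated below
  \<open>x\<close> has appeared before the gaps of \<open>y\<close>. Since \<open>x\<close> and \<open>x + y\<close> have the same colour, nothing
  is enumerated in the gap between them. So the members of \<open>A\<close> below a power of 3 dividing \<open>x\<close>
  are enumerated before stage \<open>x\<close>, which gives a \<open>\<Delta>\<^sup>0\<^sub>1\<close> definition of \<open>A\<close> from \<open>H\<close>.
\<close>

section \<open>Substitution\<close>

text \<open>Base 3 is chosen because adding two equal last nonzero digits exchanges 1 and 2 and
  keeps the position, so one bit of colour detects equal positions. A gap concerns only numbers
  below a power of 3 dividing its lower part; hence the gaps of \<open>x + y\<close> above
  \<open>x\<close> still concern only numbers below \<open>x\<close>, and the stages that matter can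
  be bounded before \<open>y\<close> is chosen.

  The obstacle is that numbers may be nonstandard while only \<Sigma>1 induction is at hand. Both
  the stage after which nothing below \<open>x\<close> is new and the pigeonhole among residues
  modulo a power of 3 come from strong bounding. That in turn rests on coding a bounded \<Sigma>1
  set by one number, the least one with a \<Pi>1 property, with coprime divisors as in Goedel's beta
  function. The same codes replace recursion: parity along a chain is read off from finite
  approximations that exist and agree, which makes it \<Delta>1.

  Definability is treated semantically, by closure properties of relations, and the arithmetic is
  done in an ordered ring whose non-negative part is the model, so that subtraction is
  available.\<close>

lemma tsubst_tsubst: "tsubst \<sigma> (tsubst \<tau> t) = tsubst (\<lambda>i. tsubst \<sigma> (\<tau> i)) t"
  by (induction t) auto

lemma tsubst_cong: "(\<And>i. i < tbound t \<Longrightarrow> \<sigma> i = \<tau> i) \<Longrightarrow> tsubst \<sigma> t = tsubst \<tau> t"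
  by (induction t) auto

lemma tsubst_Var [simp]: "tsubst Var t = t"
  by (induction t) auto

text \<open>Agreement is asked only below the bounds, so a renaming that treats a fresh index
  specially still acts like the plain shift. The eigenvariable arguments rest on this.\<close>

lemma subst_cong:
  assumes "\<And>i. i < boundN p \<Longrightarrow> \<sigma> i = \<tau> i" and "\<And>X. X < boundS p \<Longrightarrow> \<rho> X = \<pi> X"
  shows "subst \<sigma> \<rho> p = subst \<tau> \<pi> p"
  using assms
proof (induction p arbitrary: \<sigma> \<tau> \<rho> \<pi>)
  case (Imp p q)
  have "subst \<sigma> \<rho> p = subst \<tau> \<pi> p" by (rule Imp.IH(1)) (simp_all add: Imp.prems)
  moreover have "subst \<sigma> \<rho> q = subst \<tau> \<pi> q" by (rule Imp.IH(2)) (simp_all add: Imp.prems)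
  ultimately show ?case by simp
next
  case (AllN p)
  have "subst (case_nat (Var 0) (\<lambda>i. tshift (\<sigma> i))) \<rho> p = subst (case_nat (Var 0) (\<lambda>i. tshift (\<tau> i))) \<pi> p"
    using AllN.prems by (intro AllN.IH) (auto split: nat.split)
  then show ?case by simp
next
  case (AllS p)
  have "subst \<sigma> (case_nat 0 (\<lambda>X. Suc (\<rho> X))) p = subst \<tau> (case_nat 0 (\<lambda>X. Suc (\<pi> X))) p"
    using AllS.prems by (intro AllS.IH) (auto split: nat.split)
  then show ?case by simp
qed (auto intro: tsubst_cong)

lemma case_nat_Var [simp]: "case_nat (Var 0) (\<lambda>i. Var (Suc i)) = Var"
  by (auto split: nat.split)

lemma case_nat_Suc [simp]: "case_nat 0 (\<lambda>X. Suc X) = (\<lambda>X. X)"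
  by (auto split: nat.split)

lemma subst_Var [simp]: "subst Var (\<lambda>X. X) p = p"
  by (induction p) auto

lemma subst_subst:
  "subst \<sigma> \<rho> (subst \<tau> \<pi> p) = subst (\<lambda>i. tsubst \<sigma> (\<tau> i)) (\<lambda>X. \<rho> (\<pi> X)) p"
proof (induction p arbitrary: \<sigma> \<tau> \<rho> \<pi>)
  case (AllN p)
  have "(\<lambda>i. tsubst (case_nat (Var 0) (\<lambda>i. tshift (\<sigma> i))) (case_nat (Var 0) (\<lambda>i. tshift (\<tau> i)) i))
      = case_nat (Var 0) (\<lambda>i. tshift (tsubst \<sigma> (\<tau> i)))"
    by (auto split: nat.split simp: tsubst_tsubst)
  then show ?case by (simp add: AllN.IH)
next
  case (AllS p)
  have "(\<lambda>X. case_nat 0 (\<lambda>X. Suc (\<rho> X)) (case_nat 0 (\<lambda>X. Suc (\<pi> X)) X))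
      = case_nat 0 (\<lambda>X. Suc (\<rho> (\<pi> X)))"
    by (auto split: nat.split)
  then show ?case by (simp add: AllS.IH)
qed (auto simp: tsubst_tsubst)

lemma boundN_funpow_AllN: "boundN ((AllN ^^ n) p) = boundN p - n"
  by (induction n) auto

lemma boundN_funpow_AllS: "boundN ((AllS ^^ n) p) = boundN p"
  by (induction n) auto

lemma boundS_funpow_AllN: "boundS ((AllN ^^ n) p) = boundS p"
  by (induction n) auto

lemma boundS_funpow_AllS: "boundS ((AllS ^^ n) p) = boundS p - n"
  by (induction n) auto

lemma boundN_univ_closure: "boundN (univ_closure p) = 0"
  and boundS_univ_closure: "boundS (univ_closure p) = 0"
  by (simp_all add: univ_closure_def boundN_funpow_AllN boundN_funpow_AllS
      boundS_funpow_AllN boundS_funpow_AllS)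


section \<open>Completeness\<close>

lemma provable_mono: "\<Gamma> \<turnstile> p \<Longrightarrow> \<Gamma> \<subseteq> \<Delta> \<Longrightarrow> \<Delta> \<turnstile> p"
proof (induction arbitrary: \<Delta> rule: provable.induct)
  case (Imp_I p \<Gamma> q)
  show ?case by (rule provable.Imp_I) (use Imp_I in auto)
next
  case (Contr p \<Gamma>)
  show ?case by (rule provable.Contr) (use Contr in auto)
next
  case (AllN_I \<Gamma> p)
  show ?case by (rule provable.AllN_I) (use AllN_I in blast)
next
  case (AllS_I \<Gamma> p)
  show ?case by (rule provable.AllS_I) (use AllS_I in blast)
next
  case (Eq_subst \<Gamma> s t p)
  show ?case by (rule provable.Eq_subst[OF Eq_subst.IH]) (use Eq_subst.prems in auto)
qed (auto intro: provable.intros)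

text \<open>The quantifier rules express eigenvariables by shifting. Renaming a whole derivation is
  what connects them with the usual form, in which a fresh free variable is generalised.\<close>

lemma provable_subst: "\<Gamma> \<turnstile> p \<Longrightarrow> subst \<sigma> \<rho> ` \<Gamma> \<turnstile> subst \<sigma> \<rho> p"
proof (induction arbitrary: \<sigma> \<rho> rule: provable.induct)
  case (Hyp p \<Gamma>)
  then show ?case by (blast intro: provable.Hyp)
next
  case (Imp_I p \<Gamma> q)
  then show ?case by (auto intro!: provable.Imp_I)
next
  case (Imp_E \<Gamma> p q)
  show ?case using provable.Imp_E[OF Imp_E.IH(1)[of \<sigma> \<rho>, simplified] Imp_E.IH(2)] .
next
  case (Contr p \<Gamma>)
  show ?case by (rule provable.Contr) (use Contr.IH[of \<sigma> \<rho>] in simp)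
next
  case (AllN_I \<Gamma> p)
  let ?\<sigma> = "case_nat (Var 0) (\<lambda>i. tshift (\<sigma> i))"
  have "subst ?\<sigma> \<rho> ` shiftN ` \<Gamma> = shiftN ` subst \<sigma> \<rho> ` \<Gamma>"
    by (simp add: image_image subst_subst)
  then show ?case using AllN_I.IH[of ?\<sigma> \<rho>] by (auto intro: provable.AllN_I)
next
  case (AllN_E \<Gamma> p t)
  have "instN (tsubst \<sigma> t) (subst (case_nat (Var 0) (\<lambda>i. tshift (\<sigma> i))) \<rho> p) = subst \<sigma> \<rho> (instN t p)"
    by (auto simp: subst_subst tsubst_tsubst split: nat.split intro!: subst_cong)
  then show ?case using provable.AllN_E[OF AllN_E.IH[of \<sigma> \<rho>, simplified]] by metis
next
  case (AllS_I \<Gamma> p)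
  let ?\<rho> = "case_nat 0 (\<lambda>X. Suc (\<rho> X))"
  have "subst \<sigma> ?\<rho> ` shiftS ` \<Gamma> = shiftS ` subst \<sigma> \<rho> ` \<Gamma>"
    by (simp add: image_image subst_subst)
  then show ?case using AllS_I.IH[of \<sigma> ?\<rho>] by (auto intro: provable.AllS_I)
next
  case (AllS_E \<Gamma> p Y)
  have "instS (\<rho> Y) (subst \<sigma> (case_nat 0 (\<lambda>X. Suc (\<rho> X))) p) = subst \<sigma> \<rho> (instS Y p)"
    by (auto simp: subst_subst tsubst_tsubst split: nat.split intro!: subst_cong)
  then show ?case using provable.AllS_E[OF AllS_E.IH[of \<sigma> \<rho>, simplified]] by metis
next
  case (Eq_refl \<Gamma> t)
  then show ?case by (auto intro: provable.Eq_refl)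
next
  case (Eq_subst \<Gamma> s t p)
  have *: "instN (tsubst \<sigma> t) (subst (case_nat (Var 0) (\<lambda>i. tshift (\<sigma> i))) \<rho> p) = subst \<sigma> \<rho> (instN t p)" for t
    by (auto simp: subst_subst tsubst_tsubst split: nat.split intro!: subst_cong)
  show ?case
    using provable.Eq_subst[OF Eq_subst.IH(1)[of \<sigma> \<rho>, simplified], of "subst (case_nat (Var 0) (\<lambda>i. tshift (\<sigma> i))) \<rho> p"]
      Eq_subst.IH(2)[of \<sigma> \<rho>] * by metis
qed

text \<open>This transfers consistency from the stages of an increasing chain of theories to their
  union.\<close>

lemma provable_compact: "\<Gamma> \<turnstile> p \<Longrightarrow> \<exists>\<Gamma>'. finite \<Gamma>' \<and> \<Gamma>' \<subseteq> \<Gamma> \<and> \<Gamma>' \<turnstile> p"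
proof (induction rule: provable.induct)
  case (Hyp p \<Gamma>)
  then show ?case by (intro exI[of _ "{p}"]) (auto intro: provable.Hyp)
next
  case (Imp_I p \<Gamma> q)
  then obtain \<Gamma>' where "finite \<Gamma>'" "\<Gamma>' \<subseteq> insert p \<Gamma>" "\<Gamma>' \<turnstile> q" by blast
  moreover from this have "insert p (\<Gamma>' - {p}) \<turnstile> q" by (elim provable_mono) blast
  ultimately show ?case by (intro exI[of _ "\<Gamma>' - {p}"] conjI provable.Imp_I) auto
next
  case (Imp_E \<Gamma> p q)
  then obtain \<Gamma>' \<Gamma>'' where fin: "finite (\<Gamma>' \<union> \<Gamma>'')" "\<Gamma>' \<union> \<Gamma>'' \<subseteq> \<Gamma>"
    and prov: "\<Gamma>' \<turnstile> p \<^bold>\<longrightarrow> q" "\<Gamma>'' \<turnstile> p" by blast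
  have "\<Gamma>' \<union> \<Gamma>'' \<turnstile> p \<^bold>\<longrightarrow> q" "\<Gamma>' \<union> \<Gamma>'' \<turnstile> p"
    using prov provable_mono by (metis Un_upper1, metis Un_upper2)
  then show ?case using fin by (meson provable.Imp_E)
next
  case (Contr p \<Gamma>)
  then obtain \<Gamma>' where "finite \<Gamma>'" "\<Gamma>' \<subseteq> insert (\<^bold>\<not> p) \<Gamma>" "\<Gamma>' \<turnstile> Fls" by blast
  moreover from this have "insert (\<^bold>\<not> p) (\<Gamma>' - {\<^bold>\<not> p}) \<turnstile> Fls" by (elim provable_mono) blast
  then have "\<Gamma>' - {\<^bold>\<not> p} \<turnstile> p" by (rule provable.Contr)
  ultimately show ?case by (intro exI[of _ "\<Gamma>' - {\<^bold>\<not> p}"]) auto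
next
  case (AllN_I \<Gamma> p)
  then show ?case by (metis finite_subset_image provable.AllN_I)
next
  case (AllN_E \<Gamma> p t)
  then obtain \<Gamma>' where "finite \<Gamma>'" "\<Gamma>' \<subseteq> \<Gamma>" "\<Gamma>' \<turnstile> AllN p" by blast
  then show ?case using provable.AllN_E[of \<Gamma>' p t] by blast
next
  case (AllS_I \<Gamma> p)
  then show ?case by (metis finite_subset_image provable.AllS_I)
next
  case (AllS_E \<Gamma> p Y)
  then obtain \<Gamma>' where "finite \<Gamma>'" "\<Gamma>' \<subseteq> \<Gamma>" "\<Gamma>' \<turnstile> AllS p" by blast
  then show ?case using provable.AllS_E[of \<Gamma>' p Y] by blast
next
  case (Eq_refl \<Gamma> t)
  show ?case by (intro exI[of _ "{}"]) (simp add: provable.Eq_refl)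
next
  case (Eq_subst \<Gamma> s t p)
  then obtain \<Gamma>' \<Gamma>'' where fin: "finite (\<Gamma>' \<union> \<Gamma>'')" "\<Gamma>' \<union> \<Gamma>'' \<subseteq> \<Gamma>"
    and prov: "\<Gamma>' \<turnstile> Eq s t" "\<Gamma>'' \<turnstile> instN s p" by blast
  have "\<Gamma>' \<union> \<Gamma>'' \<turnstile> Eq s t" "\<Gamma>' \<union> \<Gamma>'' \<turnstile> instN s p"
    using prov provable_mono by (metis Un_upper1, metis Un_upper2)
  then have "\<Gamma>' \<union> \<Gamma>'' \<turnstile> instN t p" by (rule provable.Eq_subst)
  then show ?case using fin by blast
qed

lemma provable_Fls: "\<Gamma> \<turnstile> Fls \<Longrightarrow> \<Gamma> \<turnstile> p"
  by (rule provable.Contr) (erule provable_mono, blast)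

section \<open>Generalisation over fresh variables\<close>

definition below :: "nat \<Rightarrow> fm set \<Rightarrow> bool"
  where "below k \<Gamma> \<longleftrightarrow> (\<forall>q\<in>\<Gamma>. boundN q \<le> k \<and> boundS q \<le> k)"

text \<open>The renaming that sends \<open>Var k\<close> to \<open>Var 0\<close> and shifts every
  other variable turns \<open>instN (Var k) p\<close> back into \<open>p\<close> and acts as
  \<open>shiftN\<close> on the hypotheses, since \<open>k\<close> is free in neither
  \<open>AllN p\<close> nor \<open>\<Gamma>\<close>.\<close>

lemma provable_AllN_fresh:
  assumes "\<Gamma> \<turnstile> instN (Var k) p" and "below k \<Gamma>" and "boundN (AllN p) \<le> k"
  shows "\<Gamma> \<turnstile> AllN p"
proof (rule AllN_I)
  let ?\<sigma> = "\<lambda>i. if i = k then Var 0 else Var (Suc i)"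
  have "subst ?\<sigma> (\<lambda>X. X) q = shiftN q" if "q \<in> \<Gamma>" for q
    using that assms(2) by (intro subst_cong) (auto simp: below_def)
  then have "subst ?\<sigma> (\<lambda>X. X) ` \<Gamma> = shiftN ` \<Gamma>" by (rule image_cong[OF refl])
  moreover have "subst ?\<sigma> (\<lambda>X. X) (instN (Var k) p) = subst Var (\<lambda>X. X) p"
    unfolding subst_subst using assms(3) by (intro subst_cong) (auto split: nat.split)
  ultimately show "shiftN ` \<Gamma> \<turnstile> p"
    using provable_subst[OF assms(1), of ?\<sigma> "\<lambda>X. X"] by simp
qed

lemma provable_AllS_fresh:
  assumes "\<Gamma> \<turnstile> instS k p" and "below k \<Gamma>" and "boundS (AllS p) \<le> k"
  shows "\<Gamma> \<turnstile> AllS p"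
proof (rule AllS_I)
  let ?\<rho> = "\<lambda>i. if i = k then 0 else Suc i"
  have "subst Var ?\<rho> q = shiftS q" if "q \<in> \<Gamma>" for q
    using that assms(2) by (intro subst_cong) (auto simp: below_def)
  then have "subst Var ?\<rho> ` \<Gamma> = shiftS ` \<Gamma>" by (rule image_cong[OF refl])
  moreover have "subst Var ?\<rho> (instS k p) = subst Var (\<lambda>X. X) p"
    unfolding subst_subst using assms(3) by (intro subst_cong) (auto split: nat.split)
  ultimately show "shiftS ` \<Gamma> \<turnstile> p"
    using provable_subst[OF assms(1), of Var ?\<rho>] by simp
qed

section \<open>Henkin extensions of closed consistent theories\<close>

instance tm :: countable by countable_datatype
instance fm :: countable by countable_datatype

text \<open>The variables themselves serve as Henkin constants. As the starting theory is closed and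
  each stage adds finitely many formulas, all sufficiently large indices stay fresh.\<close>

definition henkin :: "fm set \<Rightarrow> bool" where
  "henkin \<Delta> \<longleftrightarrow> \<not> \<Delta> \<turnstile> Fls \<and> (\<forall>p. p \<in> \<Delta> \<or> \<^bold>\<not> p \<in> \<Delta>)
    \<and> (\<forall>p. \<^bold>\<not> AllN p \<in> \<Delta> \<longrightarrow> (\<exists>k. \<^bold>\<not> instN (Var k) p \<in> \<Delta>))
    \<and> (\<forall>p. \<^bold>\<not> AllS p \<in> \<Delta> \<longrightarrow> (\<exists>k. \<^bold>\<not> instS k p \<in> \<Delta>))"

definition fresh :: "fm set \<Rightarrow> nat" where "fresh \<Gamma> = (SOME k. below k \<Gamma>)"

text \<open>A set with at most one member; it is empty unless \<open>\<phi>\<close> is a negated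
  universal formula, which spares a case distinction in the construction.\<close>

definition witness :: "nat \<Rightarrow> fm \<Rightarrow> fm set" where
  "witness k \<phi> = {\<^bold>\<not> instN (Var k) p | p. \<phi> = \<^bold>\<not> AllN p} \<union> {\<^bold>\<not> instS k p | p. \<phi> = \<^bold>\<not> AllS p}"

primrec henkin_stage :: "fm set \<Rightarrow> nat \<Rightarrow> fm set" where
  "henkin_stage \<Gamma> 0 = \<Gamma>"
| "henkin_stage \<Gamma> (Suc n) =
    (let \<Delta> = insert (from_nat n) (henkin_stage \<Gamma> n)
     in if \<Delta> \<turnstile> Fls then henkin_stage \<Gamma> n else \<Delta> \<union> witness (fresh \<Delta>) (from_nat n))"

lemma below_Un_finite:
  assumes "\<exists>k. below k \<Gamma>" and "finite \<Delta>" shows "\<exists>k. below k (\<Gamma> \<union> \<Delta>)"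
proof -
  obtain k where k: "below k \<Gamma>" using assms by blast
  define m where "m = k + (\<Sum>q\<in>\<Delta>. boundN q + boundS q)"
  have "boundN q + boundS q \<le> (\<Sum>q\<in>\<Delta>. boundN q + boundS q)" if "q \<in> \<Delta>" for q
    using member_le_sum[OF that, of "\<lambda>q. boundN q + boundS q"] assms(2) by simp
  then have "below m (\<Gamma> \<union> \<Delta>)"
    using k by (fastforce simp: below_def m_def)
  then show ?thesis by blast
qed

lemma finite_witness: "finite (witness k \<phi>)"
proof -
  have "finite {p. \<phi> = \<^bold>\<not> AllN p}" by (cases "\<exists>p. \<phi> = \<^bold>\<not> AllN p") auto
  moreover have "finite {p. \<phi> = \<^bold>\<not> AllS p}" by (cases "\<exists>p. \<phi> = \<^bold>\<not> AllS p") auto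
  ultimately show ?thesis unfolding witness_def by simp
qed

lemma below_henkin_stage: "below 0 \<Gamma> \<Longrightarrow> \<exists>k. below k (henkin_stage \<Gamma> n)"
proof (induction n)
  case (Suc n)
  have "henkin_stage \<Gamma> (Suc n) \<subseteq> henkin_stage \<Gamma> n \<union>
      ({from_nat n} \<union> witness (fresh (insert (from_nat n) (henkin_stage \<Gamma> n))) (from_nat n))"
    by (auto simp: Let_def)
  moreover have "\<exists>k. below k (henkin_stage \<Gamma> n \<union>
      ({from_nat n} \<union> witness (fresh (insert (from_nat n) (henkin_stage \<Gamma> n))) (from_nat n)))"
    using Suc by (intro below_Un_finite) (auto simp: finite_witness)
  ultimately show ?case unfolding below_def by (meson subsetD)
qed auto

text \<open>If the negated instance at the fresh variable were inconsistent with
  \<open>\<Delta>\<close>, the instance would be provable, hence also the universal formula, whose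
  negation \<open>\<phi>\<close> is in \<open>\<Delta>\<close>.\<close>

lemma witness_consistent:
  assumes "\<not> \<Delta> \<turnstile> Fls" and "below k \<Delta>" and "\<phi> \<in> \<Delta>"
  shows "\<not> \<Delta> \<union> witness k \<phi> \<turnstile> Fls"
proof -
  consider p where "\<phi> = \<^bold>\<not> AllN p" | p where "\<phi> = \<^bold>\<not> AllS p"
    | "\<nexists>p. \<phi> = \<^bold>\<not> AllN p" "\<nexists>p. \<phi> = \<^bold>\<not> AllS p" by blast
  then show ?thesis
  proof cases
    case (1 p)
    have "\<not> \<Delta> \<turnstile> instN (Var k) p"
    proof
      assume "\<Delta> \<turnstile> instN (Var k) p"
      then have "\<Delta> \<turnstile> AllN p"
        using assms 1 by (intro provable_AllN_fresh) (auto simp: below_def)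
      then show False using assms 1 by (meson Hyp Imp_E)
    qed
    then show ?thesis using 1 Contr by (auto simp: witness_def)
  next
    case (2 p)
    have "\<not> \<Delta> \<turnstile> instS k p"
    proof
      assume "\<Delta> \<turnstile> instS k p"
      then have "\<Delta> \<turnstile> AllS p"
        using assms 2 by (intro provable_AllS_fresh) (auto simp: below_def)
      then show False using assms 2 by (meson Hyp Imp_E)
    qed
    then show ?thesis using 2 Contr by (auto simp: witness_def)
  next
    case 3
    then show ?thesis using assms by (simp add: witness_def)
  qed
qed

lemma henkin_stage_consistent:
  assumes "\<not> \<Gamma> \<turnstile> Fls" and "below 0 \<Gamma>" shows "\<not> henkin_stage \<Gamma> n \<turnstile> Fls"
proof (induction n)
  case (Suc n)
  let ?\<Delta> = "insert (from_nat n) (henkin_stage \<Gamma> n)"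
  have "\<exists>k. below k ?\<Delta>"
    using below_Un_finite[OF below_henkin_stage[OF assms(2)], of "{from_nat n}" n] by simp
  then have "below (fresh ?\<Delta>) ?\<Delta>" unfolding fresh_def by (rule someI_ex)
  then show ?case
    using Suc witness_consistent[of ?\<Delta> "fresh ?\<Delta>" "from_nat n"] by (auto simp: Let_def)
qed (use assms in simp)

lemma henkin_stage_mono: "m \<le> n \<Longrightarrow> henkin_stage \<Gamma> m \<subseteq> henkin_stage \<Gamma> n"
  by (rule lift_Suc_mono_le[of "henkin_stage \<Gamma>"]) (auto simp: Let_def)

lemma henkin_extension:
  assumes "\<not> \<Gamma> \<turnstile> Fls" and "below 0 \<Gamma>"
  shows "\<exists>\<Delta>. \<Gamma> \<subseteq> \<Delta> \<and> henkin \<Delta>"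
proof (intro exI conjI)
  let ?\<Delta> = "\<Union>n. henkin_stage \<Gamma> n"
  show "\<Gamma> \<subseteq> ?\<Delta>" using henkin_stage.simps(1) by blast
  have stage: "\<exists>n. F \<subseteq> henkin_stage \<Gamma> n" if "finite F" "F \<subseteq> ?\<Delta>" for F
    using that
  proof (induction F rule: finite_induct)
    case (insert q F)
    then obtain m n where "F \<subseteq> henkin_stage \<Gamma> m" "q \<in> henkin_stage \<Gamma> n" by blast
    then have "insert q F \<subseteq> henkin_stage \<Gamma> (max m n)"
      using henkin_stage_mono[of m "max m n" \<Gamma>] henkin_stage_mono[of n "max m n" \<Gamma>] by auto
    then show ?case by blast
  qed blast
  have cons: "\<not> ?\<Delta> \<turnstile> Fls"
  proof
    assume "?\<Delta> \<turnstile> Fls"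
    then obtain F n where "F \<turnstile> Fls" "F \<subseteq> henkin_stage \<Gamma> n"
      using provable_compact stage by metis
    then show False using henkin_stage_consistent[OF assms] provable_mono by blast
  qed
  have enter: "henkin_stage \<Gamma> (Suc (to_nat p)) =
      insert p (henkin_stage \<Gamma> (to_nat p)) \<union> witness (fresh (insert p (henkin_stage \<Gamma> (to_nat p)))) p"
    if "\<not> insert p ?\<Delta> \<turnstile> Fls" for p
  proof -
    have "\<not> insert p (henkin_stage \<Gamma> (to_nat p)) \<turnstile> Fls"
      using that by (meson UN_upper UNIV_I insert_mono provable_mono)
    then show ?thesis by (simp add: Let_def)
  qed
  have max: "p \<in> ?\<Delta> \<or> \<^bold>\<not> p \<in> ?\<Delta>" for p
  proof -
    have "\<not> insert p ?\<Delta> \<turnstile> Fls \<or> \<not> insert (\<^bold>\<not> p) ?\<Delta> \<turnstile> Fls"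
      using cons by (meson Contr Imp_E Imp_I)
    then show ?thesis using enter by blast
  qed
  \<comment> \<open>This covers also the formulas present from the start: they are processed once
    more when their number comes up, and then receive a witness.\<close>
  have wit: "\<exists>k. witness k p \<subseteq> ?\<Delta>" if "p \<in> ?\<Delta>" for p
  proof -
    have "insert p ?\<Delta> = ?\<Delta>" using that by blast
    then have "witness (fresh (insert p (henkin_stage \<Gamma> (to_nat p)))) p \<subseteq> henkin_stage \<Gamma> (Suc (to_nat p))"
      using enter[of p] cons by (metis sup_ge2)
    then show ?thesis by blast
  qed
  have "\<exists>k. \<^bold>\<not> instN (Var k) p \<in> ?\<Delta>" if "\<^bold>\<not> AllN p \<in> ?\<Delta>" for p
    using wit[OF that] by (auto simp: witness_def)
  moreover have "\<exists>k. \<^bold>\<not> instS k p \<in> ?\<Delta>" if "\<^bold>\<not> AllS p \<in> ?\<Delta>" for p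
    using wit[OF that] by (auto simp: witness_def)
  ultimately show "henkin ?\<Delta>" unfolding henkin_def using cons max by blast
qed

section \<open>Semantics\<close>

primrec eval :: "(nat \<Rightarrow> 'a::{zero,one,plus,times}) \<Rightarrow> tm \<Rightarrow> 'a" where
  "eval e (Var i) = e i"
| "eval e Zero = 0"
| "eval e One = 1"
| "eval e (Plus s t) = eval e s + eval e t"
| "eval e (Times s t) = eval e s * eval e t"

text \<open>The number domain is an explicit set and not the whole type because it will later be the
  non-negative part of a ring.\<close>

primrec sat :: "'a::{zero,one,plus,times,ord} set \<Rightarrow> 'a set set \<Rightarrow> (nat \<Rightarrow> 'a) \<Rightarrow> (nat \<Rightarrow> 'a set) \<Rightarrow> fm \<Rightarrow> bool"
  where
  "sat D S e v Fls = False"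
| "sat D S e v (Eq s t) = (eval e s = eval e t)"
| "sat D S e v (Less s t) = (eval e s < eval e t)"
| "sat D S e v (Mem t X) = (eval e t \<in> v X)"
| "sat D S e v (p \<^bold>\<longrightarrow> q) = (sat D S e v p \<longrightarrow> sat D S e v q)"
| "sat D S e v (AllN p) = (\<forall>x\<in>D. sat D S (case_nat x e) v p)"
| "sat D S e v (AllS p) = (\<forall>X\<in>S. sat D S e (case_nat X v) p)"

lemma eval_tsubst: "eval e (tsubst \<sigma> t) = eval (\<lambda>i. eval e (\<sigma> i)) t"
  by (induction t) auto

lemma eval_cong: "(\<And>i. i < tbound t \<Longrightarrow> e i = f i) \<Longrightarrow> eval e t = eval f t"
  by (induction t) auto

lemma sat_subst:
  "sat D S e v (subst \<sigma> \<rho> p) = sat D S (\<lambda>i. eval e (\<sigma> i)) (\<lambda>X. v (\<rho> X)) p"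
proof (induction p arbitrary: e v \<sigma> \<rho>)
  case (AllN p)
  have "(\<lambda>i. eval (case_nat x e) (case_nat (Var 0) (\<lambda>i. tshift (\<sigma> i)) i)) = case_nat x (\<lambda>i. eval e (\<sigma> i))" for x
    by (auto split: nat.split simp: eval_tsubst)
  then show ?case by (simp add: AllN.IH)
next
  case (AllS p)
  have "(\<lambda>i. case_nat X v (case_nat 0 (\<lambda>i. Suc (\<rho> i)) i)) = case_nat X (\<lambda>i. v (\<rho> i))" for X
    by (rule ext) (simp split: nat.split)
  then show ?case by (simp add: AllS.IH)
qed (auto simp: eval_tsubst)

lemma sat_cong:
  assumes "\<And>i. i < boundN p \<Longrightarrow> e i = f i" and "\<And>X. X < boundS p \<Longrightarrow> v X = w X"
  shows "sat D S e v p = sat D S f w p"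
  using assms
proof (induction p arbitrary: e f v w)
  case (Eq s t)
  then show ?case using eval_cong[of s e f] eval_cong[of t e f] by simp
next
  case (Less s t)
  then show ?case using eval_cong[of s e f] eval_cong[of t e f] by simp
next
  case (Mem t X)
  then show ?case using eval_cong[of t e f] by simp
next
  case (Imp p q)
  have "sat D S e v p = sat D S f w p" by (rule Imp.IH(1)) (simp_all add: Imp.prems)
  moreover have "sat D S e v q = sat D S f w q" by (rule Imp.IH(2)) (simp_all add: Imp.prems)
  ultimately show ?case by simp
next
  case (AllN p)
  have "sat D S (case_nat x e) v p = sat D S (case_nat x f) w p" for x
    using AllN.prems by (intro AllN.IH) (auto split: nat.split)
  then show ?case by simp
next
  case (AllS p)
  have "sat D S e (case_nat X v) p = sat D S f (case_nat X w) p" for X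
    using AllS.prems by (intro AllS.IH) (auto split: nat.split)
  then show ?case by simp
qed simp

section \<open>Truth of universal closures\<close>

definition app :: "nat \<Rightarrow> (nat \<Rightarrow> 'b) \<Rightarrow> (nat \<Rightarrow> 'b) \<Rightarrow> nat \<Rightarrow> 'b"
  where "app n f e = (\<lambda>i. if i < n then f i else e (i - n))"

lemma app_case_nat: "app n f (case_nat x e) = app (Suc n) (f(n := x)) e"
proof
  fix i
  consider "i < n" | "i = n" | k where "i = Suc (n + k)" by (metis less_iff_Suc_add nat_neq_iff)
  then show "app n f (case_nat x e) i = app (Suc n) (f(n := x)) e i"
    by cases (auto simp: app_def Suc_diff_le)
qed

text \<open>Nonemptiness matters already for \<open>n = 0\<close>: over an empty domain no
  \<open>f\<close> has its range in \<open>D\<close>, and the right-hand side would hold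
  vacuously.\<close>

lemma sat_funpow_AllN:
  "sat D S e v ((AllN ^^ n) p) \<longleftrightarrow> (\<forall>f. range f \<subseteq> D \<longrightarrow> sat D S (app n f e) v p)" if "D \<noteq> {}"
proof (induction n arbitrary: e)
  case 0
  show ?case using that by (auto simp: app_def)
next
  case (Suc n)
  have "sat D S e v ((AllN ^^ Suc n) p) \<longleftrightarrow>
      (\<forall>x\<in>D. \<forall>f. range f \<subseteq> D \<longrightarrow> sat D S (app (Suc n) (f(n := x)) e) v p)"
    by (simp add: Suc app_case_nat)
  also have "\<dots> \<longleftrightarrow> (\<forall>f. range f \<subseteq> D \<longrightarrow> sat D S (app (Suc n) f e) v p)"
  proof (intro iffI allI impI ballI)
    fix f :: "nat \<Rightarrow> 'a" assume *: "\<forall>x\<in>D. \<forall>f. range f \<subseteq> D \<longrightarrow> sat D S (app (Suc n) (f(n := x)) e) v p" "range f \<subseteq> D"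
    have "f(n := f n) = f" by simp
    then show "sat D S (app (Suc n) f e) v p" using * by (metis rangeI subsetD)
  next
    fix x and f :: "nat \<Rightarrow> 'a" assume "\<forall>f. range f \<subseteq> D \<longrightarrow> sat D S (app (Suc n) f e) v p" "x \<in> D" "range f \<subseteq> D"
    then show "sat D S (app (Suc n) (f(n := x)) e) v p" by (metis fun_upd_image image_subset_iff fun_upd_apply UNIV_I)
  qed
  finally show ?case .
qed

lemma sat_funpow_AllS:
  "sat D S e v ((AllS ^^ n) p) \<longleftrightarrow> (\<forall>w. range w \<subseteq> S \<longrightarrow> sat D S e (app n w v) p)" if "S \<noteq> {}"
proof (induction n arbitrary: v)
  case 0
  show ?case using that by (auto simp: app_def)
next
  case (Suc n)
  have "sat D S e v ((AllS ^^ Suc n) p) \<longleftrightarrow>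
      (\<forall>x\<in>S. \<forall>f. range f \<subseteq> S \<longrightarrow> sat D S e (app (Suc n) (f(n := x)) v) p)"
    by (simp add: Suc app_case_nat)
  also have "\<dots> \<longleftrightarrow> (\<forall>f. range f \<subseteq> S \<longrightarrow> sat D S e (app (Suc n) f v) p)"
  proof (intro iffI allI impI ballI)
    fix f :: "nat \<Rightarrow> 'a set" assume *: "\<forall>x\<in>S. \<forall>f. range f \<subseteq> S \<longrightarrow> sat D S e (app (Suc n) (f(n := x)) v) p" "range f \<subseteq> S"
    have "f(n := f n) = f" by simp
    then show "sat D S e (app (Suc n) f v) p" using * by (metis rangeI subsetD)
  next
    fix x and f :: "nat \<Rightarrow> 'a set" assume "\<forall>f. range f \<subseteq> S \<longrightarrow> sat D S e (app (Suc n) f v) p" "x \<in> S" "range f \<subseteq> S"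
    then show "sat D S e (app (Suc n) (f(n := x)) v) p" by (metis fun_upd_image image_subset_iff fun_upd_apply UNIV_I)
  qed
  finally show ?case .
qed

lemma sat_univ_closure:
  assumes "D \<noteq> {}" and "S \<noteq> {}"
  shows "sat D S e v (univ_closure p) \<longleftrightarrow>
    (\<forall>f w. range f \<subseteq> D \<longrightarrow> range w \<subseteq> S \<longrightarrow> sat D S f w p)"
proof -
  have "sat D S (app (boundN p) f e) (app (boundS p) w v) p = sat D S f w p" for f w
    by (rule sat_cong) (auto simp: app_def)
  then show ?thesis
    by (auto simp: univ_closure_def sat_funpow_AllN[OF assms(1)] sat_funpow_AllS[OF assms(2)])
qed

lemma eval_case_nat_Var: "(\<lambda>i. eval e (case_nat t Var i)) = case_nat (eval e t) e"
  by (auto split: nat.split)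

lemma sat_induction_for:
  "sat D S e v (induction_for p) \<longleftrightarrow>
    (sat D S (case_nat 0 e) v p \<longrightarrow>
     (\<forall>x\<in>D. sat D S (case_nat x e) v p \<longrightarrow> sat D S (case_nat (x + 1) e) v p) \<longrightarrow>
     (\<forall>x\<in>D. sat D S (case_nat x e) v p))"
proof -
  have "(\<lambda>i. eval (case_nat x e) (case_nat (Plus (Var 0) One) (\<lambda>i. Var (Suc i)) i)) = case_nat (x + 1) e" for x
    by (auto split: nat.split)
  then show ?thesis
    by (simp add: induction_for_def sat_subst eval_case_nat_Var imp_conjL)
qed

lemma sat_comprehension_for:
  "sat D S e v (comprehension_for p) \<longleftrightarrow> (\<exists>X\<in>S. \<forall>x\<in>D. x \<in> X \<longleftrightarrow> sat D S (case_nat x e) v p)"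
  by (auto simp: comprehension_for_def sat_subst)

text \<open>Both sorts range over everything; this is all that is required to refute the
  inconsistency of \<open>RCA0\<close> in the standard model.\<close>

lemma soundness:
  "\<Gamma> \<turnstile> p \<Longrightarrow> (\<And>q. q \<in> \<Gamma> \<Longrightarrow> sat UNIV UNIV e v q) \<Longrightarrow> sat UNIV UNIV e v p"
proof (induction arbitrary: e v rule: provable.induct)
  case (AllN_I \<Gamma> p)
  have "sat UNIV UNIV (case_nat x e) v p" for x
    by (rule AllN_I.IH) (auto simp: sat_subst AllN_I.prems)
  then show ?case by simp
next
  case (AllS_I \<Gamma> p)
  have "sat UNIV UNIV e (case_nat X v) p" for X
    by (rule AllS_I.IH) (auto simp: sat_subst AllS_I.prems)
  then show ?case by simp
next
  case (AllN_E \<Gamma> p t)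
  then show ?case by (simp add: sat_subst eval_case_nat_Var)
next
  case (AllS_E \<Gamma> p Y)
  have "(\<lambda>X. v (case_nat Y (\<lambda>X. X) X)) = case_nat (v Y) v"
    by (rule ext) (simp split: nat.split)
  then show ?case using AllS_E by (simp add: sat_subst)
next
  case (Eq_subst \<Gamma> s t p)
  have "eval e s = eval e t" using Eq_subst.IH(1)[OF Eq_subst.prems] by simp
  then show ?case using Eq_subst.IH(2)[OF Eq_subst.prems] by (simp add: sat_subst eval_case_nat_Var)
next
  case (Contr p \<Gamma>)
  then show ?case by (metis insert_iff sat.simps(1,5))
qed auto

section \<open>Consistency of \<open>RCA0\<close> from the standard model\<close>

lemma nat_sat_RCA0: "p \<in> RCA0 \<Longrightarrow> sat UNIV UNIV (e :: nat \<Rightarrow> nat) v p"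
proof -
  have ind: "sat UNIV UNIV f w (induction_for q)" for f :: "nat \<Rightarrow> nat" and w q
    unfolding sat_induction_for
  proof (intro impI ballI)
    fix n
    assume "sat UNIV UNIV (case_nat 0 f) w q"
      and "\<forall>x\<in>UNIV. sat UNIV UNIV (case_nat x f) w q \<longrightarrow> sat UNIV UNIV (case_nat (x + 1) f) w q"
    then show "sat UNIV UNIV (case_nat n f) w q" by (induction n) auto
  qed
  have comp: "sat UNIV UNIV f w (comprehension_for q)" for f :: "nat \<Rightarrow> nat" and w q
    unfolding sat_comprehension_for by (rule bexI[of _ "{x. sat UNIV UNIV (case_nat x f) w q}"]) auto
  have basic: "sat UNIV UNIV f w q" if "q \<in> basic_axioms" for f :: "nat \<Rightarrow> nat" and w q
    using that by (auto simp: basic_axioms_def)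
  assume "p \<in> RCA0"
  then show ?thesis
    unfolding RCA0_def by (auto simp: sat_univ_closure ind comp basic)
qed

lemma RCA0_consistent: "\<not> RCA0 \<turnstile> Fls"
  using soundness[of RCA0 Fls "\<lambda>_. 0 :: nat" "\<lambda>_. {}"] nat_sat_RCA0 by auto


section \<open>The term model\<close>

lemma tsubst_tshift [simp]: "tsubst (case_nat s \<sigma>) (tshift t) = tsubst \<sigma> t"
  by (simp add: tsubst_tsubst)

context
  fixes \<Delta> assumes henkin: "henkin \<Delta>"
begin

lemma henkin_provable: "\<Delta> \<turnstile> p \<longleftrightarrow> p \<in> \<Delta>"
  using henkin unfolding henkin_def by (meson Hyp Imp_E)

lemma henkin_Fls: "Fls \<notin> \<Delta>"
  using henkin unfolding henkin_def henkin_provable by blast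

lemma henkin_Imp: "p \<^bold>\<longrightarrow> q \<in> \<Delta> \<longleftrightarrow> (p \<in> \<Delta> \<longrightarrow> q \<in> \<Delta>)"
proof
  assume "p \<^bold>\<longrightarrow> q \<in> \<Delta>"
  then show "p \<in> \<Delta> \<longrightarrow> q \<in> \<Delta>" using henkin_provable by (meson Imp_E)
next
  assume *: "p \<in> \<Delta> \<longrightarrow> q \<in> \<Delta>"
  have "insert p \<Delta> \<turnstile> q"
  proof (cases "p \<in> \<Delta>")
    case True
    then show ?thesis using * by (simp add: Hyp)
  next
    case False
    then have "\<^bold>\<not> p \<in> \<Delta>" using henkin unfolding henkin_def by blast
    then show ?thesis by (meson Hyp Imp_E insertCI provable_Fls)
  qed
  then show "p \<^bold>\<longrightarrow> q \<in> \<Delta>" using henkin_provable by (meson Imp_I)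
qed

lemma henkin_AllN: "AllN p \<in> \<Delta> \<longleftrightarrow> (\<forall>t. instN t p \<in> \<Delta>)"
proof
  show "AllN p \<in> \<Delta> \<Longrightarrow> \<forall>t. instN t p \<in> \<Delta>" using AllN_E[of \<Delta> p] henkin_provable by blast
  have "\<exists>t. instN t p \<notin> \<Delta>" if "AllN p \<notin> \<Delta>"
  proof -
    from that have "\<^bold>\<not> AllN p \<in> \<Delta>" using henkin_Imp by blast
    then obtain k where "\<^bold>\<not> instN (Var k) p \<in> \<Delta>" using henkin unfolding henkin_def by blast
    then show ?thesis using henkin_Imp henkin_Fls by blast
  qed
  then show "\<forall>t. instN t p \<in> \<Delta> \<Longrightarrow> AllN p \<in> \<Delta>" by blast
qed

lemma henkin_AllS: "AllS p \<in> \<Delta> \<longleftrightarrow> (\<forall>Y. instS Y p \<in> \<Delta>)"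
proof
  show "AllS p \<in> \<Delta> \<Longrightarrow> \<forall>Y. instS Y p \<in> \<Delta>" using AllS_E[of \<Delta> p] henkin_provable by blast
  have "\<exists>Y. instS Y p \<notin> \<Delta>" if "AllS p \<notin> \<Delta>"
  proof -
    from that have "\<^bold>\<not> AllS p \<in> \<Delta>" using henkin_Imp by blast
    then obtain k where "\<^bold>\<not> instS k p \<in> \<Delta>" using henkin unfolding henkin_def by blast
    then show ?thesis using henkin_Imp henkin_Fls by blast
  qed
  then show "\<forall>Y. instS Y p \<in> \<Delta> \<Longrightarrow> AllS p \<in> \<Delta>" by blast
qed

lemma henkin_Eq_refl: "Eq t t \<in> \<Delta>"
  using henkin_provable Eq_refl by blast

lemma henkin_Eq_subst: "Eq s t \<in> \<Delta> \<Longrightarrow> instN s p \<in> \<Delta> \<Longrightarrow> instN t p \<in> \<Delta>"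
  using henkin_provable Eq_subst by blast

text \<open>Here and in the following congruence lemmas the formula given to
  \<open>henkin_Eq_subst\<close> marks with \<open>Var 0\<close> the one occurrence to be replaced;
  \<open>tshift\<close> keeps the other terms from being captured.\<close>

lemma henkin_Eq_sym: "Eq s t \<in> \<Delta> \<Longrightarrow> Eq t s \<in> \<Delta>"
  using henkin_Eq_subst[of s t "Eq (Var 0) (tshift s)"] henkin_Eq_refl by simp

lemma henkin_Eq_trans: "Eq s t \<in> \<Delta> \<Longrightarrow> Eq t u \<in> \<Delta> \<Longrightarrow> Eq s u \<in> \<Delta>"
  using henkin_Eq_subst[of t u "Eq (tshift s) (Var 0)"] by simp

lemma henkin_Plus_cong:
  assumes "Eq s s' \<in> \<Delta>" and "Eq t t' \<in> \<Delta>" shows "Eq (Plus s t) (Plus s' t') \<in> \<Delta>"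
  using henkin_Eq_subst[OF assms(1), of "Eq (Plus (tshift s) (tshift t)) (Plus (Var 0) (tshift t))"]
    henkin_Eq_subst[OF assms(2), of "Eq (Plus (tshift s) (tshift t)) (Plus (tshift s') (Var 0))"]
    henkin_Eq_refl by simp

lemma henkin_Times_cong:
  assumes "Eq s s' \<in> \<Delta>" and "Eq t t' \<in> \<Delta>" shows "Eq (Times s t) (Times s' t') \<in> \<Delta>"
  using henkin_Eq_subst[OF assms(1), of "Eq (Times (tshift s) (tshift t)) (Times (Var 0) (tshift t))"]
    henkin_Eq_subst[OF assms(2), of "Eq (Times (tshift s) (tshift t)) (Times (tshift s') (Var 0))"]
    henkin_Eq_refl by simp

lemma henkin_Less_mono:
  assumes "Eq s s' \<in> \<Delta>" and "Eq t t' \<in> \<Delta>" and "Less s t \<in> \<Delta>" shows "Less s' t' \<in> \<Delta>"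
  using henkin_Eq_subst[OF assms(1), of "Less (Var 0) (tshift t)"]
    henkin_Eq_subst[OF assms(2), of "Less (tshift s') (Var 0)"] assms(3) by simp

lemma henkin_Mem_mono:
  assumes "Eq s t \<in> \<Delta>" and "Mem s Y \<in> \<Delta>" shows "Mem t Y \<in> \<Delta>"
  using henkin_Eq_subst[OF assms(1), of "Mem (Var 0) Y"] assms(2) by simp

end

text \<open>A theory refuting the implication, if it is not provable. Fixing it globally makes its
  term model a type, so that type class instances are available for it; to have a type in either
  case, the consistency of \<open>RCA0\<close> is needed.\<close>

definition refuting :: "fm set" where
  "refuting = (SOME \<Delta>. henkin \<Delta> \<and> RCA0 \<subseteq> \<Delta> \<and>
    ((\<exists>p\<in>ACA0. \<not> RCA0 \<turnstile> HT_le2 4 \<^bold>\<longrightarrow> p) \<longrightarrow> HT_le2 4 \<in> \<Delta> \<and> (\<exists>p\<in>ACA0. p \<notin> \<Delta>)))"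

lemma boundN_HT_le2: "boundN (HT_le2 4) = 0" and boundS_HT_le2: "boundS (HT_le2 4) = 0"
  by (simp_all add: HT_le2_def colouring_def infinite_positive_def sums_homogeneous_def pair_def
      numeral_eq_Suc)

lemma below_RCA0: "below 0 RCA0"
  by (auto simp: below_def RCA0_def boundN_univ_closure boundS_univ_closure)

lemma refuting_exists:
  "\<exists>\<Delta>. henkin \<Delta> \<and> RCA0 \<subseteq> \<Delta> \<and>
    ((\<exists>p\<in>ACA0. \<not> RCA0 \<turnstile> HT_le2 4 \<^bold>\<longrightarrow> p) \<longrightarrow> HT_le2 4 \<in> \<Delta> \<and> (\<exists>p\<in>ACA0. p \<notin> \<Delta>))"
proof (cases "\<exists>p\<in>ACA0. \<not> RCA0 \<turnstile> HT_le2 4 \<^bold>\<longrightarrow> p")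
  case True
  then obtain p where p: "p \<in> ACA0" "\<not> RCA0 \<turnstile> HT_le2 4 \<^bold>\<longrightarrow> p" by blast
  let ?\<Gamma> = "insert (\<^bold>\<not> p) (insert (HT_le2 4) RCA0)"
  have "\<not> ?\<Gamma> \<turnstile> Fls" using p(2) by (meson Contr Imp_I)
  moreover have "below 0 ?\<Gamma>"
    using p(1) below_RCA0
    by (auto simp: below_def ACA0_def boundN_univ_closure boundS_univ_closure boundN_HT_le2 boundS_HT_le2)
  ultimately obtain \<Delta> where "?\<Gamma> \<subseteq> \<Delta>" "henkin \<Delta>" using henkin_extension by blast
  moreover from this have "p \<notin> \<Delta>" using henkin_Imp henkin_Fls by blast
  ultimately show ?thesis using p(1) by blast
next
  case False
  then show ?thesis using henkin_extension[OF RCA0_consistent below_RCA0] by blast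
qed

lemma henkin_refuting: "henkin refuting"
  and RCA0_refuting: "RCA0 \<subseteq> refuting"
  and refuting_counterexample:
    "p \<in> ACA0 \<Longrightarrow> \<not> RCA0 \<turnstile> HT_le2 4 \<^bold>\<longrightarrow> p \<Longrightarrow> HT_le2 4 \<in> refuting \<and> (\<exists>p\<in>ACA0. p \<notin> refuting)"
  using someI_ex[OF refuting_exists, folded refuting_def] by blast+

quotient_type number = tm / "\<lambda>s t. Eq s t \<in> refuting"
  by (rule equivpI)
    (auto simp: reflp_def symp_def transp_def
      intro: henkin_Eq_refl[OF henkin_refuting] henkin_Eq_sym[OF henkin_refuting]
        henkin_Eq_trans[OF henkin_refuting])

instantiation number :: "{zero, one, plus, times, ord}"
begin
lift_definition zero_number :: number is Zero .
lift_definition one_number :: number is One .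
lift_definition plus_number :: "number \<Rightarrow> number \<Rightarrow> number" is Plus
  by (rule henkin_Plus_cong[OF henkin_refuting])
lift_definition times_number :: "number \<Rightarrow> number \<Rightarrow> number" is Times
  by (rule henkin_Times_cong[OF henkin_refuting])
lift_definition less_number :: "number \<Rightarrow> number \<Rightarrow> bool" is "\<lambda>s t. Less s t \<in> refuting"
  using henkin_Less_mono[OF henkin_refuting] henkin_Eq_sym[OF henkin_refuting] by blast
definition less_eq_number :: "number \<Rightarrow> number \<Rightarrow> bool" where "less_eq_number x y \<longleftrightarrow> x < y \<or> x = y"
instance ..
end

lift_definition member :: "number \<Rightarrow> nat \<Rightarrow> bool" is "\<lambda>t Y. Mem t Y \<in> refuting"
  using henkin_Mem_mono[OF henkin_refuting] henkin_Eq_sym[OF henkin_refuting] by blast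

text \<open>The sets of the model are the extensions of the set variables. Identifying variables
  with equal extension is harmless, since equality of sets is not primitive.\<close>

definition number_set :: "nat \<Rightarrow> number set" where "number_set Y = {x. member x Y}"

lemma eval_number: "eval (\<lambda>i. abs_number (\<sigma> i)) t = abs_number (tsubst \<sigma> t)"
  by (induction t) (simp_all add: zero_number_def one_number_def plus_number.abs_eq times_number.abs_eq)

lemma all_number: "(\<forall>x. P x) \<longleftrightarrow> (\<forall>t. P (abs_number t))"
  by (metis Quotient3_abs_rep Quotient3_number)

text \<open>The statement is about arbitrary substitutions so that a quantifier step only extends
  the substitution by one term or one set variable.\<close>

lemma truth:
  "subst \<sigma> \<rho> p \<in> refuting \<longleftrightarrow>
    sat UNIV (range number_set) (\<lambda>i. abs_number (\<sigma> i)) (\<lambda>X. number_set (\<rho> X)) p"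
proof (induction p arbitrary: \<sigma> \<rho>)
  case Fls
  then show ?case by (simp add: henkin_Fls[OF henkin_refuting])
next
  case (Eq s t)
  then show ?case by (simp add: eval_number number.abs_eq_iff)
next
  case (Less s t)
  then show ?case by (simp add: eval_number less_number.abs_eq)
next
  case (Mem t X)
  then show ?case by (simp add: eval_number number_set_def member.abs_eq)
next
  case (Imp p q)
  then show ?case by (simp add: henkin_Imp[OF henkin_refuting])
next
  case (AllN p)
  have "(\<lambda>i. abs_number (case_nat t \<sigma> i)) = case_nat (abs_number t) (\<lambda>i. abs_number (\<sigma> i))" for t
    by (auto split: nat.split)
  moreover have "instN t (subst (case_nat (Var 0) (\<lambda>i. tshift (\<sigma> i))) \<rho> p) = subst (case_nat t \<sigma>) \<rho> p" for t
    by (auto simp: subst_subst tsubst_tsubst split: nat.split intro!: subst_cong)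
  ultimately have "subst \<sigma> \<rho> (AllN p) \<in> refuting \<longleftrightarrow>
      (\<forall>t. sat UNIV (range number_set) (case_nat (abs_number t) (\<lambda>i. abs_number (\<sigma> i))) (\<lambda>X. number_set (\<rho> X)) p)"
    by (simp add: henkin_AllN[OF henkin_refuting] AllN.IH)
  then show ?case by (simp add: all_number)
next
  case (AllS p)
  have "(\<lambda>i. number_set (case_nat Y \<rho> i)) = case_nat (number_set Y) (\<lambda>i. number_set (\<rho> i))" for Y
    by (rule ext) (simp split: nat.split)
  moreover have "instS Y (subst \<sigma> (case_nat 0 (\<lambda>X. Suc (\<rho> X))) p) = subst \<sigma> (case_nat Y \<rho>) p" for Y
    by (auto simp: subst_subst tsubst_tsubst split: nat.split intro!: subst_cong)
  ultimately show ?case by (simp add: henkin_AllS[OF henkin_refuting] AllS.IH)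
qed

lemma closed_refuting_iff_sat:
  assumes "boundN p = 0" and "boundS p = 0"
  shows "p \<in> refuting \<longleftrightarrow> sat UNIV (range number_set) e v p"
proof -
  have "p \<in> refuting \<longleftrightarrow>
      sat UNIV (range number_set) (\<lambda>i. abs_number (Var i)) (\<lambda>X. number_set X) p"
    using truth[of Var "\<lambda>X. X" p] by simp
  also have "\<dots> \<longleftrightarrow> sat UNIV (range number_set) e v p"
    by (rule sat_cong) (simp_all add: assms)
  finally show ?thesis .
qed

section \<open>Bounded predicates\<close>

text \<open>Under \<open>params \<sigma> e\<close> a variable stands for an entry of the environment \<open>e\<close> or for a fixed
  parameter.\<close>

definition params :: "(nat \<Rightarrow> nat + 'a) \<Rightarrow> (nat \<Rightarrow> 'a) \<Rightarrow> nat \<Rightarrow> 'a"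
  where "params \<sigma> e i = (case \<sigma> i of Inl j \<Rightarrow> e j | Inr a \<Rightarrow> a)"

text \<open>Interleaving lets two formulas with separate parameters be read in one environment: the
  variables of one move to the even places, those of the other to the odd places.\<close>

definition join :: "(nat \<Rightarrow> 'b) \<Rightarrow> (nat \<Rightarrow> 'b) \<Rightarrow> nat \<Rightarrow> 'b"
  where "join f g i = (if even i then f (i div 2) else g (i div 2))"

lemma join_even [simp]: "join f g (2 * i) = f i"
  and join_odd [simp]: "join f g (Suc (2 * i)) = g i"
  by (auto simp: join_def)

lemma params_join [simp]: "params (join \<sigma> \<tau>) e (2 * i) = params \<sigma> e i"
    "params (join \<sigma> \<tau>) e (Suc (2 * i)) = params \<tau> e i"
  by (auto simp: params_def)

lemma range_join: "range (join f g) = range f \<union> range g"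
proof
  show "range (join f g) \<subseteq> range f \<union> range g" by (auto simp: join_def)
  show "range f \<union> range g \<subseteq> range (join f g)" by (metis Un_least image_subsetI join_even join_odd rangeI)
qed

lemma bounded_subst: "bounded p \<Longrightarrow> bounded (subst \<sigma> \<rho> p)"
proof (induction arbitrary: \<sigma> \<rho> rule: bounded.induct)
  case (6 p t)
  have "tsubst (case_nat (Var 0) (\<lambda>i. tshift (\<sigma> i))) (tshift t) = tshift (tsubst \<sigma> t)"
    by (simp add: tsubst_tsubst)
  then show ?case using 6 by (auto intro: bounded.intros)
next
  case (7 p t)
  have "tsubst (case_nat (Var 0) (\<lambda>i. tshift (\<sigma> i))) (tshift t) = tshift (tsubst \<sigma> t)"
    by (simp add: tsubst_tsubst)
  then show ?case using 7 by (auto intro: bounded.intros)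
qed (auto intro: bounded.intros)

section \<open>Relations definable by bounded formulas with parameters\<close>

locale arith_structure =
  fixes D :: "'a::{zero,one,plus,times,ord} set" and S :: "'a set set"
  assumes D_zero: "0 \<in> D" and D_one: "1 \<in> D"
    and D_plus: "x \<in> D \<Longrightarrow> y \<in> D \<Longrightarrow> x + y \<in> D"
    and S_nonempty: "S \<noteq> {}"
begin

definition valid :: "(nat \<Rightarrow> nat + 'a) \<Rightarrow> bool"
  where "valid \<sigma> \<longleftrightarrow> (\<forall>i a. \<sigma> i = Inr a \<longrightarrow> a \<in> D)"

definition term_fun :: "((nat \<Rightarrow> 'a) \<Rightarrow> 'a) \<Rightarrow> bool" where
  "term_fun f \<longleftrightarrow> (\<exists>t \<sigma>. valid \<sigma> \<and> (\<forall>e. f e = eval (params \<sigma> e) t))"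

text \<open>The semantic form of \<Delta>0 definability. Its closure properties allow definability
  to be proved by introduction rules that follow the shape of a relation, so that concrete formulas
  need not be written down.\<close>

definition delta0 :: "((nat \<Rightarrow> 'a) \<Rightarrow> bool) \<Rightarrow> bool" where
  "delta0 R \<longleftrightarrow> (\<exists>p \<sigma> v. bounded p \<and> valid \<sigma> \<and> range v \<subseteq> S \<and>
     (\<forall>e. range e \<subseteq> D \<longrightarrow> R e = sat D S (params \<sigma> e) v p))"

lemma valid_join: "valid \<sigma> \<Longrightarrow> valid \<tau> \<Longrightarrow> valid (join \<sigma> \<tau>)"
  by (auto simp: valid_def join_def)

lemma term_fun_join:
  assumes "term_fun f" and "term_fun g"
  obtains s t \<sigma> where "valid \<sigma>" "\<And>e. f e = eval (params \<sigma> e) s" "\<And>e. g e = eval (params \<sigma> e) t"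
proof -
  obtain s \<sigma> t \<tau> where "valid \<sigma>" "valid \<tau>"
    and "\<And>e. f e = eval (params \<sigma> e) s" "\<And>e. g e = eval (params \<tau> e) t"
    using assms unfolding term_fun_def by blast
  then show ?thesis
    by (intro that[of "join \<sigma> \<tau>" "tsubst (\<lambda>i. Var (2 * i)) s" "tsubst (\<lambda>i. Var (Suc (2 * i))) t"])
      (simp_all add: valid_join eval_tsubst)
qed

lemma delta0_join:
  assumes "delta0 P" and "delta0 Q"
  obtains p q \<sigma> v where "bounded p" "bounded q" "valid \<sigma>" "range v \<subseteq> S"
    "\<And>e. range e \<subseteq> D \<Longrightarrow> P e = sat D S (params \<sigma> e) v p"
    "\<And>e. range e \<subseteq> D \<Longrightarrow> Q e = sat D S (params \<sigma> e) v q"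
proof -
  obtain p \<sigma> v q \<tau> w where "bounded p" "bounded q" "valid \<sigma>" "valid \<tau>" "range v \<subseteq> S" "range w \<subseteq> S"
    and "\<And>e. range e \<subseteq> D \<Longrightarrow> P e = sat D S (params \<sigma> e) v p"
    and "\<And>e. range e \<subseteq> D \<Longrightarrow> Q e = sat D S (params \<tau> e) w q"
    using assms unfolding delta0_def by (elim exE conjE) blast
  then show ?thesis
    by (intro that[of "subst (\<lambda>i. Var (2 * i)) (\<lambda>X. 2 * X) p"
          "subst (\<lambda>i. Var (Suc (2 * i))) (\<lambda>X. Suc (2 * X)) q" "join \<sigma> \<tau>" "join v w"])
      (simp_all add: valid_join range_join bounded_subst sat_subst)
qed

lemma term_fun_var: "term_fun (\<lambda>e. e i)"
  unfolding term_fun_def valid_def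
  by (intro exI[of _ "Var i"] exI[of _ Inl]) (auto simp: params_def)

lemma term_fun_const: "a \<in> D \<Longrightarrow> term_fun (\<lambda>e. a)"
  unfolding term_fun_def valid_def
  by (intro exI[of _ "Var 0"] exI[of _ "\<lambda>_. Inr a"]) (auto simp: params_def)

lemma term_fun_plus: "term_fun f \<Longrightarrow> term_fun g \<Longrightarrow> term_fun (\<lambda>e. f e + g e)"
proof (erule (1) term_fun_join)
  fix s t \<sigma>
  assume "valid \<sigma>" "\<And>e. f e = eval (params \<sigma> e) s" "\<And>e. g e = eval (params \<sigma> e) t"
  then show ?thesis
    unfolding term_fun_def by (intro exI[of _ "Plus s t"] exI[of _ \<sigma>]) simp
qed

lemma term_fun_times: "term_fun f \<Longrightarrow> term_fun g \<Longrightarrow> term_fun (\<lambda>e. f e * g e)"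
proof (erule (1) term_fun_join)
  fix s t \<sigma>
  assume "valid \<sigma>" "\<And>e. f e = eval (params \<sigma> e) s" "\<And>e. g e = eval (params \<sigma> e) t"
  then show ?thesis
    unfolding term_fun_def by (intro exI[of _ "Times s t"] exI[of _ \<sigma>]) simp
qed

lemmas term_fun_intros = term_fun_var term_fun_const term_fun_plus term_fun_times D_zero D_one

lemma term_fun_eval: "term_fun (\<lambda>e. eval e t)"
  by (induction t) (auto intro: term_fun_intros)

lemma delta0_eq: "term_fun f \<Longrightarrow> term_fun g \<Longrightarrow> delta0 (\<lambda>e. f e = g e)"
proof (erule (1) term_fun_join)
  fix s t \<sigma>
  obtain X where "X \<in> S" using S_nonempty by blast
  then show "valid \<sigma> \<Longrightarrow> (\<And>e. f e = eval (params \<sigma> e) s) \<Longrightarrow> (\<And>e. g e = eval (params \<sigma> e) t) \<Longrightarrow> ?thesis"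
    unfolding delta0_def
    by (intro exI[of _ "Eq s t"] exI[of _ \<sigma>] exI[of _ "\<lambda>_. X"]) (auto intro: bounded.intros)
qed

lemma delta0_less: "term_fun f \<Longrightarrow> term_fun g \<Longrightarrow> delta0 (\<lambda>e. f e < g e)"
proof (erule (1) term_fun_join)
  fix s t \<sigma>
  obtain X where "X \<in> S" using S_nonempty by blast
  then show "valid \<sigma> \<Longrightarrow> (\<And>e. f e = eval (params \<sigma> e) s) \<Longrightarrow> (\<And>e. g e = eval (params \<sigma> e) t) \<Longrightarrow> ?thesis"
    unfolding delta0_def
    by (intro exI[of _ "Less s t"] exI[of _ \<sigma>] exI[of _ "\<lambda>_. X"]) (auto intro: bounded.intros)
qed

lemma delta0_mem: "X \<in> S \<Longrightarrow> term_fun f \<Longrightarrow> delta0 (\<lambda>e. f e \<in> X)"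
proof -
  assume "X \<in> S" "term_fun f"
  then obtain t \<sigma> where "valid \<sigma>" "\<And>e. f e = eval (params \<sigma> e) t" unfolding term_fun_def by blast
  with \<open>X \<in> S\<close> show ?thesis
    unfolding delta0_def
    by (intro exI[of _ "Mem t 0"] exI[of _ \<sigma>] exI[of _ "\<lambda>_. X"]) (auto intro: bounded.intros)
qed

lemma delta0_imp: "delta0 P \<Longrightarrow> delta0 Q \<Longrightarrow> delta0 (\<lambda>e. P e \<longrightarrow> Q e)"
proof (erule (1) delta0_join)
  fix p q \<sigma> v
  assume "bounded p" "bounded q" "valid \<sigma>" "range v \<subseteq> S"
    "\<And>e. range e \<subseteq> D \<Longrightarrow> P e = sat D S (params \<sigma> e) v p"
    "\<And>e. range e \<subseteq> D \<Longrightarrow> Q e = sat D S (params \<sigma> e) v q"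
  then show ?thesis
    unfolding delta0_def
    by (intro exI[of _ "p \<^bold>\<longrightarrow> q"] exI[of _ \<sigma>] exI[of _ v]) (auto intro: bounded.intros)
qed

lemma delta0_False: "delta0 (\<lambda>e. False)"
proof -
  obtain X where "X \<in> S" using S_nonempty by blast
  then show ?thesis
    unfolding delta0_def
    by (intro exI[of _ Fls] exI[of _ Inl] exI[of _ "\<lambda>_. X"]) (auto simp: valid_def intro: bounded.intros)
qed

lemma delta0_not: "delta0 P \<Longrightarrow> delta0 (\<lambda>e. \<not> P e)"
  using delta0_imp[OF _ delta0_False] by simp

lemma delta0_disj: "delta0 P \<Longrightarrow> delta0 Q \<Longrightarrow> delta0 (\<lambda>e. P e \<or> Q e)"
  using delta0_imp[OF delta0_not, of P Q] by (simp add: disj_imp)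

lemma delta0_conj: "delta0 P \<Longrightarrow> delta0 Q \<Longrightarrow> delta0 (\<lambda>e. P e \<and> Q e)"
  using delta0_not[OF delta0_disj[OF delta0_not delta0_not], of P Q] by simp

lemma delta0_iff: "delta0 P \<Longrightarrow> delta0 Q \<Longrightarrow> delta0 (\<lambda>e. P e \<longleftrightarrow> Q e)"
  using delta0_conj[OF delta0_imp[of P Q] delta0_imp[of Q P]] by (simp add: iff_conv_conj_imp)

lemma delta0_all:
  assumes "delta0 (\<lambda>e. Q (e 0) (\<lambda>i. e (Suc i)))" and "term_fun f"
  shows "delta0 (\<lambda>e. \<forall>x\<in>D. x < f e \<longrightarrow> Q x e)"
proof -
  obtain p \<sigma> v where p: "bounded p" "valid \<sigma>" "range v \<subseteq> S"
    and Q: "\<And>e. range e \<subseteq> D \<Longrightarrow> Q (e 0) (\<lambda>i. e (Suc i)) = sat D S (params \<sigma> e) v p"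
    using assms(1) unfolding delta0_def by blast
  obtain t \<tau> where t: "valid \<tau>" and f: "\<And>e. f e = eval (params \<tau> e) t"
    using assms(2) unfolding term_fun_def by blast
  \<comment> \<open>Several variables may stand for entry 0, which becomes the quantified one. All
    of them are renamed to \<open>Var 0\<close> by \<open>?\<pi>\<close>; the other entries move
    down by one, and the bound \<open>t\<close> is read at the odd places.\<close>
  define \<sigma>' :: "nat \<Rightarrow> nat + 'a"
    where "\<sigma>' i = (case \<sigma> i of Inl j \<Rightarrow> Inl (j - 1) | Inr a \<Rightarrow> Inr a)" for i
  let ?\<pi> = "\<lambda>i. if \<sigma> i = Inl 0 then Var 0 else Var (Suc (2 * i))"
  let ?t = "tsubst (\<lambda>i. Var (Suc (2 * i))) t"
  let ?q = "AllN (Less (Var 0) (tshift ?t) \<^bold>\<longrightarrow> subst ?\<pi> (\<lambda>X. X) p)"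
  have "valid \<sigma>'" using p(2) by (auto simp: valid_def \<sigma>'_def split: sum.splits)
  then have valid: "valid (join \<sigma>' \<tau>)" using t by (rule valid_join)
  have "eval (case_nat x (params (join \<sigma>' \<tau>) e)) (?\<pi> i) = params \<sigma> (case_nat x e) i" for x e i
  proof (cases "\<sigma> i")
    case (Inl j)
    then show ?thesis by (cases j) (simp_all add: params_def \<sigma>'_def)
  next
    case (Inr a)
    then show ?thesis by (simp add: params_def \<sigma>'_def)
  qed
  moreover have "Q x e = sat D S (params \<sigma> (case_nat x e)) v p" if "x \<in> D" "range e \<subseteq> D" for x e
  proof -
    have "range (case_nat x e) \<subseteq> D" using that by (auto simp: image_subset_iff split: nat.split)
    from Q[OF this] show ?thesis by simp
  qed
  ultimately have "(\<forall>x\<in>D. x < f e \<longrightarrow> Q x e) = sat D S (params (join \<sigma>' \<tau>) e) v ?q" if "range e \<subseteq> D" for e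
    using that by (simp add: f eval_tsubst sat_subst)
  then show ?thesis
    unfolding delta0_def using valid p
    by (intro exI[of _ ?q] exI[of _ "join \<sigma>' \<tau>"] exI[of _ v]) (auto intro!: bounded.intros bounded_subst)
qed

lemma delta0_ex:
  assumes "delta0 (\<lambda>e. Q (e 0) (\<lambda>i. e (Suc i)))" and "term_fun f"
  shows "delta0 (\<lambda>e. \<exists>x\<in>D. x < f e \<and> Q x e)"
  using delta0_not[OF delta0_all[of "\<lambda>x e. \<not> Q x e", OF delta0_not[OF assms(1)] assms(2)]] by simp

lemmas delta0_intros = delta0_eq delta0_less delta0_mem delta0_imp delta0_False delta0_not delta0_disj
  delta0_conj delta0_iff delta0_all delta0_ex term_fun_intros

lemma delta0_cong: "delta0 P \<Longrightarrow> (\<And>e. range e \<subseteq> D \<Longrightarrow> P e = Q e) \<Longrightarrow> delta0 Q"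
  unfolding delta0_def by (elim exE, rule exI, rule exI, rule exI) auto

lemma delta0_rename:
  assumes "delta0 P" shows "delta0 (\<lambda>e. P (\<lambda>i. e (\<pi> i)))"
proof -
  obtain p \<sigma> v where p: "bounded p" "valid \<sigma>" "range v \<subseteq> S"
    and P: "\<And>e. range e \<subseteq> D \<Longrightarrow> P e = sat D S (params \<sigma> e) v p"
    using assms unfolding delta0_def by blast
  have "params \<sigma> (\<lambda>i. e (\<pi> i)) = params (\<lambda>i. map_sum \<pi> id (\<sigma> i)) e" for e
    by (auto simp: params_def split: sum.split)
  moreover have "valid (\<lambda>i. map_sum \<pi> id (\<sigma> i))"
    using p(2) by (auto simp: valid_def map_sum_def split: sum.splits)
  moreover have "range (\<lambda>i. e (\<pi> i)) \<subseteq> D" if "range e \<subseteq> D" for e using that by auto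
  ultimately show ?thesis
    unfolding delta0_def using p P
    by (intro exI[of _ p] exI[of _ "\<lambda>i. map_sum \<pi> id (\<sigma> i)"] exI[of _ v]) simp
qed

text \<open>The variable 0 is the existentially quantified \<open>y\<close>, the variable 1 is \<open>x\<close>.\<close>

lemma delta0_binary_join:
  assumes "delta0 (\<lambda>e. P (e 0) (e 1))" and "delta0 (\<lambda>e. Q (e 0) (e 1))"
  obtains p q w v where "bounded p" "bounded q" "range w \<subseteq> D" "range v \<subseteq> S"
    "\<And>x y. x \<in> D \<Longrightarrow> y \<in> D \<Longrightarrow> P x y = sat D S (case_nat y (case_nat x w)) v p"
    "\<And>x y. x \<in> D \<Longrightarrow> y \<in> D \<Longrightarrow> Q x y = sat D S (case_nat y (case_nat x w)) v q"
proof (rule delta0_join[OF assms])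
  fix p q \<sigma> v
  assume *: "bounded p" "bounded q" "valid \<sigma>" "range v \<subseteq> S"
    "\<And>e. range e \<subseteq> D \<Longrightarrow> P (e 0) (e 1) = sat D S (params \<sigma> e) v p"
    "\<And>e. range e \<subseteq> D \<Longrightarrow> Q (e 0) (e 1) = sat D S (params \<sigma> e) v q"
  \<comment> \<open>At variables that stand for entries of the environment the value 0 is a
    placeholder: \<open>?\<pi>\<close> redirects them to the variables for \<open>x\<close> and
    \<open>y\<close>.\<close>
  define w where "w i = (case \<sigma> i of Inl _ \<Rightarrow> 0 | Inr a \<Rightarrow> a)" for i
  let ?\<pi> = "\<lambda>i. case \<sigma> i of Inl j \<Rightarrow> (if j = 0 then Var 1 else Var 0) | Inr _ \<Rightarrow> Var (Suc (Suc i))"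
  have w: "range w \<subseteq> D" using *(3) D_zero by (auto simp: valid_def w_def split: sum.splits)
  have "eval (case_nat y (case_nat x w)) (?\<pi> i) = params \<sigma> (case_nat x (\<lambda>_. y)) i" for x y i
    by (auto simp: params_def w_def split: sum.split nat.split)
  then have eq: "sat D S (case_nat y (case_nat x w)) v (subst ?\<pi> (\<lambda>X. X) r) =
      sat D S (params \<sigma> (case_nat x (\<lambda>_. y))) v r" for x y r
    by (simp add: sat_subst)
  have "range (case_nat x (\<lambda>_. y)) \<subseteq> D" if "x \<in> D" "y \<in> D" for x y
    using that by (auto split: nat.split)
  then show ?thesis
    by (intro that[of "subst ?\<pi> (\<lambda>X. X) p" "subst ?\<pi> (\<lambda>X. X) q" w v])
      (use * w eq in \<open>simp_all add: bounded_subst *(5)[symmetric] *(6)[symmetric]\<close>)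
qed

end

section \<open>Induction and comprehension in models of \<open>RCA0\<close>\<close>

locale rca = arith_structure +
  assumes S_subset: "X \<in> S \<Longrightarrow> X \<subseteq> D"
    and sat_RCA0: "p \<in> RCA0 \<Longrightarrow> sat D S e v p"
begin

lemma sat_RCA0_instance:
  assumes "univ_closure p \<in> RCA0" and "range e \<subseteq> D" and "range v \<subseteq> S" shows "sat D S e v p"
  using sat_RCA0[OF assms(1)] assms(2,3) D_zero S_nonempty
  by (subst (asm) sat_univ_closure) auto

lemma sat_basic: "p \<in> basic_axioms \<Longrightarrow> range e \<subseteq> D \<Longrightarrow> range v \<subseteq> S \<Longrightarrow> sat D S e v p"
  by (rule sat_RCA0_instance) (auto simp: RCA0_def)

lemma sigma1_induct:
  assumes def: "delta0 (\<lambda>e. P (e 0) (e 1))" and x: "x \<in> D"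
    and zero: "\<exists>y\<in>D. P 0 y" and step: "\<And>x. x \<in> D \<Longrightarrow> \<exists>y\<in>D. P x y \<Longrightarrow> \<exists>y\<in>D. P (x + 1) y"
  shows "\<exists>y\<in>D. P x y"
proof (rule delta0_binary_join[OF def def])
  fix p q w v
  assume *: "bounded p" "range w \<subseteq> D" "range v \<subseteq> S"
    "\<And>x y. x \<in> D \<Longrightarrow> y \<in> D \<Longrightarrow> P x y = sat D S (case_nat y (case_nat x w)) v p"
  have "sat D S w v (induction_for (ExN p))"
  proof (rule sat_RCA0_instance)
    show "univ_closure (induction_for (ExN p)) \<in> RCA0"
      unfolding RCA0_def Sigma01_def using *(1) by (intro imageI UnI1[OF UnI2]) blast
  qed (fact *)+
  moreover have iff: "sat D S (case_nat x w) v (ExN p) \<longleftrightarrow> (\<exists>y\<in>D. P x y)" if "x \<in> D" for x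
    using *(4) that by simp
  moreover have "sat D S (case_nat (x + 1) w) v (ExN p)" if "x \<in> D" "sat D S (case_nat x w) v (ExN p)" for x
    using that step iff[OF that(1)] iff[OF D_plus[OF that(1) D_one]] by blast
  ultimately show ?thesis
    unfolding sat_induction_for using x zero iff[OF D_zero] by blast
qed

text \<open>A dummy existential quantifier brings the predicate into \<Sigma>1 form.\<close>

lemma delta0_induct:
  assumes "delta0 (\<lambda>e. P (e 0))" and "x \<in> D"
    and "P 0" and "\<And>x. x \<in> D \<Longrightarrow> P x \<Longrightarrow> P (x + 1)"
  shows "P x"
proof -
  have "\<exists>y\<in>D. P x"
    by (rule sigma1_induct[of "\<lambda>x _. P x", OF assms(1,2)]) (use assms(3,4) D_zero in auto)
  then show ?thesis by blast
qed

lemma delta1_comprehension: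
  assumes "delta0 (\<lambda>e. P (e 0) (e 1))" and "delta0 (\<lambda>e. Q (e 0) (e 1))"
    and iff: "\<And>x. x \<in> D \<Longrightarrow> (\<exists>y\<in>D. P x y) \<longleftrightarrow> (\<forall>y\<in>D. Q x y)"
  shows "{x\<in>D. \<exists>y\<in>D. P x y} \<in> S"
proof (rule delta0_binary_join[OF assms(1,2)])
  fix p q w v
  assume *: "bounded p" "bounded q" "range w \<subseteq> D" "range v \<subseteq> S"
    "\<And>x y. x \<in> D \<Longrightarrow> y \<in> D \<Longrightarrow> P x y = sat D S (case_nat y (case_nat x w)) v p"
    "\<And>x y. x \<in> D \<Longrightarrow> y \<in> D \<Longrightarrow> Q x y = sat D S (case_nat y (case_nat x w)) v q"
  have P: "sat D S (case_nat x w) v (ExN p) \<longleftrightarrow> (\<exists>y\<in>D. P x y)" if "x \<in> D" for x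
    using *(5,6) that by simp
  have Q: "sat D S (case_nat x w) v (AllN q) \<longleftrightarrow> (\<forall>y\<in>D. Q x y)" if "x \<in> D" for x
    using *(5,6) that by simp
  have "sat D S w v (AllN (ExN p \<^bold>\<longleftrightarrow> AllN q) \<^bold>\<longrightarrow> comprehension_for (ExN p))"
  proof (rule sat_RCA0_instance)
    show "univ_closure (AllN (ExN p \<^bold>\<longleftrightarrow> AllN q) \<^bold>\<longrightarrow> comprehension_for (ExN p)) \<in> RCA0"
      unfolding RCA0_def Sigma01_def Pi01_def using *(1,2) by (intro imageI UnI2) blast
  qed (fact *)+
  moreover have "sat D S w v (AllN (ExN p \<^bold>\<longleftrightarrow> AllN q))"
    using P Q iff by (simp del: sat.simps(6) add: sat.simps(6)[of _ _ w])
  ultimately have "sat D S w v (comprehension_for (ExN p))" by simp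
  then obtain X where X: "X \<in> S" "\<And>x. x \<in> D \<Longrightarrow> x \<in> X \<longleftrightarrow> (\<exists>y\<in>D. P x y)"
    unfolding sat_comprehension_for using P by blast
  then have "X = {x\<in>D. \<exists>y\<in>D. P x y}" using S_subset by blast
  then show ?thesis using X(1) by simp
qed

lemma delta0_comprehension:
  assumes "delta0 (\<lambda>e. P (e 0))" shows "{x\<in>D. P x} \<in> S"
proof -
  have "{x\<in>D. \<exists>y\<in>D. P x} \<in> S"
  proof (rule delta1_comprehension[where P = "\<lambda>x _. P x" and Q = "\<lambda>x _. P x"])
    show "(\<exists>y\<in>D. P x) \<longleftrightarrow> (\<forall>y\<in>D. P x)" for x using D_zero by auto
  qed (fact assms)+
  moreover have "{x\<in>D. \<exists>y\<in>D. P x} = {x\<in>D. P x}" using D_zero by auto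
  ultimately show ?thesis by simp
qed

end

section \<open>Arithmetic of the term model\<close>

interpretation number: rca UNIV "range number_set"
proof
  fix p :: fm and e v
  assume "p \<in> RCA0"
  moreover from this have "boundN p = 0" "boundS p = 0"
    by (auto simp: RCA0_def boundN_univ_closure boundS_univ_closure)
  ultimately show "sat UNIV (range number_set) e v p"
    using RCA0_refuting closed_refuting_iff_sat by blast
qed auto

lemma number_basic:
  fixes x y :: number
  shows "x + 1 \<noteq> 0" "x + 1 = y + 1 \<Longrightarrow> x = y" "x + 0 = x" "x + (y + 1) = (x + y) + 1"
    "x * 0 = 0" "x * (y + 1) = x * y + x" "\<not> x < 0" "x < y + 1 \<longleftrightarrow> x < y \<or> x = y"
proof -
  have sat: "sat UNIV (range number_set) (case_nat x (\<lambda>_. y)) (\<lambda>_. number_set 0) p" if "p \<in> basic_axioms" for p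
    using number.sat_basic[OF that] by auto
  note * = sat[unfolded basic_axioms_def]
  show "x + 1 \<noteq> 0" using *[of "\<^bold>\<not> Eq (Plus (Var 0) One) Zero"] by simp
  show "x + 1 = y + 1 \<Longrightarrow> x = y"
    using *[of "Eq (Plus (Var 0) One) (Plus (Var 1) One) \<^bold>\<longrightarrow> Eq (Var 0) (Var 1)"] by simp
  show "x + 0 = x" using *[of "Eq (Plus (Var 0) Zero) (Var 0)"] by simp
  show "x + (y + 1) = (x + y) + 1"
    using *[of "Eq (Plus (Var 0) (Plus (Var 1) One)) (Plus (Plus (Var 0) (Var 1)) One)"] by simp
  show "x * 0 = 0" using *[of "Eq (Times (Var 0) Zero) Zero"] by simp
  show "x * (y + 1) = x * y + x"
    using *[of "Eq (Times (Var 0) (Plus (Var 1) One)) (Plus (Times (Var 0) (Var 1)) (Var 0))"] by simp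
  show "\<not> x < 0" using *[of "\<^bold>\<not> Less (Var 0) Zero"] by simp
  show "x < y + 1 \<longleftrightarrow> x < y \<or> x = y"
    using *[of "Less (Var 0) (Plus (Var 1) One) \<^bold>\<longleftrightarrow> Less (Var 0) (Var 1) \<^bold>\<or> Eq (Var 0) (Var 1)"] by auto
qed

lemma number_induct [case_names def zero step]:
  assumes "number.delta0 (\<lambda>e. P (e 0))" and "P 0" and "\<And>x. P x \<Longrightarrow> P (x + 1)"
  shows "P x"
  using number.delta0_induct[of P x] assms by blast

lemmas number_arith = number_basic(1,3-8)

lemmas number_delta0 = number.delta0_intros UNIV_I

text \<open>Just what makes the ring of differences a discretely ordered integral domain.
  Discreteness is contained in \<open>less_iff_add_one\<close>.\<close>

class peano_semiring = comm_semiring_1 + ord +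
  assumes add_right_imp: "a + c = b + c \<Longrightarrow> a = b"
    and less_iff_add_one: "a < b \<longleftrightarrow> (\<exists>c. b = a + c + 1)"
    and less_trichotomy: "a < b \<or> a = b \<or> b < a"
    and add_one_neq_zero: "a + 1 \<noteq> 0"

lemma number_zero_add: "0 + x = x" for x :: number
proof (induction x rule: number_induct)
  case def
  show ?case by (intro number_delta0)
qed (simp_all only: number_arith)

lemma number_suc_add: "(y + 1) + x = (y + x) + 1" for x y :: number
proof (induction x rule: number_induct)
  case def
  show ?case by (intro number_delta0)
qed (simp_all only: number_arith)

lemma number_add_comm: "y + x = x + y" for x y :: number
proof (induction x rule: number_induct)
  case def
  show ?case by (intro number_delta0)
qed (simp_all only: number_arith number_zero_add number_suc_add)

lemma number_add_assoc: "(x + y) + z = x + (y + z)" for x y z :: number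
proof (induction z rule: number_induct)
  case def
  show ?case by (intro number_delta0)
qed (simp_all only: number_arith)

lemma number_add_left_comm: "x + (y + z) = y + (x + z)" for x y z :: number
  using number_add_assoc[of x y z] number_add_assoc[of y x z] number_add_comm[of x y] by simp

lemmas number_add_ac = number_add_assoc number_add_comm number_add_left_comm

lemma number_zero_times: "0 * x = 0" for x :: number
proof (induction x rule: number_induct)
  case def
  show ?case by (intro number_delta0)
qed (simp_all only: number_arith)

lemma number_suc_times: "(y + 1) * x = y * x + x" for x y :: number
proof (induction x rule: number_induct)
  case def
  show ?case by (intro number_delta0)
next
  case (step x)
  show ?case unfolding number_basic(6) step by (simp only: number_add_ac)
qed (simp only: number_arith)

lemma number_times_comm: "y * x = x * y" for x y :: number
proof (induction x rule: number_induct)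
  case def
  show ?case by (intro number_delta0)
qed (simp_all only: number_arith number_zero_times number_suc_times)

lemma number_distrib: "(x + y) * z = x * z + y * z" for x y z :: number
proof (induction z rule: number_induct)
  case def
  show ?case by (intro number_delta0)
next
  case (step z)
  show ?case unfolding number_basic(6) step by (simp only: number_add_ac)
qed (simp only: number_arith)

lemma number_times_assoc: "(x * y) * z = x * (y * z)" for x y z :: number
proof (induction z rule: number_induct)
  case def
  show ?case by (intro number_delta0)
next
  case (step z)
  have "x * (y * z + y) = (y * z) * x + y * x"
    using number_distrib[of "y * z" y x] number_times_comm[of x "y * z + y"] by simp
  then show ?case using step number_times_comm[of x "y * z"] number_times_comm[of x y]
    by (simp only: number_basic(6))
qed (simp only: number_arith)

lemma number_add_cancel: "x + z = y + z \<longrightarrow> x = y" for x y z :: number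
proof (induction z rule: number_induct)
  case def
  show ?case by (intro number_delta0)
next
  case (step z)
  then show ?case using number_basic(2)[of "x + z" "y + z"] by (simp only: number_basic(4)) blast
qed (simp add: number_arith)

lemma number_less_add: "x < x + y + 1" for x y :: number
proof (induction y rule: number_induct)
  case def
  show ?case by (intro number_delta0)
qed (simp_all add: number_arith)

text \<open>The quantifier stands in front of the implication so that the induction formula is
  \<Sigma>1 as it is written.\<close>

lemma number_less_ex: "\<exists>z. x < y \<longrightarrow> y = x + z + 1" for x y :: number
proof -
  have "\<exists>z\<in>UNIV. x < y \<longrightarrow> y = x + z + 1"
  proof (rule number.sigma1_induct[of "\<lambda>y z. x < y \<longrightarrow> y = x + z + 1"])
    show "number.delta0 (\<lambda>e. x < e 0 \<longrightarrow> e 0 = x + e 1 + 1)" by (intro number_delta0)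
    show "\<exists>z\<in>UNIV. x < y + 1 \<longrightarrow> y + 1 = x + z + 1" if IH: "\<exists>z\<in>UNIV. x < y \<longrightarrow> y = x + z + 1" for y
    proof (cases "x < y")
      case True
      then obtain z where "y = x + z + 1" using IH by blast
      then have "y + 1 = x + (z + 1) + 1" by (simp only: number_arith)
      then show ?thesis by blast
    next
      case False
      then have "x < y + 1 \<longrightarrow> y + 1 = x + 0 + 1" by (simp add: number_arith)
      then show ?thesis by blast
    qed
  qed (simp_all add: number_arith)
  then show ?thesis by blast
qed

lemma number_less_iff: "x < y \<longleftrightarrow> (\<exists>z. y = x + z + 1)" for x y :: number
  using number_less_ex[of x y] number_less_add[of x] by blast

lemma number_zero_less_or: "0 < x \<or> 0 = x" for x :: number
proof (induction x rule: number_induct)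
  case def
  show ?case by (intro number_delta0)
qed (auto simp: number_arith)

lemma number_trichotomy: "x < y \<or> x = y \<or> y < x" for x y :: number
proof (induction x rule: number_induct)
  case def
  show ?case by (intro number_delta0)
next
  case zero
  show ?case using number_zero_less_or by blast
next
  case (step x)
  then consider "x < y" | "x = y" | "y < x" by blast
  then show ?case
  proof cases
    case 1
    then obtain z where z: "y = x + z + 1" using number_less_iff by blast
    show ?thesis
    proof (cases "z = 0")
      case True
      then show ?thesis using z by (simp add: number_arith)
    next
      case False
      then obtain w where "z = w + 1"
        using number_zero_less_or[of z] number_less_iff[of 0 z] by (auto simp: number_zero_add)
      then have "y = (x + 1) + w + 1" using z by (simp only: number_add_ac)
      then show ?thesis using number_less_iff by blast
    qed
  qed (simp_all add: number_arith)
qed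

instance number :: peano_semiring
proof
  fix a b c :: number
  show "a + b + c = a + (b + c)" by (rule number_add_assoc)
  show "a + b = b + a" by (rule number_add_comm)
  show "0 + a = a" by (rule number_zero_add)
  show "a * b * c = a * (b * c)" by (rule number_times_assoc)
  show "a * b = b * a" by (rule number_times_comm)
  show "1 * a = a" using number_suc_times[of 0 a] by (simp add: number_zero_add number_zero_times)
  show "(a + b) * c = a * c + b * c" by (rule number_distrib)
  show "0 * a = 0" by (rule number_zero_times)
  show "a * 0 = 0" by (rule number_basic)
  show "(0 :: number) \<noteq> 1" using number_basic(1)[of 0] by (simp add: number_zero_add)
  show "a + 1 \<noteq> 0" by (rule number_basic)
  show "a + c = b + c \<Longrightarrow> a = b" using number_add_cancel by blast
  show "a < b \<longleftrightarrow> (\<exists>c. b = a + c + 1)" by (rule number_less_iff)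
  show "a < b \<or> a = b \<or> b < a" by (rule number_trichotomy)
qed


section \<open>The ring of differences\<close>

context peano_semiring
begin

lemma add_left_imp: "c + a = c + b \<Longrightarrow> a = b"
  using add_right_imp by (simp add: add.commute)

lemma less_irrefl': "\<not> a < a"
proof
  assume "a < a"
  then obtain c where "a = a + (c + 1)" unfolding less_iff_add_one by (auto simp: add.assoc)
  then have "a + 0 = a + (c + 1)" by simp
  then have "0 = c + 1" by (rule add_left_imp)
  then show False using add_one_neq_zero by metis
qed

lemma less_add_iff: "a + c < b + c \<longleftrightarrow> a < b"
proof
  assume "a + c < b + c"
  then obtain d where "b + c = (a + d + 1) + c" unfolding less_iff_add_one by (auto simp: ac_simps)
  then show "a < b" unfolding less_iff_add_one using add_right_imp by blast
next
  assume "a < b"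
  then show "a + c < b + c" unfolding less_iff_add_one by (auto simp: ac_simps)
qed

lemma less_trans': "a < b \<Longrightarrow> b < c \<Longrightarrow> a < c"
  unfolding less_iff_add_one by (metis add.assoc)

end

\<comment> \<open>The Grothendieck construction. It provides subtraction, the ring laws and the
  library of ordered rings, while the numbers of the model survive as the non-negative
  elements.\<close>
quotient_type (overloaded) 'a differences = "'a::peano_semiring \<times> 'a" / "\<lambda>(a, b) (c, d). a + d = c + b"
  morphisms Rep_differences Abs_differences
proof (rule equivpI)
  show "reflp (\<lambda>(a, b) (c, d). a + d = c + (b :: 'a))" by (auto simp: reflp_def)
  show "symp (\<lambda>(a, b) (c, d). a + d = c + (b :: 'a))" by (auto simp: symp_def)
  show "transp (\<lambda>(a, b) (c, d). a + d = c + (b :: 'a))"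
  proof (rule transpI, clarify)
    fix a b c d e f :: 'a
    assume "a + d = c + b" "c + f = e + d"
    then have "(a + d) + (c + f) = (c + b) + (e + d)" by simp
    then have "(a + f) + (c + d) = (e + b) + (c + d)" by (simp add: ac_simps)
    then show "a + f = e + b" by (rule add_right_imp)
  qed
qed

instantiation differences :: (peano_semiring) comm_ring_1
begin

lift_definition zero_differences :: "'a differences" is "(0, 0)" .
lift_definition one_differences :: "'a differences" is "(1, 0)" .
lift_definition plus_differences :: "'a differences \<Rightarrow> 'a differences \<Rightarrow> 'a differences"
  is "\<lambda>(a, b) (c, d). (a + c, b + d)"
proof clarsimp
  fix a b c d e f g h :: 'a
  assume "a + d = c + b" "e + h = g + f"
  then have "(a + d) + (e + h) = (c + b) + (g + f)" by simp
  then show "a + e + (d + h) = c + g + (b + f)" by (simp add: ac_simps)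
qed
lift_definition uminus_differences :: "'a differences \<Rightarrow> 'a differences" is "\<lambda>(a, b). (b, a)"
  by (auto simp: ac_simps)
definition minus_differences :: "'a differences \<Rightarrow> 'a differences \<Rightarrow> 'a differences"
  where "minus_differences x y = x + - y"
lift_definition times_differences :: "'a differences \<Rightarrow> 'a differences \<Rightarrow> 'a differences"
  is "\<lambda>(a, b) (c, d). (a * c + b * d, a * d + b * c)"
proof clarsimp
  fix s t u v w x y z :: 'a
  assume "s + v = u + t" "w + z = y + x"
  \<comment> \<open>The first equation times \<open>w\<close>, its reverse times \<open>x\<close>,
    the second equation times \<open>u\<close> and its reverse times \<open>v\<close> are added;
    four mixed products are then common to both sides and cancel.\<close>
  then have "(s + v) * w + (u + t) * x + u * (w + z) + v * (y + x) =
      (u + t) * w + (s + v) * x + u * (y + x) + v * (w + z)" by simp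
  then have "(s * w + t * x + (u * z + v * y)) + (v * w + u * x + u * w + v * x) =
      (u * y + v * z + (s * x + t * w)) + (v * w + u * x + u * w + v * x)"
    by (simp add: algebra_simps)
  then show "s * w + t * x + (u * z + v * y) = u * y + v * z + (s * x + t * w)"
    by (rule add_right_imp)
qed

instance
proof
  fix x y z :: "'a differences"
  show "x + y + z = x + (y + z)" by transfer (auto simp: ac_simps)
  show "x + y = y + x" by transfer (auto simp: ac_simps)
  show "0 + x = x" by transfer auto
  show "- x + x = 0" by transfer (auto simp: ac_simps)
  show "x - y = x + - y" by (rule minus_differences_def)
  show "x * y * z = x * (y * z)" by transfer (auto simp: algebra_simps)
  show "x * y = y * x" by transfer (auto simp: algebra_simps)
  show "1 * x = x" by transfer auto
  show "(x + y) * z = x * z + y * z" by transfer (auto simp: algebra_simps)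
  show "(0 :: 'a differences) \<noteq> 1" by transfer auto
qed

end

instantiation differences :: (peano_semiring) linordered_idom
begin

lift_definition less_differences :: "'a differences \<Rightarrow> 'a differences \<Rightarrow> bool"
  is "\<lambda>(a, b) (c, d). a + d < c + b"
proof clarsimp
  fix a b c d e f g h :: 'a
  assume *: "a + d = c + b" "e + h = g + f"
  have "a + f < e + b \<longleftrightarrow> (a + f) + (d + h) < (e + b) + (d + h)" by (simp only: less_add_iff)
  also have "(a + f) + (d + h) = (a + d) + (f + h)" by (simp add: ac_simps)
  also have "\<dots> = (c + h) + (b + f)" by (simp add: * ac_simps)
  also have "(e + b) + (d + h) = (e + h) + (d + b)" by (simp add: ac_simps)
  also have "\<dots> = (g + d) + (b + f)" by (simp add: * ac_simps)
  finally show "a + f < e + b \<longleftrightarrow> c + h < g + d" by (simp only: less_add_iff)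
qed

definition less_eq_differences :: "'a differences \<Rightarrow> 'a differences \<Rightarrow> bool"
  where "less_eq_differences x y \<longleftrightarrow> x < y \<or> x = y"
definition abs_differences :: "'a differences \<Rightarrow> 'a differences"
  where "abs_differences x = (if x < 0 then - x else x)"
definition sgn_differences :: "'a differences \<Rightarrow> 'a differences"
  where "sgn_differences x = (if x = 0 then 0 else if 0 < x then 1 else - 1)"

lemma differences_less_irrefl: "\<not> x < x" for x :: "'a differences"
  by transfer (auto simp: less_irrefl')

lemma differences_less_trans: "x < y \<Longrightarrow> y < z \<Longrightarrow> x < z" for x y z :: "'a differences"
proof (transfer, clarify)
  fix a b c d e f :: 'a
  assume "a + d < c + b" "c + f < e + d"
  then have "(a + d) + f < (c + b) + f" "(c + f) + b < (e + d) + b" by (simp_all only: less_add_iff)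
  then have "(a + f) + d < (c + b) + f" "(c + b) + f < (e + b) + d" by (simp_all add: ac_simps)
  then have "(a + f) + d < (e + b) + d" by (rule less_trans')
  then show "a + f < e + b" by (simp only: less_add_iff)
qed

lemma differences_less_linear: "x < y \<or> x = y \<or> y < x" for x y :: "'a differences"
  by transfer (clarsimp, metis less_trichotomy)

lemma differences_add_strict_mono: "x < y \<Longrightarrow> z + x < z + y" for x y z :: "'a differences"
proof (transfer, clarsimp)
  fix a b c d e f :: 'a
  assume "a + d < c + b"
  then have "(a + d) + (e + f) < (c + b) + (e + f)" by (simp only: less_add_iff)
  then show "e + a + (f + d) < e + c + (f + b)" by (simp add: ac_simps)
qed

lemma differences_mult_strict_mono: "x < y \<Longrightarrow> 0 < z \<Longrightarrow> z * x < z * y" for x y z :: "'a differences"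
proof (transfer, clarsimp)
  fix a b c d e f :: 'a
  assume "a + d < c + b" "f < e"
  then obtain k l where k: "c + b = a + d + k + 1" and l: "e = f + l + 1"
    unfolding less_iff_add_one by blast
  have "e * c + f * d + (e * b + f * a) = f * (c + b) + (l + 1) * (c + b) + f * (a + d)"
    unfolding l by (simp add: algebra_simps)
  also have "(l + 1) * (c + b) = (l + 1) * (a + d) + (l * k + l + k) + 1"
    unfolding k by (simp add: algebra_simps)
  also have "f * (c + b) + ((l + 1) * (a + d) + (l * k + l + k) + 1) + f * (a + d) =
      (e * a + f * b + (e * d + f * c)) + (l * k + l + k) + 1"
    unfolding l by (simp add: algebra_simps)
  finally have "\<exists>c'. e * c + f * d + (e * b + f * a) = (e * a + f * b + (e * d + f * c)) + c' + 1" ..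
  then show "e * a + f * b + (e * d + f * c) < e * c + f * d + (e * b + f * a)"
    by (simp only: less_iff_add_one)
qed

instance
proof
  fix x y z :: "'a differences"
  show "x < y \<longleftrightarrow> x \<le> y \<and> \<not> y \<le> x"
    unfolding less_eq_differences_def
    using differences_less_irrefl[of x] differences_less_trans[of x y x] by blast
  show "x \<le> x" unfolding less_eq_differences_def by blast
  show "x \<le> y \<Longrightarrow> y \<le> z \<Longrightarrow> x \<le> z"
    unfolding less_eq_differences_def using differences_less_trans[of x y z] by blast
  show "x \<le> y \<Longrightarrow> y \<le> x \<Longrightarrow> x = y"
    unfolding less_eq_differences_def
    using differences_less_irrefl[of x] differences_less_trans[of x y x] by blast
  show "x \<le> y \<or> y \<le> x" unfolding less_eq_differences_def using differences_less_linear[of x y] by blast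
  show "x \<le> y \<Longrightarrow> z + x \<le> z + y"
    unfolding less_eq_differences_def using differences_add_strict_mono[of x y z] by blast
  show "x < y \<Longrightarrow> 0 < z \<Longrightarrow> z * x < z * y" by (rule differences_mult_strict_mono)
  show "\<bar>x\<bar> = (if x < 0 then - x else x)" by (rule abs_differences_def)
  show "sgn x = (if x = 0 then 0 else if 0 < x then 1 else - 1)" by (rule sgn_differences_def)
qed

end

section \<open>Embedding the numbers into the ring\<close>

lift_definition difference :: "'a::peano_semiring \<Rightarrow> 'a differences" is "\<lambda>a. (a, 0)" .

lemma difference_zero [simp]: "difference 0 = 0"
  by transfer simp

lemma difference_one [simp]: "difference 1 = 1"
  by transfer simp

lemma difference_add [simp]: "difference (a + b) = difference a + difference b"
  by transfer simp

lemma difference_mult [simp]: "difference (a * b) = difference a * difference b"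
  by transfer simp

lemma difference_less [simp]: "difference a < difference b \<longleftrightarrow> a < b"
  by transfer simp

lemma difference_eq [simp]: "difference a = difference b \<longleftrightarrow> a = b"
  by transfer simp

lemma range_difference: "range difference = {0..}"
proof -
  have "\<exists>a. x = difference a" if "0 \<le> x" for x :: "'a differences"
    using that unfolding less_eq_differences_def
  proof (transfer, clarsimp)
    fix a b :: 'a
    assume "b < a \<or> b = a"
    then obtain c where "a = c + b"
      unfolding less_iff_add_one by (metis add.assoc add.commute add_0)
    then show "\<exists>c. a = c + b" by blast
  qed
  moreover have "0 \<le> difference a" for a :: 'a
  proof -
    have "\<not> a < 0" unfolding less_iff_add_one by (metis add_one_neq_zero)
    then have "\<not> difference a < 0" by (metis difference_less difference_zero)
    then show ?thesis by simp
  qed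
  ultimately show ?thesis by auto
qed

lemma difference_discrete: "0 < x \<Longrightarrow> 1 \<le> x" for x :: "'a::peano_semiring differences"
proof -
  assume "0 < x"
  then obtain a where a: "x = difference a" using range_difference by (metis atLeast_iff less_imp_le rangeE)
  with \<open>0 < x\<close> have "0 < a" using difference_zero difference_less by metis
  then obtain c where "a = c + 1" unfolding less_iff_add_one by auto
  then have "x = difference c + 1" using a by simp
  moreover have "0 \<le> difference c" using range_difference by blast
  ultimately show ?thesis by simp
qed

lemma eval_difference: "eval (\<lambda>i. difference (e i)) t = difference (eval e t)"
  by (induction t) auto

lemma sat_difference:
  "sat {0..} ((`) difference ` S) (\<lambda>i. difference (e i)) (\<lambda>X. difference ` v X) p \<longleftrightarrow> sat UNIV S e v p"
proof (induction p arbitrary: e v)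
  case (Mem t X)
  show ?case by (auto simp: eval_difference)
next
  case (AllN p)
  have "case_nat (difference x) (\<lambda>i. difference (e i)) = (\<lambda>i. difference (case_nat x e i))" for x
    by (auto split: nat.split)
  then show ?case unfolding range_difference[symmetric] by (simp add: AllN.IH[unfolded range_difference[symmetric]])
next
  case (AllS p)
  have "case_nat (difference ` X) (\<lambda>i. difference ` v i) = (\<lambda>i. difference ` case_nat X v i)" for X
    by (rule ext) (simp split: nat.split)
  then show ?case by (simp add: AllS.IH)
qed (simp_all add: eval_difference)

section \<open>Arithmetic in the ring of a model\<close>

definition pr :: "'a::linordered_idom \<Rightarrow> 'a \<Rightarrow> 'a"
  where "pr x y = (x + y) * (x + y) + x"

text \<open>Finite sets are coded by pairs \<open>(M, c)\<close>: the members \<open>i\<close> are those whose slot divides \<open>c\<close>.\<close>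

definition slot :: "'a::linordered_idom \<Rightarrow> 'a \<Rightarrow> 'a"
  where "slot M i = M * (i + 1) + 1"

locale discrete_rca = rca "{0..}" S for S :: "'a::linordered_idom set set" +
  assumes discrete: "0 < (x :: 'a) \<Longrightarrow> 1 \<le> x"
begin

abbreviation N :: "'a set" where "N \<equiv> {0..}"

lemma less_iff_add_one_le: "x < y \<longleftrightarrow> x + 1 \<le> y" for x y :: 'a
  using discrete[of "y - x"] by (auto simp: algebra_simps intro: less_le_trans[of x "x + 1"])

lemma less_add_one_iff: "x < y + 1 \<longleftrightarrow> x \<le> y" for x y :: 'a
  unfolding less_iff_add_one_le by simp

lemma pr_in: "x \<in> N \<Longrightarrow> y \<in> N \<Longrightarrow> pr x y \<in> N"
  by (simp add: pr_def)

lemma square_ge: "0 \<le> x \<Longrightarrow> x \<le> x * x" for x :: 'a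
proof (cases "x = 0")
  case False
  assume "0 \<le> x"
  then have "1 * x \<le> x * x" using discrete[of x] False by (intro mult_right_mono) auto
  then show ?thesis by simp
qed simp

lemma pr_ge1: "x \<in> N \<Longrightarrow> y \<in> N \<Longrightarrow> x \<le> pr x y"
  by (simp add: pr_def)

lemma pr_ge2: "x \<in> N \<Longrightarrow> y \<in> N \<Longrightarrow> y \<le> pr x y"
  using square_ge[of "x + y"] by (simp add: pr_def)

lemma pr_less1: "x \<in> N \<Longrightarrow> y \<in> N \<Longrightarrow> x < pr x y + 1"
  and pr_less2: "x \<in> N \<Longrightarrow> y \<in> N \<Longrightarrow> y < pr x y + 1"
  using pr_ge1[of x y] pr_ge2[of x y] by (simp_all add: less_add_one_iff)

text \<open>\<open>pr x y\<close> lies below the square of \<open>x + y + 1\<close>, while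
  \<open>pr x' y'\<close> is at least the square of \<open>x' + y'\<close>. So a code determines the
  sum of its components.\<close>

lemma pr_inject_aux:
  assumes "x \<in> N" "y \<in> N" "x' \<in> N" "y' \<in> N" "x + y < x' + y'"
  shows "pr x y < pr x' y'"
proof -
  define s where "s = x + y"
  have "s + 1 \<le> x' + y'" using assms(5) by (simp add: s_def less_iff_add_one_le)
  then have "(s + 1) * (s + 1) \<le> (x' + y') * (x' + y')"
    using assms by (intro mult_mono) (auto simp: s_def)
  moreover have "pr x y < (s + 1) * (s + 1)"
    using assms by (simp add: pr_def s_def[symmetric] algebra_simps) (simp add: s_def)
  ultimately show ?thesis using assms(3) by (simp add: pr_def)
qed

lemma pr_inject:
  assumes "x \<in> N" "y \<in> N" "x' \<in> N" "y' \<in> N"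
  shows "pr x y = pr x' y' \<longleftrightarrow> x = x' \<and> y = y'"
proof
  assume eq: "pr x y = pr x' y'"
  then have "x + y = x' + y'"
    using pr_inject_aux[of x y x' y'] pr_inject_aux[of x' y' x y] assms
    by (metis less_irrefl linorder_neqE)
  then show "x = x' \<and> y = y'" using eq by (simp add: pr_def)
qed simp

lemma term_fun_pr: "term_fun f \<Longrightarrow> term_fun g \<Longrightarrow> term_fun (\<lambda>e. pr (f e) (g e))"
  unfolding pr_def by (intro term_fun_intros)

lemma term_fun_slot: "term_fun f \<Longrightarrow> term_fun g \<Longrightarrow> term_fun (\<lambda>e. slot (f e) (g e))"
  unfolding slot_def by (intro term_fun_intros)

lemma delta0_le: "term_fun f \<Longrightarrow> term_fun g \<Longrightarrow> delta0 (\<lambda>e. f e \<le> g e)"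
  unfolding less_add_one_iff[symmetric] by (intro delta0_intros)

lemma eval_in: "range e \<subseteq> N \<Longrightarrow> eval e t \<in> N"
  by (induction t) (auto simp: image_subset_iff)

lemma term_fun_in: "term_fun f \<Longrightarrow> range e \<subseteq> N \<Longrightarrow> f e \<in> N"
proof -
  assume "term_fun f" and e: "range e \<subseteq> N"
  then obtain t \<sigma> where "valid \<sigma>" "f e = eval (params \<sigma> e) t" unfolding term_fun_def by blast
  moreover have "range (params \<sigma> e) \<subseteq> N"
    using e \<open>valid \<sigma>\<close> by (auto simp: image_subset_iff params_def valid_def split: sum.split)
  ultimately show ?thesis using eval_in by simp
qed

lemma dvd_le: "a dvd b \<Longrightarrow> 0 < b \<Longrightarrow> a \<le> b" for a b :: 'a
proof (cases "0 < a")
  case True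
  assume "a dvd b" "0 < b"
  then obtain k where k: "b = a * k" by (elim dvdE)
  then have "0 < k" using True \<open>0 < b\<close> by (auto simp: zero_less_mult_iff)
  then have "a * 1 \<le> a * k" using True discrete by (intro mult_left_mono) auto
  then show ?thesis using k by simp
next
  case False
  assume "0 < b"
  then show ?thesis using False by simp
qed

text \<open>A quotient of a positive \<open>b\<close> is at most \<open>b\<close>, and for
  \<open>b = 0\<close> the quotient 0 can be taken. This makes divisibility a bounded
  relation.\<close>

lemma dvd_iff: "a \<in> N \<Longrightarrow> b \<in> N \<Longrightarrow> a dvd b \<longleftrightarrow> (\<exists>k\<in>N. k < b + 1 \<and> b = a * k)"
proof
  assume *: "a \<in> N" "b \<in> N" "a dvd b"
  show "\<exists>k\<in>N. k < b + 1 \<and> b = a * k"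
  proof (cases "b = 0")
    case True
    then show ?thesis by (intro bexI[of _ 0]) auto
  next
    case False
    obtain k where k: "b = a * k" using *(3) by (elim dvdE)
    have "0 < b" using False *(2) by simp
    then have "0 < k" using k *(1) by (auto simp: zero_less_mult_iff)
    moreover have "k \<le> b" using \<open>0 < b\<close> k by (intro dvd_le) auto
    ultimately show ?thesis using k by (intro bexI[of _ k]) (auto simp: less_add_one_iff)
  qed
qed auto

lemma delta0_dvd:
  assumes "term_fun f" and "term_fun g" shows "delta0 (\<lambda>e. f e dvd g e)"
proof (rule delta0_cong)
  \<comment> \<open>Under the new quantifier the old environment is
    \<open>\<lambda>i. e (Suc i)\<close>, so the terms for \<open>f\<close> and \<open>g\<close>
    have to be renamed.\<close>
  have shift: "term_fun (\<lambda>e. h (\<lambda>i. e (Suc i)))" if h: "term_fun h" for h :: "(nat \<Rightarrow> 'a) \<Rightarrow> 'a"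
  proof -
    obtain t \<sigma> where "valid \<sigma>" "\<And>e. h e = eval (params \<sigma> e) t" using h unfolding term_fun_def by blast
    moreover have "params \<sigma> (\<lambda>i. e (Suc i)) = params (\<lambda>i. map_sum Suc id (\<sigma> i)) e" for e
      by (auto simp: params_def split: sum.split)
    moreover have "valid (\<lambda>i. map_sum Suc id (\<sigma> i))"
      using \<open>valid \<sigma>\<close> by (auto simp: valid_def map_sum_def split: sum.splits)
    ultimately show ?thesis
      unfolding term_fun_def by (intro exI[of _ t] exI[of _ "\<lambda>i. map_sum Suc id (\<sigma> i)"]) simp
  qed
  show "delta0 (\<lambda>e. \<exists>k\<in>N. k < g e + 1 \<and> g e = f e * k)"
    by (intro delta0_intros shift assms)
  show "(\<exists>k\<in>N. k < g e + 1 \<and> g e = f e * k) = (f e dvd g e)" if "range e \<subseteq> N" for e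
    using dvd_iff term_fun_in[OF assms(1) that] term_fun_in[OF assms(2) that] by blast
qed

lemmas delta0_rules = delta0_intros term_fun_pr term_fun_slot delta0_le delta0_dvd

text \<open>Without a least element, every number would fail the \<Pi>1 property, by
  course-of-values induction. To keep the induction formula in \<Sigma>1 form, it carries one bound
  \<open>w\<close> for the counterexamples of all \<open>k\<close> up to \<open>x\<close>; only
  \<open>w\<close> is quantified without a bound.\<close>

lemma pi1_least:
  assumes def: "delta0 (\<lambda>e. P (e 0) (e 1))" and a: "a \<in> N" "\<forall>y\<in>N. P a y"
  shows "\<exists>m\<in>N. (\<forall>y\<in>N. P m y) \<and> (\<forall>k\<in>N. k < m \<longrightarrow> (\<exists>y\<in>N. \<not> P k y))"
proof (rule ccontr)
  assume "\<not> ?thesis"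
  then have no: "\<exists>k\<in>N. k < m \<and> (\<forall>y\<in>N. P k y)" if "m \<in> N" "\<forall>y\<in>N. P m y" for m
    using that by blast
  have "\<exists>w\<in>N. \<forall>k\<in>N. k < a + 1 \<longrightarrow> (\<exists>y\<in>N. y < w \<and> \<not> P k y)"
  proof (rule sigma1_induct[of "\<lambda>x w. \<forall>k\<in>N. k < x + 1 \<longrightarrow> (\<exists>y\<in>N. y < w \<and> \<not> P k y)"])
    have "delta0 (\<lambda>e. P (e 1) (e 0))"
      using delta0_rename[OF def, of "case_nat 1 (\<lambda>_. 0)"] by simp
    then show "delta0 (\<lambda>e. \<forall>k\<in>N. k < e 0 + 1 \<longrightarrow> (\<exists>y\<in>N. y < e 1 \<and> \<not> P k y))"
      by (intro delta0_rules) simp_all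
    obtain y where y: "y \<in> N" "\<not> P 0 y" using no[of 0] by force
    show "\<exists>w\<in>N. \<forall>k\<in>N. k < 0 + 1 \<longrightarrow> (\<exists>y\<in>N. y < w \<and> \<not> P k y)"
    proof (rule bexI[of _ "y + 1"], intro ballI impI)
      fix k assume "k \<in> N" "k < 0 + 1"
      then have "k = 0" using less_add_one_iff[of k 0] by simp
      then show "\<exists>z\<in>N. z < y + 1 \<and> \<not> P k z" using y by (intro bexI[of _ y]) auto
    qed (use y in simp)
    show "\<exists>w\<in>N. \<forall>k\<in>N. k < x + 1 + 1 \<longrightarrow> (\<exists>y\<in>N. y < w \<and> \<not> P k y)"
      if x: "x \<in> N" and IH: "\<exists>w\<in>N. \<forall>k\<in>N. k < x + 1 \<longrightarrow> (\<exists>y\<in>N. y < w \<and> \<not> P k y)" for x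
    proof -
      obtain w where w: "w \<in> N" "\<And>k. k \<in> N \<Longrightarrow> k < x + 1 \<Longrightarrow> \<exists>y\<in>N. y < w \<and> \<not> P k y" using IH by blast
      obtain y where y: "y \<in> N" "\<not> P (x + 1) y" using no[of "x + 1"] w x by force
      show ?thesis
      proof (rule bexI[of _ "w + y + 1"], intro ballI impI)
        fix k assume k: "k \<in> N" "k < x + 1 + 1"
        show "\<exists>z\<in>N. z < w + y + 1 \<and> \<not> P k z"
        proof (cases "k = x + 1")
          case True
          then show ?thesis using y w(1) by (intro bexI[of _ y]) auto
        next
          case False
          then have "k < x + 1" using k(2) less_add_one_iff[of k "x + 1"] by simp
          then obtain z where "z \<in> N" "z < w" "\<not> P k z" using w(2) k(1) by blast
          then show ?thesis using y by (intro bexI[of _ z]) auto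
        qed
      qed (use w y in simp)
    qed
  qed (fact a)
  then obtain y where "y \<in> N" "\<not> P a y" using a(1) by (auto simp: less_add_one_iff)
  then show False using a(2) by blast
qed

lemma division:
  assumes "n \<in> N" "0 < q" obtains k r where "k \<in> N" "r \<in> N" "r < q" "n = q * k + r"
proof -
  have "\<exists>k\<in>N. \<exists>r\<in>N. r < q \<and> n = q * k + r"
  proof (rule sigma1_induct[of "\<lambda>n k. \<exists>r\<in>N. r < q \<and> n = q * k + r"])
    show "delta0 (\<lambda>e. \<exists>r\<in>N. r < q \<and> e 0 = q * e 1 + r)"
      by (intro delta0_rules) (use assms in auto)
    show "\<exists>k\<in>N. \<exists>r\<in>N. r < q \<and> x + 1 = q * k + r" if "x \<in> N" and "\<exists>k\<in>N. \<exists>r\<in>N. r < q \<and> x = q * k + r" for x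
    proof -
      obtain k r where *: "k \<in> N" "r \<in> N" "r < q" "x = q * k + r" using \<open>\<exists>k\<in>N. _\<close> by blast
      show ?thesis
      proof (cases "r + 1 = q")
        case True
        then have "x + 1 = q * (k + 1) + 0" using * by (simp add: algebra_simps)
        then show ?thesis using * assms by (intro bexI[of _ "k + 1"] bexI[of _ 0]) auto
      next
        case False
        then have "r + 1 < q" using *(3) less_iff_add_one_le[of r q] by simp
        then show ?thesis using * by (intro bexI[of _ k] bexI[of _ "r + 1"]) auto
      qed
    qed
    show "\<exists>k\<in>N. \<exists>r\<in>N. r < q \<and> 0 = q * k + r"
      using assms by (intro bexI[of _ 0]) auto
  qed (fact assms)
  then show ?thesis using that by blast
qed


section \<open>Codes of finite sets and strong bounding\<close>

lemma slot_pos: "M \<in> N \<Longrightarrow> i \<in> N \<Longrightarrow> 0 < slot M i"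
  by (simp add: slot_def add_nonneg_pos)

text \<open>It replaces the factorial, whose definition would need recursion; mere existence of a
  multiple is a \<Sigma>1 statement.\<close>

lemma common_multiple:
  assumes "p \<in> N" obtains M where "M \<in> N" "0 < M" "\<And>i. i \<in> N \<Longrightarrow> i < p \<Longrightarrow> i + 1 dvd M"
proof -
  have "\<exists>M\<in>N. 0 < M \<and> (\<forall>i\<in>N. i < p \<longrightarrow> i + 1 dvd M)"
  proof (rule sigma1_induct[of "\<lambda>p M. 0 < M \<and> (\<forall>i\<in>N. i < p \<longrightarrow> i + 1 dvd M)"])
    show "delta0 (\<lambda>e. 0 < e 1 \<and> (\<forall>i\<in>N. i < e 0 \<longrightarrow> i + 1 dvd e 1))"
      by (intro delta0_rules)
    show "\<exists>M\<in>N. 0 < M \<and> (\<forall>i\<in>N. i < 0 \<longrightarrow> i + 1 dvd M)"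
      by (intro bexI[of _ 1]) auto
    show "\<exists>M\<in>N. 0 < M \<and> (\<forall>i\<in>N. i < x + 1 \<longrightarrow> i + 1 dvd M)"
      if x: "x \<in> N" and IH: "\<exists>M\<in>N. 0 < M \<and> (\<forall>i\<in>N. i < x \<longrightarrow> i + 1 dvd M)" for x
    proof -
      obtain M where M: "M \<in> N" "0 < M" "\<And>i. i \<in> N \<Longrightarrow> i < x \<Longrightarrow> i + 1 dvd M" using IH by blast
      have "i + 1 dvd M * (x + 1)" if "i \<in> N" "i < x + 1" for i
        using M(3)[of i] that by (cases "i = x") (auto simp: less_add_one_iff)
      then show ?thesis using M x by (intro bexI[of _ "M * (x + 1)"]) (auto intro!: mult_pos_pos add_nonneg_pos)
    qed
  qed (fact assms)
  then show ?thesis using that by blast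
qed

text \<open>Cancellation without greatest common divisors. Since
  \<open>(j + 1) * slot M i - (i + 1) * slot M j = j - i\<close>, the slot of \<open>j\<close>
  divides \<open>(j - i) * n\<close>. As \<open>j - i\<close> divides \<open>M\<close>, it then
  divides \<open>M * (j + 1) * n\<close>, and \<open>M * (j + 1)\<close> is \<open>-1\<close> modulo
  the slot of \<open>j\<close>.\<close>

lemma slot_coprime:
  assumes M: "\<And>i. i \<in> N \<Longrightarrow> i < p \<Longrightarrow> i + 1 dvd M"
    and ij: "i \<in> N" "j \<in> N" "i < p" "j < p" "i \<noteq> j" and dvd: "slot M j dvd slot M i * n"
  shows "slot M j dvd n"
proof -
  have *: "y - x dvd M" if "x \<in> N" "y < p" "x < y" for x y
  proof -
    have "(y - x - 1) + 1 dvd M"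
    proof (rule M)
      show "y - x - 1 \<in> N" using that(3) by (simp add: less_iff_add_one_le algebra_simps)
      have "y - x - 1 < y" using that(1) by (simp add: algebra_simps add_pos_nonneg)
      then show "y - x - 1 < p" using that(2) by simp
    qed
    then show ?thesis by simp
  qed
  have "j - i dvd M"
  proof (cases "i < j")
    case True
    then show ?thesis using * ij by blast
  next
    case False
    then have "i - j dvd M" using * ij by simp
    then show ?thesis by (metis dvd_minus_iff minus_diff_eq minus_dvd_iff)
  qed
  then obtain c where c: "M = (j - i) * c" by (elim dvdE)
  have "slot M j dvd (j + 1) * (slot M i * n) - (i + 1) * n * slot M j"
    using dvd by (intro dvd_diff) auto
  also have "(j + 1) * (slot M i * n) - (i + 1) * n * slot M j = (j - i) * n"
    by (simp add: slot_def algebra_simps)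
  finally have "slot M j dvd (j - i) * n" .
  then have "slot M j dvd (j - i) * n * (c * (j + 1))" by (rule dvd_mult2)
  also have "(j - i) * n * (c * (j + 1)) = (M * (j + 1)) * n" by (simp add: c algebra_simps)
  also have "\<dots> = slot M j * n - n" by (simp add: slot_def algebra_simps)
  finally have "slot M j dvd slot M j * n - n" .
  then have "slot M j dvd slot M j * n - (slot M j * n - n)" by (rule dvd_diff[OF dvd_triv_left])
  then show ?thesis by simp
qed

text \<open>The least positive number divisible by the slots of all members of a bounded
  \<open>\<Sigma>\<^sup>0\<^sub>1\<close> set is divisible by no further slot below the bound.\<close>

lemma sigma1_code:
  assumes T: "T \<in> S" and p: "p \<in> N"
  obtains M c where "M \<in> N" "c \<in> N"
    "\<And>i. i \<in> N \<Longrightarrow> i < p \<Longrightarrow> slot M i dvd c \<longleftrightarrow> (\<exists>t\<in>N. pr i t \<in> T)"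
proof -
  obtain M where M: "M \<in> N" "0 < M" "\<And>i. i \<in> N \<Longrightarrow> i < p \<Longrightarrow> i + 1 dvd M"
    using common_multiple[OF p] by blast
  \<comment> \<open>The product of all slots below the bound shows that the \<Pi>1 property to be
    minimised holds of some number.\<close>
  have "\<exists>c\<in>N. 0 < c \<and> (\<forall>i\<in>N. i < p \<longrightarrow> slot M i dvd c)"
  proof (rule sigma1_induct[of "\<lambda>p c. 0 < c \<and> (\<forall>i\<in>N. i < p \<longrightarrow> slot M i dvd c)"])
    show "delta0 (\<lambda>e. 0 < e 1 \<and> (\<forall>i\<in>N. i < e 0 \<longrightarrow> slot M i dvd e 1))"
      by (intro delta0_rules M)
    show "\<exists>c\<in>N. 0 < c \<and> (\<forall>i\<in>N. i < 0 \<longrightarrow> slot M i dvd c)"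
      by (intro bexI[of _ 1]) auto
    show "\<exists>c\<in>N. 0 < c \<and> (\<forall>i\<in>N. i < x + 1 \<longrightarrow> slot M i dvd c)"
      if x: "x \<in> N" and IH: "\<exists>c\<in>N. 0 < c \<and> (\<forall>i\<in>N. i < x \<longrightarrow> slot M i dvd c)" for x
    proof -
      obtain c where c: "c \<in> N" "0 < c" "\<And>i. i \<in> N \<Longrightarrow> i < x \<Longrightarrow> slot M i dvd c" using IH by blast
      have "slot M i dvd c * slot M x" if "i \<in> N" "i < x + 1" for i
        using c(3)[of i] that by (cases "i = x") (auto simp: less_add_one_iff)
      moreover have "0 < c * slot M x" using c slot_pos[OF M(1) x] by simp
      ultimately show ?thesis by (intro bexI[of _ "c * slot M x"]) auto
    qed
  qed (fact p)
  then obtain c0 where c0: "c0 \<in> N" "0 < c0" "\<And>i. i \<in> N \<Longrightarrow> i < p \<Longrightarrow> slot M i dvd c0" by blast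
  \<comment> \<open>Positivity excludes 0, which every slot divides. The stage \<open>t\<close> is
    left free: it is the unbounded quantifier of the \<Pi>1 property.\<close>
  define R where "R c t \<longleftrightarrow> 0 < c \<and> (\<forall>i\<in>N. i < p \<longrightarrow> pr i t \<in> T \<longrightarrow> slot M i dvd c)" for c t
  have "delta0 (\<lambda>e. R (e 0) (e 1))" unfolding R_def by (intro delta0_rules M T p)
  moreover have "\<forall>t\<in>N. R c0 t" using c0 by (simp add: R_def)
  ultimately obtain c where c: "c \<in> N" "\<forall>t\<in>N. R c t" and least: "\<forall>k\<in>N. k < c \<longrightarrow> (\<exists>t\<in>N. \<not> R k t)"
    using pi1_least[of R c0] c0(1) by blast
  have c_pos: "0 < c" using bspec[OF c(2) D_zero] by (simp add: R_def)
  \<comment> \<open>Otherwise the quotient of \<open>c\<close> by the slot of \<open>i\<close> would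
    be a smaller solution: the slots that are required to divide \<open>c\<close> belong to other
    indices, so by coprimality they still divide the quotient.\<close>
  have "\<exists>t\<in>N. pr i t \<in> T" if i: "i \<in> N" "i < p" and dvd: "slot M i dvd c" for i
  proof (rule ccontr)
    assume no: "\<not> (\<exists>t\<in>N. pr i t \<in> T)"
    obtain k where k: "c = slot M i * k" using dvd by (elim dvdE)
    have pos: "0 < slot M i" using slot_pos M(1) i(1) by blast
    then have "0 < k" using k c_pos by (auto simp: zero_less_mult_iff)
    have "1 < slot M i" using M(2) i(1) by (simp add: slot_def mult_pos_pos add_nonneg_pos)
    then have "1 * k < slot M i * k" using \<open>0 < k\<close> by (intro mult_strict_right_mono) auto
    then have "k < c" using k by simp
    moreover have "k \<in> N" using \<open>0 < k\<close> by simp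
    ultimately obtain t where t: "t \<in> N" "\<not> R k t" using least by blast
    then obtain j where j: "j \<in> N" "j < p" "pr j t \<in> T" "\<not> slot M j dvd k"
      unfolding R_def using \<open>0 < k\<close> by blast
    have "slot M j dvd slot M i * k" using bspec[OF c(2) t(1)] j k unfolding R_def by blast
    moreover have "i \<noteq> j" using no j t(1) by blast
    ultimately have "slot M j dvd k" using slot_coprime[OF M(3) i(1) j(1) i(2) j(2), of k] by blast
    then show False using j(4) by blast
  qed
  moreover have "slot M i dvd c" if "i \<in> N" "i < p" "\<exists>t\<in>N. pr i t \<in> T" for i
    using c(2) that unfolding R_def by blast
  ultimately show ?thesis using that[of M c] M c(1) by blast
qed

text \<open>The code turns the unbounded question whether \<open>i\<close> is ever enumerated into a
  divisibility. The statement that all enumerated indices below \<open>q\<close> have a stage below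
  \<open>b\<close> is then \<Delta>0, and the stages are collected by \<Sigma>1 induction on
  \<open>q\<close>.\<close>

lemma strong_bounding:
  assumes T: "T \<in> S" and p: "p \<in> N"
  obtains b where "b \<in> N"
    "\<And>i t. i \<in> N \<Longrightarrow> i < p \<Longrightarrow> t \<in> N \<Longrightarrow> pr i t \<in> T \<Longrightarrow> \<exists>t\<in>N. t < b \<and> pr i t \<in> T"
proof -
  obtain M c where M: "M \<in> N" "c \<in> N"
    and code: "\<And>i. i \<in> N \<Longrightarrow> i < p \<Longrightarrow> slot M i dvd c \<longleftrightarrow> (\<exists>t\<in>N. pr i t \<in> T)"
    using sigma1_code[OF assms] by blast
  have "\<exists>b\<in>N. \<forall>i\<in>N. i < p \<longrightarrow> i < p \<longrightarrow> slot M i dvd c \<longrightarrow> (\<exists>t\<in>N. t < b \<and> pr i t \<in> T)"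
  proof (rule sigma1_induct[of "\<lambda>q b. \<forall>i\<in>N. i < q \<longrightarrow> i < p \<longrightarrow> slot M i dvd c \<longrightarrow> (\<exists>t\<in>N. t < b \<and> pr i t \<in> T)"])
    show "delta0 (\<lambda>e. \<forall>i\<in>N. i < e 0 \<longrightarrow> i < p \<longrightarrow> slot M i dvd c \<longrightarrow> (\<exists>t\<in>N. t < e 1 \<and> pr i t \<in> T))"
      by (intro delta0_rules M T p)
    show "\<exists>b\<in>N. \<forall>i\<in>N. i < 0 \<longrightarrow> i < p \<longrightarrow> slot M i dvd c \<longrightarrow> (\<exists>t\<in>N. t < b \<and> pr i t \<in> T)"
      by (intro bexI[of _ 0]) auto
    show "\<exists>b\<in>N. \<forall>i\<in>N. i < x + 1 \<longrightarrow> i < p \<longrightarrow> slot M i dvd c \<longrightarrow> (\<exists>t\<in>N. t < b \<and> pr i t \<in> T)"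
      if x: "x \<in> N" and IH: "\<exists>b\<in>N. \<forall>i\<in>N. i < x \<longrightarrow> i < p \<longrightarrow> slot M i dvd c \<longrightarrow> (\<exists>t\<in>N. t < b \<and> pr i t \<in> T)" for x
    proof -
      obtain b where b: "b \<in> N"
        "\<And>i. i \<in> N \<Longrightarrow> i < x \<Longrightarrow> i < p \<Longrightarrow> slot M i dvd c \<Longrightarrow> \<exists>t\<in>N. t < b \<and> pr i t \<in> T" using IH by blast
      \<comment> \<open>If \<open>x\<close> is not below \<open>p\<close> or its slot does not
        divide \<open>c\<close>, no stage is required and 0 is taken.\<close>
      obtain u where u: "u \<in> N" "x < p \<Longrightarrow> slot M x dvd c \<Longrightarrow> pr x u \<in> T"
        using code[OF x] D_zero by blast
      show ?thesis
      proof (rule bexI[of _ "b + u + 1"], intro ballI impI)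
        fix i assume i: "i \<in> N" "i < x + 1" "i < p" "slot M i dvd c"
        show "\<exists>t\<in>N. t < b + u + 1 \<and> pr i t \<in> T"
        proof (cases "i = x")
          case True
          then show ?thesis using u b(1) i by (intro bexI[of _ u]) auto
        next
          case False
          then have "i < x" using i(2) by (simp add: less_add_one_iff)
          then obtain t where "t \<in> N" "t < b" "pr i t \<in> T" using b(2) i by blast
          then show ?thesis using u by (intro bexI[of _ t]) auto
        qed
      qed (use b u in simp)
    qed
  qed (fact p)
  then obtain b where "b \<in> N" "\<And>i. i \<in> N \<Longrightarrow> i < p \<Longrightarrow> slot M i dvd c \<Longrightarrow> \<exists>t\<in>N. t < b \<and> pr i t \<in> T" by blast
  then show ?thesis using that[of b] code by blast
qed

text \<open>The set is the projection of the pairs \<open>pr i 0\<close> with \<open>i\<close> in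
  \<open>X\<close>, so the coding of \<Sigma>1 sets applies.\<close>

lemma set_code:
  assumes X: "X \<in> S" and p: "p \<in> N"
  obtains M c where "M \<in> N" "c \<in> N" "\<And>i. i \<in> N \<Longrightarrow> i < p \<Longrightarrow> slot M i dvd c \<longleftrightarrow> i \<in> X"
proof -
  have T: "{z\<in>N. \<exists>i\<in>N. i < z + 1 \<and> z = pr i 0 \<and> i \<in> X} \<in> S" (is "?T \<in> S")
    by (intro delta0_comprehension delta0_rules X)
  have iff: "(\<exists>t\<in>N. pr i t \<in> ?T) \<longleftrightarrow> i \<in> X" if "i \<in> N" for i
  proof
    assume "\<exists>t\<in>N. pr i t \<in> ?T"
    then show "i \<in> X" using that by (auto simp: pr_inject)
  next
    assume "i \<in> X"
    then have "pr i 0 \<in> ?T" using that pr_in[of i 0] pr_less1[of i 0] by auto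
    then show "\<exists>t\<in>N. pr i t \<in> ?T" by (intro bexI[of _ 0]) auto
  qed
  obtain M c where "M \<in> N" "c \<in> N" "\<And>i. i \<in> N \<Longrightarrow> i < p \<Longrightarrow> slot M i dvd c \<longleftrightarrow> (\<exists>t\<in>N. pr i t \<in> ?T)"
    using sigma1_code[OF T p] by blast
  then show ?thesis using that[of M c] iff by simp
qed

section \<open>Alternating sets\<close>

text \<open>If a set \<open>G\<close> satisfies \<open>n \<in> G \<longleftrightarrow> alternating I n (\<lambda>r. r \<in> G)\<close>, then \<open>n \<in> G\<close> is the parity of
  the length of the chain that starts with \<open>n\<close> and goes from each \<open>n\<close> to the largest \<open>r < n\<close>
  with \<open>(n, r) \<in> I\<close>.\<close>

definition last_in :: "'a set \<Rightarrow> 'a \<Rightarrow> 'a \<Rightarrow> bool" where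
  "last_in I n r \<longleftrightarrow> pr n r \<in> I \<and> (\<forall>s\<in>N. s < n \<longrightarrow> r < s \<longrightarrow> pr n s \<notin> I)"

definition alternating :: "'a set \<Rightarrow> 'a \<Rightarrow> ('a \<Rightarrow> bool) \<Rightarrow> bool" where
  "alternating I n B \<longleftrightarrow> (\<exists>r\<in>N. r < n \<and> last_in I n r \<and> \<not> B r)"

text \<open>A number pair coding a solution of the recursion on the interval from 0 to
  \<open>n\<close>. Unlike the solution itself, such pairs can be quantified over in a \<Sigma>1
  formula.\<close>

definition approximates :: "'a set \<Rightarrow> 'a \<Rightarrow> 'a \<Rightarrow> 'a \<Rightarrow> bool" where
  "approximates I n M c \<longleftrightarrow>
    (\<forall>k\<in>N. k < n + 1 \<longrightarrow> (slot M k dvd c \<longleftrightarrow> alternating I k (\<lambda>r. slot M r dvd c)))"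

lemma alternating_cong:
  "(\<And>r. r \<in> N \<Longrightarrow> r < n \<Longrightarrow> B r = C r) \<Longrightarrow> alternating I n B = alternating I n C"
  unfolding alternating_def by blast

context
  fixes I assumes I: "I \<in> S"
begin

text \<open>The number \<open>z\<close> bounds both components because the induction principle
  allows a single unbounded quantifier.\<close>

lemma approximation_exists:
  assumes "n \<in> N" shows "\<exists>z\<in>N. \<exists>M\<in>N. M < z \<and> (\<exists>c\<in>N. c < z \<and> approximates I n M c)"
proof (rule sigma1_induct[of "\<lambda>n z. \<exists>M\<in>N. M < z \<and> (\<exists>c\<in>N. c < z \<and> approximates I n M c)"])
  show "delta0 (\<lambda>e. \<exists>M\<in>N. M < e 1 \<and> (\<exists>c\<in>N. c < e 1 \<and> approximates I (e 0) M c))"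
    unfolding approximates_def alternating_def last_in_def by (intro delta0_rules I)
  \<comment> \<open>The value at \<open>n\<close> depends only on values below \<open>n\<close>.
    Recomputing all values from the old code and coding the result anew extends the solution; for
    \<open>n = 0\<close> nothing is assumed of the old code, which also gives the start of the
    induction.\<close>
  have approx: "\<exists>z\<in>N. \<exists>M\<in>N. M < z \<and> (\<exists>c\<in>N. c < z \<and> approximates I n M c)"
    if "n \<in> N" "M \<in> N" "c \<in> N"
      and old: "\<And>k. k \<in> N \<Longrightarrow> k < n \<Longrightarrow> slot M k dvd c \<longleftrightarrow> alternating I k (\<lambda>r. slot M r dvd c)" for n M c
  proof -
    have "{i\<in>N. alternating I i (\<lambda>r. slot M r dvd c)} \<in> S"
      unfolding alternating_def last_in_def by (intro delta0_comprehension delta0_rules I that(2,3))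
    moreover have "n + 1 \<in> N" using \<open>n \<in> N\<close> by simp
    ultimately obtain M' c' where M': "M' \<in> N" "c' \<in> N"
      and code: "\<And>i. i \<in> N \<Longrightarrow> i < n + 1 \<Longrightarrow>
        slot M' i dvd c' \<longleftrightarrow> i \<in> {i\<in>N. alternating I i (\<lambda>r. slot M r dvd c)}"
      by (rule set_code) blast
    have "approximates I n M' c'"
      unfolding approximates_def
    proof (intro ballI impI)
      fix k assume k: "k \<in> N" "k < n + 1"
      have "slot M' k dvd c' \<longleftrightarrow> alternating I k (\<lambda>r. slot M r dvd c)" using code k by simp
      also have "\<dots> \<longleftrightarrow> alternating I k (\<lambda>r. slot M' r dvd c')"
      proof (rule alternating_cong)
        fix r assume r: "r \<in> N" "r < k"
        then have "r < n" using k(2) by (simp add: less_add_one_iff)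
        then show "slot M r dvd c \<longleftrightarrow> slot M' r dvd c'" using old[of r] code[of r] r by simp
      qed
      finally show "slot M' k dvd c' \<longleftrightarrow> alternating I k (\<lambda>r. slot M' r dvd c')" .
    qed
    moreover have "M' < M' + c' + 1" "c' < M' + c' + 1" "M' + c' + 1 \<in> N"
      using M' by (simp_all add: less_add_one_iff)
    ultimately show ?thesis using M' by blast
  qed
  show "\<exists>z\<in>N. \<exists>M\<in>N. M < z \<and> (\<exists>c\<in>N. c < z \<and> approximates I 0 M c)"
    by (rule approx[of 0 0 0]) auto
  show "\<exists>z\<in>N. \<exists>M\<in>N. M < z \<and> (\<exists>c\<in>N. c < z \<and> approximates I (x + 1) M c)"
    if "x \<in> N" and IH: "\<exists>z\<in>N. \<exists>M\<in>N. M < z \<and> (\<exists>c\<in>N. c < z \<and> approximates I x M c)" for x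
  proof -
    obtain M c where "M \<in> N" "c \<in> N" "approximates I x M c" using IH by blast
    then show ?thesis using \<open>x \<in> N\<close> by (intro approx[of "x + 1" M c]) (simp_all add: approximates_def)
  qed
qed (fact assms)

lemma approximation_unique:
  assumes "n \<in> N" "M \<in> N" "c \<in> N" "approximates I n M c"
    and "n' \<in> N" "M' \<in> N" "c' \<in> N" "approximates I n' M' c'"
    and k: "k \<in> N" "k < n + 1" "k < n' + 1"
  shows "slot M k dvd c \<longleftrightarrow> slot M' k dvd c'"
proof -
  have "\<forall>j\<in>N. j < k + 1 \<longrightarrow> j < n + 1 \<longrightarrow> j < n' + 1 \<longrightarrow> (slot M j dvd c \<longleftrightarrow> slot M' j dvd c')"
  proof (rule delta0_induct[where P = "\<lambda>k. \<forall>j\<in>N. j < k \<longrightarrow> j < n + 1 \<longrightarrow> j < n' + 1 \<longrightarrow> (slot M j dvd c \<longleftrightarrow> slot M' j dvd c')"])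
    show "delta0 (\<lambda>e. \<forall>j\<in>N. j < e 0 \<longrightarrow> j < n + 1 \<longrightarrow> j < n' + 1 \<longrightarrow> (slot M j dvd c \<longleftrightarrow> slot M' j dvd c'))"
      by (intro delta0_rules) (use assms in auto)
    fix x assume "x \<in> N"
      and IH: "\<forall>j\<in>N. j < x \<longrightarrow> j < n + 1 \<longrightarrow> j < n' + 1 \<longrightarrow> (slot M j dvd c \<longleftrightarrow> slot M' j dvd c')"
    show "\<forall>j\<in>N. j < x + 1 \<longrightarrow> j < n + 1 \<longrightarrow> j < n' + 1 \<longrightarrow> (slot M j dvd c \<longleftrightarrow> slot M' j dvd c')"
    proof (intro ballI impI)
      fix j assume j: "j \<in> N" "j < x + 1" "j < n + 1" "j < n' + 1"
      have "slot M j dvd c \<longleftrightarrow> alternating I j (\<lambda>r. slot M r dvd c)"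
        using assms(4) j unfolding approximates_def by blast
      also have "\<dots> \<longleftrightarrow> alternating I j (\<lambda>r. slot M' r dvd c')"
      proof (rule alternating_cong)
        fix r assume "r \<in> N" "r < j"
        then show "slot M r dvd c \<longleftrightarrow> slot M' r dvd c'" using IH j by (auto simp: less_add_one_iff)
      qed
      also have "\<dots> \<longleftrightarrow> slot M' j dvd c'"
        using assms(8) j unfolding approximates_def by blast
      finally show "slot M j dvd c \<longleftrightarrow> slot M' j dvd c'" .
    qed
  qed (use k in auto)
  then show ?thesis using k by auto
qed

text \<open>As approximations exist and agree, membership according to some approximation is the
  same as membership according to all of them. This is the \<Delta>1 definition that comprehension
  requires.\<close>

lemma alternating_set:
  obtains G where "G \<in> S" "\<And>n. n \<in> N \<Longrightarrow> n \<in> G \<longleftrightarrow> alternating I n (\<lambda>r. r \<in> G)"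
proof -
  let ?P = "\<lambda>n z. \<exists>M\<in>N. M < z \<and> (\<exists>c\<in>N. c < z \<and> approximates I n M c \<and> slot M n dvd c)"
  let ?Q = "\<lambda>n z. \<forall>M\<in>N. M < z \<longrightarrow> (\<forall>c\<in>N. c < z \<longrightarrow> approximates I n M c \<longrightarrow> slot M n dvd c)"
  let ?G = "{n\<in>N. \<exists>z\<in>N. ?P n z}"
  have "?G \<in> S"
  proof (rule delta1_comprehension[where Q = ?Q])
    show "delta0 (\<lambda>e. ?P (e 0) (e 1))"
      unfolding approximates_def alternating_def last_in_def by (intro delta0_rules I)
    show "delta0 (\<lambda>e. ?Q (e 0) (e 1))"
      unfolding approximates_def alternating_def last_in_def by (intro delta0_rules I)
    fix n assume n: "n \<in> N"
    obtain z M c where z: "z \<in> N" "M \<in> N" "M < z" "c \<in> N" "c < z" "approximates I n M c"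
      using approximation_exists[OF n] by blast
    have uniq: "slot M n dvd c \<longleftrightarrow> slot M' n dvd c'" if "M' \<in> N" "c' \<in> N" "approximates I n M' c'" for M' c'
      using approximation_unique[OF n z(2,4,6) n that n] by (simp add: less_add_one_iff)
    show "(\<exists>z\<in>N. ?P n z) \<longleftrightarrow> (\<forall>z\<in>N. ?Q n z)"
    proof
      assume "\<exists>z\<in>N. ?P n z"
      then have "slot M n dvd c" using uniq by blast
      then show "\<forall>z\<in>N. ?Q n z" using uniq by blast
    next
      assume "\<forall>z\<in>N. ?Q n z"
      then have "slot M n dvd c" using z by blast
      then show "\<exists>z\<in>N. ?P n z" using z by blast
    qed
  qed
  have mem: "k \<in> ?G \<longleftrightarrow> slot M k dvd c"
    if n: "n \<in> N" "M \<in> N" "c \<in> N" "approximates I n M c" and k: "k \<in> N" "k \<le> n" for n M c k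
  proof -
    have uniq: "slot M k dvd c \<longleftrightarrow> slot M' k dvd c'" if "M' \<in> N" "c' \<in> N" "approximates I k M' c'" for M' c'
      using approximation_unique[OF n k(1) that k(1)] k(2) by (simp add: less_add_one_iff)
    obtain z M' c' where "z \<in> N" "M' \<in> N" "M' < z" "c' \<in> N" "c' < z" "approximates I k M' c'"
      using approximation_exists[OF k(1)] by blast
    then show ?thesis using uniq k(1) by blast
  qed
  have "n \<in> ?G \<longleftrightarrow> alternating I n (\<lambda>r. r \<in> ?G)" if n: "n \<in> N" for n
  proof -
    obtain M c where M: "M \<in> N" "c \<in> N" "approximates I n M c"
      using approximation_exists[OF n] by blast
    have "n \<in> ?G \<longleftrightarrow> slot M n dvd c" using mem[OF n M n] by simp
    also have "\<dots> \<longleftrightarrow> alternating I n (\<lambda>r. slot M r dvd c)"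
      using M(3) n unfolding approximates_def by (simp add: less_add_one_iff)
    also have "\<dots> \<longleftrightarrow> alternating I n (\<lambda>r. r \<in> ?G)"
      using mem[OF n M] by (intro alternating_cong) simp
    finally show ?thesis .
  qed
  with \<open>?G \<in> S\<close> show ?thesis by (rule that)
qed

end

section \<open>Powers of three\<close>

text \<open>Working with the powers themselves instead of their exponents avoids having to define
  exponentiation in the model.\<close>

definition pow3 :: "'a set" where
  "pow3 = {q\<in>N. 0 < q \<and> (\<forall>d\<in>N. d < q + 1 \<longrightarrow> d dvd q \<longrightarrow> d = 1 \<or> 3 dvd d)}"

lemma pow3_in_S: "pow3 \<in> S"
  unfolding pow3_def by (intro delta0_comprehension delta0_rules) auto

lemma pow3_N: "q \<in> pow3 \<Longrightarrow> q \<in> N" and pow3_pos: "q \<in> pow3 \<Longrightarrow> 0 < q"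
  by (auto simp: pow3_def)

lemma pow3_dvd: "q \<in> pow3 \<Longrightarrow> 0 \<le> d \<Longrightarrow> d dvd q \<Longrightarrow> d = 1 \<or> 3 dvd d"
  using dvd_le[of d q] by (auto simp: pow3_def less_add_one_iff)

lemma pow3I: "0 < q \<Longrightarrow> (\<And>d. 0 \<le> d \<Longrightarrow> d dvd q \<Longrightarrow> d = 1 \<or> 3 dvd d) \<Longrightarrow> q \<in> pow3"
  by (auto simp: pow3_def)

lemma dvd_bounded_zero: "q dvd d \<Longrightarrow> - q < d \<Longrightarrow> d < q \<Longrightarrow> d = 0" for q d :: 'a
proof (rule ccontr)
  assume *: "q dvd d" "- q < d" "d < q" "d \<noteq> 0"
  then have "q \<le> \<bar>d\<bar>" by (intro dvd_le) auto
  then show False using * by (auto simp: abs_if split: if_splits)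
qed

lemma not_3_dvd: "\<not> 3 dvd (1 :: 'a)" "\<not> 3 dvd (2 :: 'a)"
  using dvd_bounded_zero[of 3 1] dvd_bounded_zero[of 3 2] by auto

lemma mod_three:
  assumes "n \<in> N" obtains k where "k \<in> N" "n = 3 * k \<or> n = 3 * k + 1 \<or> n = 3 * k + 2"
proof -
  obtain k r where *: "k \<in> N" "r \<in> N" "r < 3" "n = 3 * k + r" using division[OF assms, of 3] by auto
  have "r = 0 \<or> r = 1 \<or> r = 2"
    using *(2,3) less_iff_add_one_le[of 0 r] less_iff_add_one_le[of 1 r] less_iff_add_one_le[of r 3] by auto
  then show ?thesis using * that[of k] by auto
qed

lemma three_prime:
  assumes "3 dvd a * b" "a \<in> N" "b \<in> N" shows "3 dvd a \<or> 3 dvd b"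
proof (rule ccontr)
  assume no: "\<not> ?thesis"
  obtain k where k: "a = 3 * k \<or> a = 3 * k + 1 \<or> a = 3 * k + 2" using mod_three assms by metis
  obtain l where l: "b = 3 * l \<or> b = 3 * l + 1 \<or> b = 3 * l + 2" using mod_three assms by metis
  consider "a * b = 3 * (3 * k * l + k + l) + 1" | "a * b = 3 * (3 * k * l + 2 * k + l) + 2"
    | "a * b = 3 * (3 * k * l + k + 2 * l) + 2" | "a * b = 3 * (3 * k * l + 2 * k + 2 * l + 1) + 1"
    using k l no by (auto simp: algebra_simps)
  then show False
    using assms(1) not_3_dvd by cases (simp_all only: dvd_add_right_iff[OF dvd_triv_left])
qed

lemma pow3_one: "1 \<in> pow3"
proof (rule pow3I)
  fix d :: 'a assume d: "0 \<le> d" "d dvd 1"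
  then have "d \<noteq> 0" by auto
  then have "1 \<le> d" using d(1) discrete[of d] by simp
  then show "d = 1 \<or> 3 dvd d" using dvd_le[OF d(2)] by simp
qed simp

lemma pow3_times: "q \<in> pow3 \<Longrightarrow> 3 * q \<in> pow3"
proof (rule pow3I)
  assume q: "q \<in> pow3"
  then show "0 < 3 * q" using pow3_pos by simp
  fix d :: 'a assume d: "0 \<le> d" "d dvd 3 * q"
  show "d = 1 \<or> 3 dvd d"
  proof (cases "3 dvd d")
    case False
    have "d \<in> N" "3 * q \<in> N" using d pow3_N[OF q] by auto
    then obtain k where k: "k \<in> N" "3 * q = d * k" using dvd_iff[of d "3 * q"] d(2) by blast
    then have "3 dvd d * k" by (metis dvd_triv_left)
    then have "3 dvd k" using three_prime d(1) k(1) False by auto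
    then obtain l where "k = 3 * l" by (elim dvdE)
    then have "3 * q = 3 * (d * l)" using k(2) by (simp add: algebra_simps)
    then have "q = d * l" by simp
    then show ?thesis using pow3_dvd[OF q d(1)] by simp
  qed simp
qed

text \<open>A power other than 1 is one of its own divisors, hence a multiple of 3. Division by 3
  thus gives a descent through the powers although no exponent is available.\<close>

lemma pow3_cases: assumes "q \<in> pow3" obtains "q = 1" | q' where "q' \<in> pow3" "q = 3 * q'"
proof (cases "q = 1")
  case False
  then have "3 dvd q" using pow3_dvd[OF assms, of q] pow3_pos[OF assms] by auto
  then obtain q' where q': "q = 3 * q'" by (elim dvdE)
  have "q' \<in> pow3"
  proof (rule pow3I)
    show "0 < q'" using q' pow3_pos[OF assms] by simp
    show "d = 1 \<or> 3 dvd d" if "0 \<le> d" "d dvd q'" for d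
      using pow3_dvd[OF assms that(1)] that(2) q' by simp
  qed
  then show ?thesis using q' that by blast
qed

text \<open>Both powers are divided by 3 until the smaller one is 1; this is an induction on a bound
  for the smaller one. The larger is kept at most \<open>q\<close> to make the induction formula
  \<Delta>0.\<close>

lemma pow3_linear:
  assumes "p \<in> pow3" "q \<in> pow3" "p \<le> q" shows "p dvd q"
proof -
  have "\<forall>x\<in>N. x < p + 1 \<longrightarrow> x \<in> pow3 \<longrightarrow> (\<forall>y\<in>N. y < q + 1 \<longrightarrow> y \<in> pow3 \<longrightarrow> x \<le> y \<longrightarrow> x dvd y)"
  proof (rule delta0_induct[where P = "\<lambda>n. \<forall>x\<in>N. x < n \<longrightarrow> x \<in> pow3 \<longrightarrow>
      (\<forall>y\<in>N. y < q + 1 \<longrightarrow> y \<in> pow3 \<longrightarrow> x \<le> y \<longrightarrow> x dvd y)"])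
    show "delta0 (\<lambda>e. \<forall>x\<in>N. x < e 0 \<longrightarrow> x \<in> pow3 \<longrightarrow>
        (\<forall>y\<in>N. y < q + 1 \<longrightarrow> y \<in> pow3 \<longrightarrow> x \<le> y \<longrightarrow> x dvd y))"
      by (intro delta0_rules pow3_in_S) (use pow3_N[OF assms(2)] in auto)
    fix n assume IH: "\<forall>x\<in>N. x < n \<longrightarrow> x \<in> pow3 \<longrightarrow>
        (\<forall>y\<in>N. y < q + 1 \<longrightarrow> y \<in> pow3 \<longrightarrow> x \<le> y \<longrightarrow> x dvd y)"
    show "\<forall>x\<in>N. x < n + 1 \<longrightarrow> x \<in> pow3 \<longrightarrow>
        (\<forall>y\<in>N. y < q + 1 \<longrightarrow> y \<in> pow3 \<longrightarrow> x \<le> y \<longrightarrow> x dvd y)"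
    proof (intro ballI impI)
      fix x y assume x: "x \<in> N" "x < n + 1" "x \<in> pow3" and y: "y \<in> N" "y < q + 1" "y \<in> pow3" "x \<le> y"
      show "x dvd y"
      proof (rule pow3_cases[OF x(3)])
        fix x' assume x': "x' \<in> pow3" "x = 3 * x'"
        have "1 \<le> x'" using discrete pow3_pos[OF x'(1)] by blast
        then have "y \<noteq> 1" using x'(2) y(4) by auto
        then obtain y' where y': "y' \<in> pow3" "y = 3 * y'" using pow3_cases[OF y(3)] by metis
        have "x' < n" "y' < q + 1" "x' \<le> y'"
          using x(2) y(2,4) x' y' \<open>1 \<le> x'\<close> pow3_pos[OF y'(1)] by (simp_all add: less_add_one_iff)
        then have "x' dvd y'" using IH x'(1) y'(1) pow3_N by blast
        then show ?thesis using x' y' by simp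
      qed simp
    qed
  qed (use pow3_N[OF assms(1)] in auto)
  then show ?thesis using assms pow3_N by (auto simp: less_add_one_iff)
qed

text \<open>The quotient of \<open>q\<close> by \<open>p\<close> is a divisor of \<open>q\<close>
  other than 1, hence a multiple of 3.\<close>

lemma pow3_less:
  assumes "p \<in> pow3" "q \<in> pow3" "p < q" shows "3 * p dvd q"
proof -
  obtain k where k: "q = p * k" using pow3_linear[OF assms(1,2)] assms(3) by (auto elim: dvdE)
  have "0 < k" using k pow3_pos[OF assms(1)] pow3_pos[OF assms(2)] by (auto simp: zero_less_mult_iff)
  then have "3 dvd k" using pow3_dvd[OF assms(2), of k] k assms(3) by auto
  then show ?thesis using k by (auto elim!: dvdE simp: algebra_simps)
qed

lemma pow3_unbounded: assumes "n \<in> N" obtains q where "q \<in> pow3" "n < q"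
proof -
  have "\<exists>q\<in>N. q \<in> pow3 \<and> n < q"
  proof (rule sigma1_induct[of "\<lambda>n q. q \<in> pow3 \<and> n < q"])
    show "delta0 (\<lambda>e. e 1 \<in> pow3 \<and> e 0 < e 1)" by (intro delta0_rules pow3_in_S)
    show "\<exists>q\<in>N. q \<in> pow3 \<and> 0 < q" using pow3_one by (intro bexI[of _ 1]) auto
    show "\<exists>q\<in>N. q \<in> pow3 \<and> x + 1 < q" if IH: "\<exists>q\<in>N. q \<in> pow3 \<and> x < q" for x
    proof -
      obtain q where q: "q \<in> pow3" "x < q" using IH by blast
      have "1 \<le> q" using discrete pow3_pos[OF q(1)] by blast
      then have "x + 1 < 3 * q" using q(2) by simp
      then show ?thesis using pow3_times[OF q(1)] pow3_N by blast
    qed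
  qed (fact assms)
  then show ?thesis using that by blast
qed

text \<open>The numbers whose last nonzero digit in base 3 is 1.\<close>

definition digit1 :: "'a set" where
  "digit1 = {n\<in>N. \<exists>p\<in>N. p < n + 1 \<and> p \<in> pow3 \<and> (\<exists>k\<in>N. k < n + 1 \<and> n = p * (3 * k + 1))}"

lemma digit1_in_S: "digit1 \<in> S"
  unfolding digit1_def by (intro delta0_comprehension delta0_rules pow3_in_S) auto

lemma digit1I:
  assumes "p \<in> pow3" "k \<in> N" shows "p * (3 * k + 1) \<in> digit1"
proof -
  have p: "1 \<le> p" using discrete pow3_pos[OF assms(1)] by blast
  have "p * 1 \<le> p * (3 * k + 1)" using p assms(2) by (intro mult_left_mono) auto
  moreover have "k \<le> p * (3 * k + 1)"
  proof -
    have "k \<le> 1 * (3 * k + 1)" using assms(2) by simp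
    also have "\<dots> \<le> p * (3 * k + 1)" using p assms(2) by (intro mult_right_mono) auto
    finally show ?thesis .
  qed
  ultimately have "p < p * (3 * k + 1) + 1" "k < p * (3 * k + 1) + 1" by (simp_all add: less_add_one_iff)
  moreover have "p * (3 * k + 1) \<in> N" using p assms(2) by simp
  ultimately show ?thesis using assms pow3_N unfolding digit1_def by blast
qed

text \<open>In two expansions with different powers, three times the smaller power divides the
  number; cancelling that power makes 3 divide something congruent to 1 or 2. With equal powers the
  residues 1 and 2 clash directly.\<close>

lemma digit2_notin:
  assumes "p \<in> pow3" shows "p * (3 * k + 2) \<notin> digit1"
proof
  assume "p * (3 * k + 2) \<in> digit1"
  then obtain q l where q: "q \<in> pow3" and eq: "p * (3 * k + 2) = q * (3 * l + 1)"
    unfolding digit1_def by blast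
  have pos: "p \<noteq> 0" "q \<noteq> 0" using pow3_pos[OF assms] pow3_pos[OF q] by auto
  consider "p = q" | "p < q" | "q < p" by fastforce
  then show False
  proof cases
    case 1
    then have "3 * k + 2 = 3 * l + 1" using eq pos by simp
    then have "3 * (l - k) = 1" by (simp add: algebra_simps)
    then show False using not_3_dvd(1) by (metis dvd_triv_left)
  next
    case 2
    then have "p * 3 dvd p * (3 * k + 2)" using pow3_less[OF assms q] eq by (simp add: mult.commute)
    then have "3 dvd 3 * k + 2" using pos by (simp only: dvd_mult_cancel_left) simp
    then show False using not_3_dvd(2) by (simp only: dvd_add_right_iff[OF dvd_triv_left])
  next
    case 3
    then have "q * 3 dvd q * (3 * l + 1)" using pow3_less[OF q assms] eq by (metis dvd_mult2 mult.commute)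
    then have "3 dvd 3 * l + 1" using pos by (simp only: dvd_mult_cancel_left) simp
    then show False using not_3_dvd(1) by (simp only: dvd_add_right_iff[OF dvd_triv_left])
  qed
qed

lemma last_nonzero_digit:
  assumes "x \<in> N" "0 < x"
  obtains p k where "p \<in> pow3" "p \<le> x" "k \<in> N" "x = p * (3 * k + 1) \<or> x = p * (3 * k + 2)"
proof -
  have "\<forall>y\<in>N. y < x + 1 \<longrightarrow> 0 < y \<longrightarrow> (\<exists>p\<in>N. p < y + 1 \<and> p \<in> pow3 \<and>
      (\<exists>k\<in>N. k < y + 1 \<and> (y = p * (3 * k + 1) \<or> y = p * (3 * k + 2))))"
  proof (rule delta0_induct[where P = "\<lambda>n. \<forall>y\<in>N. y < n \<longrightarrow> 0 < y \<longrightarrow> (\<exists>p\<in>N. p < y + 1 \<and> p \<in> pow3 \<and>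
      (\<exists>k\<in>N. k < y + 1 \<and> (y = p * (3 * k + 1) \<or> y = p * (3 * k + 2))))"])
    show "delta0 (\<lambda>e. \<forall>y\<in>N. y < e 0 \<longrightarrow> 0 < y \<longrightarrow> (\<exists>p\<in>N. p < y + 1 \<and> p \<in> pow3 \<and>
        (\<exists>k\<in>N. k < y + 1 \<and> (y = p * (3 * k + 1) \<or> y = p * (3 * k + 2)))))"
      by (intro delta0_rules pow3_in_S) auto
    fix n assume IH: "\<forall>y\<in>N. y < n \<longrightarrow> 0 < y \<longrightarrow> (\<exists>p\<in>N. p < y + 1 \<and> p \<in> pow3 \<and>
        (\<exists>k\<in>N. k < y + 1 \<and> (y = p * (3 * k + 1) \<or> y = p * (3 * k + 2))))"
    show "\<forall>y\<in>N. y < n + 1 \<longrightarrow> 0 < y \<longrightarrow> (\<exists>p\<in>N. p < y + 1 \<and> p \<in> pow3 \<and>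
        (\<exists>k\<in>N. k < y + 1 \<and> (y = p * (3 * k + 1) \<or> y = p * (3 * k + 2))))"
    proof (intro ballI impI)
      fix y assume y: "y \<in> N" "y < n + 1" "0 < y"
      obtain k where k: "k \<in> N" "y = 3 * k \<or> y = 3 * k + 1 \<or> y = 3 * k + 2" using mod_three[OF y(1)] by blast
      show "\<exists>p\<in>N. p < y + 1 \<and> p \<in> pow3 \<and> (\<exists>k\<in>N. k < y + 1 \<and> (y = p * (3 * k + 1) \<or> y = p * (3 * k + 2)))"
      proof (cases "y = 3 * k")
        case True
        then have "0 < k" "k < n" using y by (auto simp: less_add_one_iff)
        then obtain p l where *: "p \<in> N" "p < k + 1" "p \<in> pow3" "l \<in> N" "l < k + 1"
          "k = p * (3 * l + 1) \<or> k = p * (3 * l + 2)" using IH k(1) by blast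
        have "p \<le> k" "l \<le> k" using *(2,5) by (simp_all add: less_add_one_iff)
        then have "3 * p < y + 1" "l < y + 1" using True \<open>0 < k\<close> by (simp_all add: less_add_one_iff)
        moreover have "y = 3 * p * (3 * l + 1) \<or> y = 3 * p * (3 * l + 2)" using *(6) True by (auto simp: algebra_simps)
        ultimately show ?thesis using pow3_times[OF *(3)] pow3_N *(4) by blast
      next
        case False
        then have "y = 1 * (3 * k + 1) \<or> y = 1 * (3 * k + 2)" using k(2) by simp
        moreover have "k < y + 1" "1 < y + 1" using k False y(3) by (auto simp: less_add_one_iff)
        ultimately show ?thesis using k(1) pow3_one pow3_N by blast
      qed
    qed
  qed (use assms in auto)
  then obtain p k where "p \<in> pow3" "p < x + 1" "k \<in> N" "x = p * (3 * k + 1) \<or> x = p * (3 * k + 2)"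
    using assms by (auto simp: less_add_one_iff)
  then show ?thesis using that[of p k] by (simp add: less_add_one_iff)
qed

section \<open>Homogeneous sets\<close>

text \<open>The common shape in which binary relations become sets of codes below; the bounds on the
  components keep the definitions \<Delta>0.\<close>

lemma pr_mem_iff:
  assumes "x \<in> N" "y \<in> N"
  shows "pr x y \<in> {z\<in>N. \<exists>a\<in>N. a < z + 1 \<and> (\<exists>b\<in>N. b < z + 1 \<and> z = pr a b \<and> P a b)} \<longleftrightarrow> P x y"
proof
  assume "pr x y \<in> {z\<in>N. \<exists>a\<in>N. a < z + 1 \<and> (\<exists>b\<in>N. b < z + 1 \<and> z = pr a b \<and> P a b)}"
  then obtain a b where "a \<in> N" "b \<in> N" "pr x y = pr a b" "P a b" by blast
  then show "P x y" using pr_inject[OF assms] by blast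
next
  assume "P x y"
  then show "pr x y \<in> {z\<in>N. \<exists>a\<in>N. a < z + 1 \<and> (\<exists>b\<in>N. b < z + 1 \<and> z = pr a b \<and> P a b)}"
    using assms pr_in[OF assms] pr_less1[OF assms] pr_less2[OF assms] by blast
qed

text \<open>Two distinct members of \<open>H\<close> with the same nonzero residue modulo
  \<open>Q\<close> would end in the same digit at the same place, so their sum would end in the
  other digit. Some residue is shared by two members, hence it is 0.\<close>

lemma homogeneous_divisible:
  assumes H: "H \<in> S" "\<And>n. n \<in> N \<Longrightarrow> \<exists>x\<in>H. n < x"
    and hom: "\<And>x. x \<in> H \<Longrightarrow> x \<in> digit1 \<longleftrightarrow> b"
      "\<And>x y. x \<in> H \<Longrightarrow> y \<in> H \<Longrightarrow> x \<noteq> y \<Longrightarrow> x + y \<in> digit1 \<longleftrightarrow> b"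
    and Q: "Q \<in> pow3"
  obtains y where "y \<in> H" "Q dvd y"
proof -
  have QN: "Q \<in> N" "0 < Q" using pow3_N pow3_pos Q by auto
  have HN: "x \<in> N" if "x \<in> H" for x using S_subset[OF H(1)] that by blast
  define T where "T = {z\<in>N. \<exists>i\<in>N. i < z + 1 \<and> (\<exists>x\<in>N. x < z + 1 \<and> z = pr i x \<and> x \<in> H \<and>
      (\<exists>k\<in>N. k < x + 1 \<and> x = Q * k + i))}"
  have T: "T \<in> S" unfolding T_def by (intro delta0_comprehension delta0_rules H(1) QN(1))
  \<comment> \<open>This is the pigeonhole principle: every residue that occurs in \<open>H\<close>
    already occurs below \<open>c\<close>, so a member \<open>y\<close> above \<open>c\<close>
    shares its residue with a smaller member.\<close>
  obtain c where c: "c \<in> N"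
    "\<And>i t. i \<in> N \<Longrightarrow> i < Q \<Longrightarrow> t \<in> N \<Longrightarrow> pr i t \<in> T \<Longrightarrow> \<exists>t\<in>N. t < c \<and> pr i t \<in> T"
    by (rule strong_bounding[OF T QN(1)]) blast
  have T_iff: "pr i x \<in> T \<longleftrightarrow> x \<in> H \<and> (\<exists>k\<in>N. k < x + 1 \<and> x = Q * k + i)" if "i \<in> N" "x \<in> N" for i x
    unfolding T_def by (rule pr_mem_iff[OF that])
  obtain y where y: "y \<in> H" "c < y" using H(2)[OF c(1)] by blast
  obtain k i where k: "k \<in> N" "i \<in> N" "i < Q" "y = Q * k + i" using division[OF HN[OF y(1)] QN(2)] by blast
  have "k \<le> Q * k" using k(1) discrete[OF QN(2)] mult_right_mono[of 1 Q k] by simp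
  then have "k < y + 1" using k(2,4) by (simp add: less_add_one_iff)
  then have "pr i y \<in> T" using T_iff[OF k(2) HN[OF y(1)]] y(1) k by blast
  then obtain x where x: "x \<in> N" "x < c" "pr i x \<in> T" using c(2)[OF k(2,3) HN[OF y(1)]] by blast
  then obtain l where l: "x \<in> H" "l \<in> N" "x = Q * l + i" using T_iff[OF k(2) x(1)] by blast
  have "x \<noteq> y" using x(2) y(2) by simp
  show ?thesis
  proof (cases "i = 0")
    case True
    then show ?thesis using that[OF y(1)] k(4) by simp
  next
    case False
    then have "0 < i" using k(2) by simp
    then obtain p u where p: "p \<in> pow3" "p \<le> i" "u \<in> N" "i = p * (3 * u + 1) \<or> i = p * (3 * u + 2)"
      using last_nonzero_digit[OF k(2)] by blast
    \<comment> \<open>The last nonzero digit of the residue \<open>i\<close> sits at a place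
      \<open>p\<close> below \<open>Q\<close>. Multiples of \<open>Q\<close> are then multiples of
      \<open>3 * p\<close> and do not affect this digit.\<close>
    have "p < Q" using p(2) k(3) by simp
    then have "3 * p dvd Q" by (rule pow3_less[OF p(1) Q])
    then obtain w where w: "Q = 3 * p * w" by (elim dvdE)
    have "0 \<le> w" using w QN(2) pow3_pos[OF p(1)] by (auto simp: zero_less_mult_iff)
    from p(4) show ?thesis
    proof
      assume i: "i = p * (3 * u + 1)"
      have eq: "x = p * (3 * (w * l + u) + 1)" "x + y = p * (3 * (w * l + w * k + 2 * u) + 2)"
        using l(3) k(4) i w by (simp_all add: algebra_simps)
      have "x \<in> digit1" unfolding eq(1) using \<open>0 \<le> w\<close> l(2) p(3) by (intro digit1I[OF p(1)]) simp
      moreover have "x + y \<notin> digit1" unfolding eq(2) by (rule digit2_notin[OF p(1)])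
      ultimately show ?thesis using hom l(1) y(1) \<open>x \<noteq> y\<close> by blast
    next
      assume i: "i = p * (3 * u + 2)"
      \<comment> \<open>Here the digits add up to 4, so a digit 1 remains and the carry accounts for
        the extra 1 in the quotient.\<close>
      have eq: "x = p * (3 * (w * l + u) + 2)" "x + y = p * (3 * (w * l + w * k + 2 * u + 1) + 1)"
        using l(3) k(4) i w by (simp_all add: algebra_simps)
      have "x \<notin> digit1" unfolding eq(1) by (rule digit2_notin[OF p(1)])
      moreover have "x + y \<in> digit1"
        unfolding eq(2) using \<open>0 \<le> w\<close> l(2) k(1) p(3) by (intro digit1I[OF p(1)]) simp
      ultimately show ?thesis using hom l(1) y(1) \<open>x \<noteq> y\<close> by blast
    qed
  qed
qed

text \<open>The base 3 expansion of \<open>n\<close> is that of \<open>r\<close>, followed by zeros up to some power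
  \<open>q\<close> of 3; and some \<open>m\<close> below a power of 3 dividing \<open>r\<close> is enumerated by \<open>T\<close> between the
  stages \<open>r\<close> and \<open>q\<close>, but not earlier.\<close>

definition gap :: "'a set \<Rightarrow> 'a \<Rightarrow> 'a \<Rightarrow> bool" where
  "gap T n r \<longleftrightarrow> 0 < r \<and>
    (\<exists>p\<in>N. p < r + 1 \<and> p \<in> pow3 \<and> p dvd r \<and>
      (\<exists>q\<in>N. q < n + 1 \<and> q \<in> pow3 \<and> r < q \<and> (\<exists>k\<in>N. k < n + 1 \<and> n = r + q * k) \<and>
        (\<exists>m\<in>N. m < p \<and> (\<exists>t\<in>N. t < q \<and> pr m t \<in> T) \<and> \<not> (\<exists>t\<in>N. t < r \<and> pr m t \<in> T))))"

definition gaps :: "'a set \<Rightarrow> 'a set" where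
  "gaps T = {z\<in>N. \<exists>n\<in>N. n < z + 1 \<and> (\<exists>r\<in>N. r < z + 1 \<and> z = pr n r \<and> gap T n r)}"

lemma gaps_in_S: "T \<in> S \<Longrightarrow> gaps T \<in> S"
  unfolding gaps_def gap_def by (intro delta0_comprehension delta0_rules pow3_in_S)

lemma gaps_iff: "n \<in> N \<Longrightarrow> r \<in> N \<Longrightarrow> pr n r \<in> gaps T \<longleftrightarrow> gap T n r"
  unfolding gaps_def by (rule pr_mem_iff)

text \<open>Above \<open>x\<close> the expansion of \<open>x + y\<close> has zeros up to
  \<open>Q\<close>, and the appearance of \<open>m\<close> before stage \<open>c\<close> makes this
  stretch a gap. Any further gap would start beyond \<open>c\<close> and concern only numbers below
  \<open>x\<close>, for which nothing new can happen after \<open>c\<close>.\<close>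

lemma last_gap:
  assumes x: "x \<in> N" "0 < x" and p: "p \<in> pow3" "p dvd x" and m: "m \<in> N" "m < p" "t \<in> N" "pr m t \<in> T"
    and late: "\<not> (\<exists>t\<in>N. t < x \<and> pr m t \<in> T)"
    and c: "c \<in> N"
      "\<And>i t. i \<in> N \<Longrightarrow> i < x \<Longrightarrow> t \<in> N \<Longrightarrow> pr i t \<in> T \<Longrightarrow> \<exists>t\<in>N. t < c \<and> pr i t \<in> T"
    and Q: "Q \<in> pow3" "x + c < Q" and y: "y \<in> N" "0 < y" "Q dvd y"
  shows "last_in (gaps T) (x + y) x"
  unfolding last_in_def
proof (intro conjI ballI impI)
  have n: "x + y \<in> N" using x y by simp
  have px: "p \<le> x" using dvd_le[OF p(2) x(2)] .
  have Qy: "Q \<le> y" using dvd_le[OF y(3,2)] .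
  obtain k where k: "k \<in> N" "k < y + 1" "y = Q * k" using dvd_iff[OF pow3_N[OF Q(1)] y(1)] y(3) by blast
  obtain t' where t': "t' \<in> N" "t' < c" "pr m t' \<in> T" using c(2)[OF m(1) _ m(3,4)] m(2) px by auto
  have "\<exists>k\<in>N. k < x + y + 1 \<and> x + y = x + Q * k"
    using k x by (intro bexI[of _ k]) (auto simp: less_add_one_iff)
  moreover have "\<exists>t\<in>N. t < Q \<and> pr m t \<in> T" using t' Q(2) x by (intro bexI[of _ t']) auto
  moreover have "p < x + 1" "Q < x + y + 1" "x < Q" "p \<in> N" "Q \<in> N"
    using px Qy x Q c(1) p pow3_N by (auto simp: less_add_one_iff)
  ultimately have "gap T (x + y) x"
    unfolding gap_def using x(2) p Q(1) m(1,2) late by blast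
  then show "pr (x + y) x \<in> gaps T" using gaps_iff n x by blast
  fix r assume r: "r \<in> N" "r < x + y" "x < r"
  show "pr (x + y) r \<notin> gaps T"
  proof
    assume "pr (x + y) r \<in> gaps T"
    then have "gap T (x + y) r" using gaps_iff n r by blast
    then obtain p' q k' m' where *: "p' \<in> pow3" "p' dvd r" "q \<in> pow3" "r < q" "x + y = r + q * k'"
      "m' \<in> N" "m' < p'" "\<exists>t\<in>N. t < q \<and> pr m' t \<in> T" "\<not> (\<exists>t\<in>N. t < r \<and> pr m' t \<in> T)"
      unfolding gap_def by blast
    \<comment> \<open>A power \<open>q\<close> at most \<open>Q\<close> divides \<open>y\<close>,
      hence also \<open>r - x\<close>, which lies strictly between 0 and \<open>q\<close>.\<close>
    have "Q < q"
    proof (rule ccontr)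
      assume "\<not> Q < q"
      then have "q dvd y" using pow3_linear[OF *(3) Q(1)] y(3) by (auto intro: dvd_trans)
      then have "q dvd y - q * k'" by simp
      also have "y - q * k' = r - x" using *(5) by (simp add: algebra_simps)
      finally have "r - x = 0" using r(3) *(4) x(2) by (intro dvd_bounded_zero[of q]) auto
      then show False using r(3) by simp
    qed
    then have "Q dvd q" using pow3_linear[OF Q(1) *(3)] by simp
    then have "Q dvd y - q * k'" using y(3) by simp
    also have "y - q * k' = r - x" using *(5) by (simp add: algebra_simps)
    finally have Qr: "Q dvd r - x" .
    then have "Q \<le> r - x" using r(3) by (intro dvd_le) auto
    then have "c < r" using Q(2) x by auto
    \<comment> \<open>The powers \<open>p'\<close> and \<open>Q\<close> are comparable by
      divisibility. If \<open>p'\<close> divides \<open>Q\<close>, it divides \<open>r - x\<close>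
      and \<open>r\<close>, hence \<open>x\<close>; otherwise \<open>Q\<close> divides
      \<open>r\<close> and \<open>r - x\<close>, hence \<open>x\<close>, although
      \<open>x < Q\<close>.\<close>
    have "p' \<le> x"
    proof (cases "p' \<le> Q")
      case True
      then have "p' dvd Q" using pow3_linear[OF *(1) Q(1)] by simp
      then have "p' dvd r - x" using Qr by (rule dvd_trans)
      then have "p' dvd r - (r - x)" by (rule dvd_diff[OF *(2)])
      then show ?thesis using x(2) by (intro dvd_le) auto
    next
      case False
      then have "Q dvd p'" using pow3_linear[OF Q(1) *(1)] by simp
      then have "Q dvd r" using *(2) by (rule dvd_trans)
      then have "Q dvd r - (r - x)" using Qr by (rule dvd_diff)
      then have "Q \<le> x" using x(2) by (intro dvd_le) auto
      then show ?thesis using Q(2) c(1) by auto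
    qed
    then have "m' < x" using *(7) by simp
    then show False using c(2)[OF *(6)] *(8,9) \<open>c < r\<close> by (meson less_trans)
  qed
qed

end

section \<open>Hindman's theorem inside the model\<close>

locale ht_rca = discrete_rca +
  assumes HT: "sat {0..} S e v (HT_le2 4)"
begin

lemma homogeneous_exists:
  assumes F: "F \<in> S"
    and "\<And>z. z \<in> F \<Longrightarrow> \<exists>x\<in>N. \<exists>y\<in>N. 0 < x \<and> y < 4 \<and> z = pr x y"
    and "\<And>x. x \<in> N \<Longrightarrow> 0 < x \<Longrightarrow> \<exists>y\<in>N. pr x y \<in> F"
    and "\<And>x y z. x \<in> N \<Longrightarrow> y \<in> N \<Longrightarrow> z \<in> N \<Longrightarrow> pr x y \<in> F \<Longrightarrow> pr x z \<in> F \<Longrightarrow> y = z"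
  obtains H c where "H \<in> S" "\<And>x. x \<in> H \<Longrightarrow> 0 < x" "\<And>n. n \<in> N \<Longrightarrow> \<exists>x\<in>H. n < x" "c \<in> N"
    "\<And>x. x \<in> H \<Longrightarrow> pr x c \<in> F" "\<And>x y. x \<in> H \<Longrightarrow> y \<in> H \<Longrightarrow> x \<noteq> y \<Longrightarrow> pr (x + y) c \<in> F"
proof -
  let ?v = "case_nat F (\<lambda>_. {})"
  have num4: "eval e (num 4) = 4" for e :: "nat \<Rightarrow> 'a" by (simp add: numeral_eq_Suc)
  have pair: "eval e (pair s t) = pr (eval e s) (eval e t)" for e :: "nat \<Rightarrow> 'a" and s t
    by (simp add: pair_def pr_def)
  have "\<forall>z\<in>N. z \<in> F \<longrightarrow> (\<exists>x\<in>N. \<exists>y\<in>N. y < 4 \<and> x \<noteq> 0 \<and> z = pr x y)"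
    using assms(2) by (metis less_irrefl)
  moreover have "\<forall>x\<in>N. x = 0 \<or> (\<exists>y\<in>N. pr x y \<in> F)" using assms(3) by fastforce
  moreover have "\<forall>x\<in>N. \<forall>y\<in>N. pr x y \<in> F \<longrightarrow> (\<forall>z\<in>N. pr x z \<in> F \<longrightarrow> y = z)" using assms(4) by blast
  ultimately have "sat {0..} S (\<lambda>_. 0) ?v (colouring 4 0)"
    by (simp add: colouring_def num4 pair del: num.simps)
  then have "sat {0..} S (\<lambda>_. 0) ?v (ExS (infinite_positive 0 \<^bold>\<and> sums_homogeneous 1 0))"
    using HT[of "\<lambda>_. 0" "\<lambda>_. {}"] F unfolding HT_le2_def by simp
  then obtain H where H: "H \<in> S" "sat {0..} S (\<lambda>_. 0) (case_nat H ?v) (infinite_positive 0)"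
    "sat {0..} S (\<lambda>_. 0) (case_nat H ?v) (sums_homogeneous 1 0)" by auto
  have sub: "x \<in> N" if "x \<in> H" for x using S_subset[OF H(1)] that by blast
  have "0 < x" if "x \<in> H" for x using H(2) sub[OF that] that by (auto simp: infinite_positive_def)
  moreover have "\<exists>x\<in>H. n < x" if "n \<in> N" for n
    using H(2) that by (auto simp: infinite_positive_def)
  moreover obtain c where "c \<in> N" "\<And>x. x \<in> N \<Longrightarrow> x \<in> H \<Longrightarrow> pr x c \<in> F"
    "\<And>x y. x \<in> N \<Longrightarrow> y \<in> N \<Longrightarrow> x \<in> H \<Longrightarrow> y \<in> H \<Longrightarrow> x \<noteq> y \<Longrightarrow> pr (x + y) c \<in> F"
    using H(3) by (auto simp: sums_homogeneous_def pair)
  ultimately show ?thesis using that[of H c] H(1) sub by blast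
qed

text \<open>The four colours are the four combinations of two membership bits, so a single
  homogeneous set serves both sets at once.\<close>

lemma homogeneous_for_two_sets:
  assumes A: "A \<in> S" and B: "B \<in> S"
  obtains H a b where "H \<in> S" "\<And>x. x \<in> H \<Longrightarrow> 0 < x" "\<And>n. n \<in> N \<Longrightarrow> \<exists>x\<in>H. n < x"
    "\<And>x. x \<in> H \<Longrightarrow> x \<in> A \<longleftrightarrow> a" "\<And>x y. x \<in> H \<Longrightarrow> y \<in> H \<Longrightarrow> x \<noteq> y \<Longrightarrow> x + y \<in> A \<longleftrightarrow> a"
    "\<And>x. x \<in> H \<Longrightarrow> x \<in> B \<longleftrightarrow> b" "\<And>x y. x \<in> H \<Longrightarrow> y \<in> H \<Longrightarrow> x \<noteq> y \<Longrightarrow> x + y \<in> B \<longleftrightarrow> b"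
proof -
  define col where "col x y \<longleftrightarrow> y = 0 \<and> x \<in> A \<and> x \<in> B \<or> y = 1 \<and> x \<in> A \<and> x \<notin> B \<or>
      y = 2 \<and> x \<notin> A \<and> x \<in> B \<or> y = 3 \<and> x \<notin> A \<and> x \<notin> B" for x y :: 'a
  define F where "F = {z\<in>N. \<exists>x\<in>N. x < z + 1 \<and> (\<exists>y\<in>N. y < z + 1 \<and> z = pr x y \<and> 0 < x \<and> col x y)}"
  have F: "F \<in> S"
    unfolding F_def col_def by (intro delta0_comprehension delta0_rules A B) auto
  have F_iff: "pr x y \<in> F \<longleftrightarrow> 0 < x \<and> col x y" if "x \<in> N" "y \<in> N" for x y
    unfolding F_def by (rule pr_mem_iff[OF that])
  obtain H c where H: "H \<in> S" "\<And>x. x \<in> H \<Longrightarrow> 0 < x" "\<And>n. n \<in> N \<Longrightarrow> \<exists>x\<in>H. n < x" and c: "c \<in> N"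
    "\<And>x. x \<in> H \<Longrightarrow> pr x c \<in> F" "\<And>x y. x \<in> H \<Longrightarrow> y \<in> H \<Longrightarrow> x \<noteq> y \<Longrightarrow> pr (x + y) c \<in> F"
  proof (rule homogeneous_exists[OF F])
    show "\<exists>x\<in>N. \<exists>y\<in>N. 0 < x \<and> y < 4 \<and> z = pr x y" if "z \<in> F" for z
    proof -
      from that obtain x y where xy: "x \<in> N" "y \<in> N" "z = pr x y" "0 < x" "col x y" unfolding F_def by blast
      then have "y < 4" by (auto simp: col_def)
      then show ?thesis using xy by blast
    qed
    show "\<exists>y\<in>N. pr x y \<in> F" if "x \<in> N" "0 < x" for x
    proof -
      have "\<exists>y\<in>N. col x y"
        by (cases "x \<in> A"; cases "x \<in> B")
          (force simp: col_def intro: bexI[of _ 0] bexI[of _ 1] bexI[of _ 2] bexI[of _ 3])+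
      then show ?thesis using F_iff that by blast
    qed
    show "y = z" if "x \<in> N" "y \<in> N" "z \<in> N" "pr x y \<in> F" "pr x z \<in> F" for x y z
      using that F_iff[of x y] F_iff[of x z] by (auto simp: col_def)
  qed blast
  have sub: "x \<in> N" if "x \<in> H" for x using S_subset[OF H(1)] that by blast
  have col: "x \<in> A \<longleftrightarrow> c = 0 \<or> c = 1" "x \<in> B \<longleftrightarrow> c = 0 \<or> c = 2" if "col x c" for x
    using that by (auto simp: col_def)
  have "col x c" if "x \<in> H" for x using c(2)[OF that] F_iff[OF sub[OF that] c(1)] by blast
  moreover have "col (x + y) c" if "x \<in> H" "y \<in> H" "x \<noteq> y" for x y
    using c(3)[OF that] F_iff[of "x + y" c] sub that c(1) by auto
  ultimately show ?thesis
    using that[OF H, of "c = 0 \<or> c = 1" "c = 0 \<or> c = 2"] col by blast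
qed

lemma projection:
  assumes T: "T \<in> S" shows "{m\<in>N. \<exists>t\<in>N. pr m t \<in> T} \<in> S"
proof -
  obtain G where G: "G \<in> S" "\<And>n. n \<in> N \<Longrightarrow> n \<in> G \<longleftrightarrow> alternating (gaps T) n (\<lambda>r. r \<in> G)"
    using alternating_set[OF gaps_in_S[OF T]] by blast
  obtain H a b where H: "H \<in> S" "\<And>x. x \<in> H \<Longrightarrow> 0 < x" "\<And>n. n \<in> N \<Longrightarrow> \<exists>x\<in>H. n < x"
    and a: "\<And>x. x \<in> H \<Longrightarrow> x \<in> digit1 \<longleftrightarrow> a"
      "\<And>x y. x \<in> H \<Longrightarrow> y \<in> H \<Longrightarrow> x \<noteq> y \<Longrightarrow> x + y \<in> digit1 \<longleftrightarrow> a"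
    and b: "\<And>x. x \<in> H \<Longrightarrow> x \<in> G \<longleftrightarrow> b"
      "\<And>x y. x \<in> H \<Longrightarrow> y \<in> H \<Longrightarrow> x \<noteq> y \<Longrightarrow> x + y \<in> G \<longleftrightarrow> b"
    using homogeneous_for_two_sets[OF digit1_in_S G(1)] by blast
  have HN: "x \<in> N" if "x \<in> H" for x using S_subset[OF H(1)] that by blast
  have div: "\<exists>y\<in>H. Q dvd y" if "Q \<in> pow3" for Q
    using homogeneous_divisible[OF H(1,3) a that] by blast
  have early: "\<exists>t\<in>N. t < x \<and> pr m t \<in> T"
    if x: "x \<in> H" and p: "p \<in> pow3" "p dvd x" and m: "m \<in> N" "m < p" "t \<in> N" "pr m t \<in> T" for x p m t
  proof (rule ccontr)
    assume late: "\<not> ?thesis"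
    obtain c where c: "c \<in> N"
      "\<And>i t. i \<in> N \<Longrightarrow> i < x \<Longrightarrow> t \<in> N \<Longrightarrow> pr i t \<in> T \<Longrightarrow> \<exists>t\<in>N. t < c \<and> pr i t \<in> T"
      using strong_bounding[OF T HN[OF x]] by blast
    obtain Q where Q: "Q \<in> pow3" "x + c < Q" using pow3_unbounded[of "x + c"] HN[OF x] c(1) by auto
    obtain y where y: "y \<in> H" "Q dvd y" using div[OF Q(1)] by blast
    have "Q \<le> y" using dvd_le[OF y(2) H(2)[OF y(1)]] .
    then have "x \<noteq> y" using Q(2) c(1) by auto
    have last: "last_in (gaps T) (x + y) x"
      using last_gap[OF HN[OF x] H(2)[OF x] p m late c Q HN[OF y(1)] H(2)[OF y(1)] y(2)] .
    have "r = x" if "r \<in> N" "r < x + y" "last_in (gaps T) (x + y) r" for r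
      using that last HN[OF x] H(2)[OF y(1)] unfolding last_in_def
      by (metis less_add_same_cancel1 linorder_neqE)
    \<comment> \<open>The chain of \<open>x + y\<close> takes one step to \<open>x\<close> and then
      follows the chain of \<open>x\<close>, so the two parities differ.\<close>
    then have "alternating (gaps T) (x + y) (\<lambda>r. r \<in> G) \<longleftrightarrow> x \<notin> G"
      unfolding alternating_def using last HN[OF x] H(2)[OF y(1)] by (metis less_add_same_cancel1)
    then have "x + y \<in> G \<longleftrightarrow> x \<notin> G" using G(2)[of "x + y"] HN[OF x] HN[OF y(1)] by simp
    then show False using b x y(1) \<open>x \<noteq> y\<close> by blast
  qed
  show ?thesis
  proof (rule delta1_comprehension[where Q = "\<lambda>m x. x \<in> H \<longrightarrow> (\<exists>p\<in>N. p < x + 1 \<and> p \<in> pow3 \<and> p dvd x \<and> m < p) \<longrightarrow>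
      (\<exists>t\<in>N. t < x \<and> pr m t \<in> T)"])
    show "delta0 (\<lambda>e. pr (e 0) (e 1) \<in> T)" by (intro delta0_rules T)
    show "delta0 (\<lambda>e. e 1 \<in> H \<longrightarrow> (\<exists>p\<in>N. p < e 1 + 1 \<and> p \<in> pow3 \<and> p dvd e 1 \<and> e 0 < p) \<longrightarrow>
        (\<exists>t\<in>N. t < e 1 \<and> pr (e 0) t \<in> T))" by (intro delta0_rules T H pow3_in_S)
    fix m assume m: "m \<in> N"
    show "(\<exists>t\<in>N. pr m t \<in> T) \<longleftrightarrow> (\<forall>x\<in>N. x \<in> H \<longrightarrow> (\<exists>p\<in>N. p < x + 1 \<and> p \<in> pow3 \<and> p dvd x \<and> m < p) \<longrightarrow>
        (\<exists>t\<in>N. t < x \<and> pr m t \<in> T))" (is "?L \<longleftrightarrow> ?R")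
    proof
      assume ?L
      then show ?R using early m by blast
    next
      assume R: ?R
      \<comment> \<open>A multiple in \<open>H\<close> of a power of 3 above \<open>m\<close>
        supplies an instance of the universal condition, which therefore cannot hold
        vacuously.\<close>
      obtain p where p: "p \<in> pow3" "m < p" using pow3_unbounded[OF m] by blast
      obtain x where x: "x \<in> H" "p dvd x" using div[OF p(1)] by blast
      have "p < x + 1" using dvd_le[OF x(2) H(2)[OF x(1)]] by (simp add: less_add_one_iff)
      then show ?L using R HN[OF x(1)] x p pow3_N by blast
    qed
  qed
qed


section \<open>Arithmetical comprehension\<close>

text \<open>The entry \<open>e 0\<close> is the second component of the outermost pair, so a
  quantifier over the number variable 0 becomes a projection of a set of pairs.\<close>

primrec tuple :: "nat \<Rightarrow> (nat \<Rightarrow> 'a) \<Rightarrow> 'a" where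
  "tuple 0 e = 0"
| "tuple (Suc k) e = pr (tuple k (\<lambda>i. e (Suc i))) (e 0)"

lemma tuple_in: "range e \<subseteq> N \<Longrightarrow> tuple k e \<in> N"
proof (induction k arbitrary: e)
  case (Suc k)
  have "range (\<lambda>i. e (Suc i)) \<subseteq> N" "e 0 \<in> N" using Suc.prems by auto
  then show ?case using Suc.IH pr_in by simp
qed simp

lemma tuple_inject:
  "range e \<subseteq> N \<Longrightarrow> range f \<subseteq> N \<Longrightarrow> tuple k e = tuple k f \<Longrightarrow> i < k \<Longrightarrow> e i = f i"
proof (induction k arbitrary: e f i)
  case (Suc k)
  have r: "range (\<lambda>i. e (Suc i)) \<subseteq> N" "range (\<lambda>i. f (Suc i)) \<subseteq> N" "e 0 \<in> N" "f 0 \<in> N"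
    using Suc.prems by auto
  have "tuple k (\<lambda>i. e (Suc i)) = tuple k (\<lambda>i. f (Suc i)) \<and> e 0 = f 0"
    using Suc.prems(3) pr_inject[OF tuple_in[OF r(1)] r(3) tuple_in[OF r(2)] r(4)] by simp
  then show ?case using Suc.IH[OF r(1,2)] Suc.prems(4) by (cases i) auto
qed simp

text \<open>The components of a pair are at most its code, so unpacking a tuple of fixed length
  \<open>k\<close> takes only bounded quantifiers.\<close>

lemma delta0_decode:
  "delta0 R \<Longrightarrow> delta0 (\<lambda>e. \<exists>f. range f \<subseteq> N \<and> tuple k f = e 0 \<and> R (app k f e))"
proof (induction k arbitrary: R)
  case 0
  have "app 0 f e = e" for f e :: "nat \<Rightarrow> 'a" by (simp add: app_def)
  moreover have "\<exists>f :: nat \<Rightarrow> 'a. range f \<subseteq> N" using D_zero by (intro exI[of _ "\<lambda>_. 0"]) simp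
  ultimately have "(\<exists>f. range f \<subseteq> N \<and> tuple 0 f = e 0 \<and> R (app 0 f e)) \<longleftrightarrow> 0 = e 0 \<and> R e" for e
    by simp
  moreover have "delta0 (\<lambda>e. 0 = e 0 \<and> R e)"
    by (rule delta0_conj[OF delta0_eq[OF term_fun_const[OF D_zero] term_fun_var] 0])
  ultimately show ?case by simp
next
  case (Suc k)
  \<comment> \<open>With \<open>f\<close> in front, the environment reads: \<open>k\<close> entries
    of \<open>f\<close>, then \<open>b\<close>, then \<open>a\<close>, then \<open>e\<close>. The
    renaming fetches \<open>a\<close> for the variable 0, shifts the entries of \<open>f\<close> up
    by one and skips \<open>b\<close>.\<close>
  let ?\<pi> = "\<lambda>i. if i = 0 then Suc k else if i \<le> k then i - 1 else Suc i"
  define W where "W e \<longleftrightarrow> (\<exists>f. range f \<subseteq> N \<and> tuple k f = e 0 \<and> R (\<lambda>i. app k f e (?\<pi> i)))" for e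
  have W: "delta0 W" unfolding W_def by (rule Suc.IH[OF delta0_rename[OF Suc.prems]])
  have eta: "case_nat (e 0) (\<lambda>i. e (Suc i)) = e" for e :: "nat \<Rightarrow> 'a" by (auto split: nat.split)
  have eta': "case_nat (e 0) (case_nat (e (Suc 0)) (\<lambda>i. e (Suc (Suc i)))) = e" for e :: "nat \<Rightarrow> 'a"
    by (auto split: nat.split)
  have "delta0 (\<lambda>e. \<exists>a\<in>N. a < e 0 + 1 \<and> (\<exists>b\<in>N. b < e 0 + 1 \<and> pr b a = e 0 \<and> W (case_nat b (case_nat a e))))"
    by (intro delta0_ex delta0_conj delta0_eq term_fun_pr term_fun_intros) (simp add: eta' W)
  then show ?case
  proof (rule delta0_cong)
    fix e :: "nat \<Rightarrow> 'a" assume e: "range e \<subseteq> N"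
    have perm: "(\<lambda>i. app k f (case_nat b (case_nat a e)) (?\<pi> i)) = app (Suc k) (case_nat a f) e" for f a b
    proof
      fix i
      consider "i = 0" | j where "i = Suc j" "j < k" | j where "i = Suc (k + j)"
      proof (cases i)
        case (Suc j)
        then show ?thesis using that(2)[of j] that(3)[of "j - k"] by (cases "j < k") auto
      qed (use that(1) in simp)
      then show "app k f (case_nat b (case_nat a e)) (?\<pi> i) = app (Suc k) (case_nat a f) e i"
        by cases (auto simp: app_def Suc_diff_le)
    qed
    show "(\<exists>a\<in>N. a < e 0 + 1 \<and> (\<exists>b\<in>N. b < e 0 + 1 \<and> pr b a = e 0 \<and> W (case_nat b (case_nat a e)))) \<longleftrightarrow>
        (\<exists>f. range f \<subseteq> N \<and> tuple (Suc k) f = e 0 \<and> R (app (Suc k) f e))"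
    proof
      assume "\<exists>a\<in>N. a < e 0 + 1 \<and> (\<exists>b\<in>N. b < e 0 + 1 \<and> pr b a = e 0 \<and> W (case_nat b (case_nat a e)))"
      then obtain a b f where "a \<in> N" "pr b a = e 0" "range f \<subseteq> N" "tuple k f = b"
        "R (app (Suc k) (case_nat a f) e)" unfolding W_def perm by auto
      then show "\<exists>f. range f \<subseteq> N \<and> tuple (Suc k) f = e 0 \<and> R (app (Suc k) f e)"
        by (intro exI[of _ "case_nat a f"]) (auto simp: image_subset_iff split: nat.split)
    next
      assume "\<exists>f. range f \<subseteq> N \<and> tuple (Suc k) f = e 0 \<and> R (app (Suc k) f e)"
      then obtain f where f: "range f \<subseteq> N" "tuple (Suc k) f = e 0" "R (app (Suc k) f e)" by blast
      let ?f = "\<lambda>i. f (Suc i)"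
      have f': "range ?f \<subseteq> N" "f 0 \<in> N" using f(1) by auto
      have b: "tuple k ?f \<in> N" using tuple_in[OF f'(1)] .
      have "W (case_nat (tuple k ?f) (case_nat (f 0) e))"
        unfolding W_def perm using f' f(3) by (intro exI[of _ ?f]) (simp add: eta)
      moreover have "f 0 < e 0 + 1" "tuple k ?f < e 0 + 1"
        using pr_less1[OF b f'(2)] pr_less2[OF b f'(2)] f(2) by simp_all
      ultimately show "\<exists>a\<in>N. a < e 0 + 1 \<and> (\<exists>b\<in>N. b < e 0 + 1 \<and> pr b a = e 0 \<and> W (case_nat b (case_nat a e)))"
        using f(2) f'(2) b by auto
    qed
  qed
qed

lemma delta0_tuple_set:
  assumes R: "delta0 (\<lambda>e. sat {0..} S e v p)" and "boundN p \<le> k"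
  shows "\<exists>X\<in>S. \<forall>e. range e \<subseteq> N \<longrightarrow> (sat {0..} S e v p \<longleftrightarrow> tuple k e \<in> X)"
proof (intro bexI allI impI)
  have dep: "sat {0..} S e v p = sat {0..} S f v p" if "\<And>i. i < k \<Longrightarrow> e i = f i" for e f
    using that assms(2) by (intro sat_cong) auto
  let ?X = "{z\<in>N. \<exists>f. range f \<subseteq> N \<and> tuple k f = z \<and> sat {0..} S f v p}"
  have "sat {0..} S (app k f e) v p = sat {0..} S f v p" for f e by (rule dep) (simp add: app_def)
  then show "?X \<in> S"
    using delta0_decode[OF R, of k] by (intro delta0_comprehension) simp
  fix e :: "nat \<Rightarrow> 'a" assume e: "range e \<subseteq> N"
  show "sat {0..} S e v p \<longleftrightarrow> tuple k e \<in> ?X"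
  proof
    assume "sat {0..} S e v p"
    then show "tuple k e \<in> ?X" using e tuple_in[OF e] by blast
  next
    assume "tuple k e \<in> ?X"
    then obtain f where f: "range f \<subseteq> N" "tuple k f = tuple k e" "sat {0..} S f v p" by blast
    then show "sat {0..} S e v p" using dep[of f e] tuple_inject[OF f(1) e f(2)] by blast
  qed
qed

text \<open>For the quantifier step one set of the model must describe the truth of the subformula
  in all environments simultaneously; hence the tuples. There the universal quantifier is treated as
  the complement of the projection of a complement.\<close>

lemma arithmetical_tuple_set:
  "arithmetical p \<Longrightarrow> boundN p \<le> k \<Longrightarrow> range v \<subseteq> S \<Longrightarrow>
    \<exists>X\<in>S. \<forall>e. range e \<subseteq> N \<longrightarrow> (sat {0..} S e v p \<longleftrightarrow> tuple k e \<in> X)"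
proof (induction p arbitrary: k)
  case Fls
  show ?case by (rule delta0_tuple_set) (use Fls in \<open>simp_all add: delta0_False\<close>)
next
  case (Eq s t)
  show ?case by (rule delta0_tuple_set) (use Eq in \<open>simp_all add: delta0_eq term_fun_eval\<close>)
next
  case (Less s t)
  show ?case by (rule delta0_tuple_set) (use Less in \<open>simp_all add: delta0_less term_fun_eval\<close>)
next
  case (Mem t X)
  have "v X \<in> S" using Mem.prems(3) by blast
  then show ?case by (intro delta0_tuple_set) (use Mem in \<open>simp_all add: delta0_mem term_fun_eval\<close>)
next
  case (Imp p q)
  obtain X where X: "X \<in> S" "\<And>e. range e \<subseteq> N \<Longrightarrow> sat {0..} S e v p \<longleftrightarrow> tuple k e \<in> X"
    using Imp.IH(1)[of k] Imp.prems by auto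
  obtain Y where Y: "Y \<in> S" "\<And>e. range e \<subseteq> N \<Longrightarrow> sat {0..} S e v q \<longleftrightarrow> tuple k e \<in> Y"
    using Imp.IH(2)[of k] Imp.prems by auto
  have "{z\<in>N. z \<in> X \<longrightarrow> z \<in> Y} \<in> S" by (intro delta0_comprehension delta0_rules X Y)
  then show ?case using X(2) Y(2) tuple_in by (intro bexI[of _ "{z\<in>N. z \<in> X \<longrightarrow> z \<in> Y}"]) simp_all
next
  case (AllN p)
  obtain X where X: "X \<in> S" "\<And>e. range e \<subseteq> N \<Longrightarrow> sat {0..} S e v p \<longleftrightarrow> tuple (Suc k) e \<in> X"
  proof -
    have "arithmetical p" "boundN p \<le> Suc k" using AllN.prems by auto
    then show ?thesis using AllN.IH[OF _ _ AllN.prems(3)] that by blast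
  qed
  have "{z\<in>N. z \<notin> X} \<in> S" by (intro delta0_comprehension delta0_rules X)
  then have Y: "{m\<in>N. \<exists>t\<in>N. pr m t \<in> {z\<in>N. z \<notin> X}} \<in> S" (is "?Y \<in> S") by (rule projection)
  have "{z\<in>N. z \<notin> ?Y} \<in> S" by (intro delta0_comprehension delta0_rules Y)
  moreover have "sat {0..} S e v (AllN p) \<longleftrightarrow> tuple k e \<in> {z\<in>N. z \<notin> ?Y}" if e: "range e \<subseteq> N" for e
  proof -
    have "sat {0..} S (case_nat x e) v p \<longleftrightarrow> pr (tuple k e) x \<in> X" if "x \<in> N" for x
    proof -
      have "range (case_nat x e) \<subseteq> N" using that e by (auto simp: image_subset_iff split: nat.split)
      from X(2)[OF this] show ?thesis by simp
    qed
    then show ?thesis using tuple_in[OF e, of k] pr_in[OF tuple_in[OF e, of k]] by auto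
  qed
  ultimately show ?case by blast
next
  case (AllS p)
  then show ?case by simp
qed

lemma sat_comprehension_arithmetical:
  assumes "arithmetical p" and e: "range e \<subseteq> N" and v: "range v \<subseteq> S"
  shows "sat {0..} S e v (comprehension_for p)"
proof -
  \<comment> \<open>The successor guarantees an entry 0 that can vary; the code \<open>?a\<close> of
    the other entries is then a fixed parameter.\<close>
  obtain X where X: "X \<in> S"
    "\<And>e. range e \<subseteq> N \<Longrightarrow> sat {0..} S e v p \<longleftrightarrow> tuple (Suc (boundN p)) e \<in> X"
    using arithmetical_tuple_set[OF assms(1) le_SucI[OF order_refl] v] by blast
  let ?a = "tuple (boundN p) e"
  have "{x\<in>N. pr ?a x \<in> X} \<in> S"
    by (intro delta0_comprehension delta0_rules X tuple_in e)
  moreover have "x \<in> {x\<in>N. pr ?a x \<in> X} \<longleftrightarrow> sat {0..} S (case_nat x e) v p" if "x \<in> N" for x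
  proof -
    have "range (case_nat x e) \<subseteq> N" using that e by (auto simp: image_subset_iff split: nat.split)
    from X(2)[OF this] show ?thesis using that by simp
  qed
  ultimately show ?thesis unfolding sat_comprehension_for by blast
qed

lemma sat_ACA0: "p \<in> ACA0 \<Longrightarrow> sat {0..} S e v p"
proof -
  assume "p \<in> ACA0"
  then obtain q where p: "p = univ_closure q"
    and q: "q \<in> basic_axioms \<or> q = induction_for (Mem (Var 0) 0) \<or> (\<exists>r. q = comprehension_for r \<and> arithmetical r)"
    unfolding ACA0_def by blast
  have "sat {0..} S f w q" if f: "range f \<subseteq> N" and w: "range w \<subseteq> S" for f w
  proof -
    have "sat {0..} S f w (induction_for (Mem (Var 0) 0))"
    proof -
      have "w 0 \<in> S" using w by blast
      then have "delta0 (\<lambda>e. e 0 \<in> w 0)" by (intro delta0_rules)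
      then show ?thesis
        unfolding sat_induction_for using delta0_induct[of "\<lambda>x. x \<in> w 0"] by auto
    qed
    then show ?thesis using q sat_basic sat_comprehension_arithmetical f w by blast
  qed
  then show ?thesis unfolding p using S_nonempty by (subst sat_univ_closure) auto
qed

end

section \<open>The refuting model and the conclusion\<close>

abbreviation number_sets :: "number differences set set"
  where "number_sets \<equiv> (`) difference ` range number_set"

lemma sat_number_sets:
  assumes "boundN p = 0" and "boundS p = 0"
  shows "sat {0..} number_sets e v p \<longleftrightarrow> p \<in> refuting"
proof -
  have "sat {0..} number_sets e v p \<longleftrightarrow>
      sat {0..} number_sets (\<lambda>_. difference 0) (\<lambda>_. difference ` {}) p"
    by (rule sat_cong) (simp_all add: assms)
  then show ?thesis
    using sat_difference[of "range number_set" "\<lambda>_. 0" "\<lambda>_. {}" p] closed_refuting_iff_sat[OF assms] by simp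
qed

lemma discrete_rca_number_sets: "discrete_rca number_sets"
proof
  show "X \<subseteq> {0..}" if "X \<in> number_sets" for X
    using that unfolding range_difference[symmetric] by blast
  show "sat {0..} number_sets e v p" if "p \<in> RCA0" for p e v
  proof -
    have "boundN p = 0" "boundS p = 0"
      using that by (auto simp: RCA0_def boundN_univ_closure boundS_univ_closure)
    then show ?thesis using sat_number_sets that RCA0_refuting by blast
  qed
qed (auto simp: difference_discrete)

theorem theorem1:
  "\<forall>p \<in> ACA0. RCA0 \<turnstile> HT_le2 4 \<^bold>\<longrightarrow> p"
proof (rule ballI, rule ccontr)
  fix p assume "p \<in> ACA0" "\<not> RCA0 \<turnstile> HT_le2 4 \<^bold>\<longrightarrow> p"
  then obtain q where q: "HT_le2 4 \<in> refuting" "q \<in> ACA0" "q \<notin> refuting"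
    using refuting_counterexample by blast
  interpret discrete_rca number_sets by (rule discrete_rca_number_sets)
  interpret ht_rca number_sets
    by unfold_locales (simp add: sat_number_sets[OF boundN_HT_le2 boundS_HT_le2] q)
  have "boundN q = 0" "boundS q = 0"
    using q(2) by (auto simp: ACA0_def boundN_univ_closure boundS_univ_closure)
  then have "\<not> sat {0..} number_sets (\<lambda>_. 0) (\<lambda>_. {}) q" using sat_number_sets q(3) by blast
  then show False using sat_ACA0[OF q(2)] by blast
qed

end
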